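(* Let $2\le r<\infty$, $2^{r-1}\le n\le2^r-1$, let $Q^n=\prod_{k=1}^n[\mathsf a_k,b_k]$ with $-\infty\le\mathsf a_k<b_k\le\infty$, let $j=(j_1,\dots,j_n)$ be a vector of non-negative integers, $|j|=j_1+\dots+j_n$, and suppose that $f(t)\chi_{Q^n}(t)$ and $(\partial^{|j|}f(t)/\partial t_1^{j_1}\cdots\partial t_n^{j_n})\chi_{Q^n}(t)$ are originals with values in $\mathcal A_r$. Let $u$ be either the spherical kernel (S) or the Cartesian kernel (C). Then for $p\in W$ $$\mathcal F^n\big((\partial^{|j|}f/\partial t_1^{j_1}\cdots\partial t_n^{j_n})\chi_{Q^n},u;p;\zeta\big)=\mathsf R_{e_1}^{j_1}\mathsf R_{e_2}^{j_2}\cdots\mathsf R_{e_n}^{j_n}\mathcal F^n(f\chi_{Q^n},u;p;\zeta)$$ $$+\sum(-1)^{|(lj)|}\,\mathsf R_{e_1}^{m_1}\mathsf R_{e_2}^{m_2}\cdots\mathsf R_{e_n}^{m_n}\,\mathcal F^{n-|h(lj)|}\big((\partial^{|q|}f(t^{(lj)})/\partial t_1^{q_1}\cdots\partial t_n^{q_n})\,\chi_{\partial Q^n_{(lj)}}(t^{(lj)}),u;p;\zeta\big),$$ where the sum is over all $(l)\in\{0,1,2\}^n$ (with $l_k=0$ whenever $j_k=0$) and all integers $m_k,q_k\ge0$ such that $|(lj)|\ge1$ and, for each $k=1,\dots,n$, $h_k=\mathrm{sign}(l_kj_k)$, $m_k+q_k+h_k=j_k$, and $q_k=0$ if $l_kj_k=0$.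 Here for the spherical kernel $\mathsf R_{e_k}=p_0+p_1\mathsf S_{e_1}+\dots+p_k\mathsf S_{e_k}$, and for the Cartesian kernel $\mathsf R_{e_k}=p_0+p_k\mathsf S_{e_k}$, $k=1,\dots,n$, with $\mathsf S_{e_k}=-\partial/\partial\zeta_k$. If $t^{(lj)}_k=\pm\infty$ for some $k$, the corresponding addendum in the sum is zero.
   Context: Cayley–Dickson algebras: $\mathcal A_0=\mathbf R$ and $\mathcal A_{r+1}=\mathcal A_r\oplus\mathcal A_r\mathbf l$ with $(\xi+\eta\mathbf l)(\gamma+\delta\mathbf l)=(\xi\gamma-\delta^*\eta)+(\delta\xi+\eta\gamma^* )\mathbf l$, $(\xi+\eta\mathbf l)^*=\xi^*-\eta\mathbf l$. The standard basis of $\mathcal A_r$ is $i_0=1,i_1,\dots,i_{2^r-1}$, with $i_j^2=-1$, $i_ji_k=-i_ki_j$ for $j\ne k$, $j,k\ge1$. $\mathrm{Re}(z)=(z+z^* )/2$, $|z|^2=zz^*$, $\exp(z)=\sum_kz^k/k!$. Write $p=\sum_jp_ji_j$, $\zeta=\sum_j\zeta_ji_j$ with real $p_j,\zeta_j$. When $n<2^r-1$ one puts $p_m=\zeta_m=t_m=0$ for $m>n$. $\chi_U$ is the characteristic function of $U$. Originals: $f:\mathbf R^n\to\mathcal A_r$ is an original if (1) $f$ is continuous almost everywhere for the Lebesgue measure; (2) each partial function $t_j\mapsto f(t)$ has on each finite interval only finitely many discontinuities, all of the first kind; (3) each partial function $g_j(t_j)=f(t)$ satisfies, except possibly at its discontinuities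 of the first kind, a Hölder condition $|g_j(t_j+h)-g_j(t_j)|\le A_j|h|^{\alpha_j}$ for $|h|<\delta_j$, with constants $0<\alpha_j\le1$, $A_j,\delta_j>0$ (for the given $t$); (4) there are real $a_1(f),a_{-1}(f)$ and constants $C_v>0$ such that for each $v\in\{-1,1\}^n$, $|f(t)|<C_v\exp(\sum_ja_{v_j}t_j)$ whenever $v_jt_j\ge0$ for all $j$. Kernels: (C) Cartesian: $u(p,t;\zeta)=p_0(t_1+\dots+t_n)+\sum_{j=1}^np_jt_ji_j+\zeta$. (S) Spherical: with $s_j=t_j+\dots+t_n$, $K=2^r-1$, $\phi_j=p_js_j+\zeta_j$: $u=p_0s_1+M+\zeta_0$, $M=\phi_1[i_1\cos\phi_2+i_2\sin\phi_2\cos\phi_3+\dots+i_{K-1}\sin\phi_2\cdots\sin\phi_{K-1}\cos\phi_K+i_K\sin\phi_2\cdots\sin\phi_K]$. Notation for faces: for $(l)\in\{0,1,2\}^n$, $t^{(l)}_k=t_k$ if $l_k=0$, $t^{(l)}_k=\mathsf a_k$ if $l_k=1$, $t^{(l)}_k=b_k$ if $l_k=2$; $l_k=0$ if $\mathsf a_k=-\infty$ and $b_k=+\infty$. $(lj)=(l_1\mathrm{sign}(j_1),\dots,l_n\mathrm{sign}(j_n))$, $|(lj)|=\sum_kl_k\mathrm{sign}(j_k)$, $h(l)=(\mathrm{sign}(l_1),\dots,\mathrm{sign}(l_n))$, $|h|=\sum|h_k|$, $|q|=\sum q_k$, with $\mathrm{sign}(0)=0$. $\partial Q^n_{(l)}$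 is the face of $Q^n$ consisting of the points $t^{(l)}$ (coordinates with $l_k=0$ free in $(\mathsf a_k,b_k)$), of dimension $n-|h(l)|$; faces for different $(l)$ are disjoint. Transforms: $\mathcal F^n(f,u;p;\zeta)=\int_{\mathbf R^n}f(t)\exp(-u(p,t;\zeta))\,dt$; $\mathcal F^{n-|h(l)|}(g(t^{(l)})\chi_{\partial Q^n_{(l)}},u;p;\zeta)=\int_{\partial Q^n_{(l)}}g(t^{(l)})\exp(-u(p,t^{(l)};\zeta))\,dt^{(l)}$, the integral being over the free coordinates (and just the value $g(t^{(l)})e^{-u(p,t^{(l)};\zeta)}$ when $|h(l)|=n$). Domain $W$: put $a_1=\max(a_1(f),a_1(\partial^{|m|}f/\partial t_1^{m_1}\cdots\partial t_n^{m_n}):|m|\le|j|,0\le m_k\le j_k\ \forall k)$ and $a_{-1}=\min(a_{-1}(f),a_{-1}(\partial^{|m|}f/\partial t_1^{m_1}\cdots\partial t_n^{m_n}):|m|\le|j|,0\le m_k\le j_k\ \forall k)$. Then $W=\mathcal A_r$ if $Q^n$ is bounded; $W=\{p\in\mathcal A_r:a_1<\mathrm{Re}(p)\}$ if some $b_k=\infty$ and all $\mathsf a_k$ are finite; $W=\{p\in\mathcal A_r:\mathrm{Re}(p)<a_{-1}\}$ if some $\mathsf a_k=-\infty$ and all $b_k$ are finite; $W=\{p\in\mathcal A_r:a_1<\mathrm{Re}(p)<a_{-1}\}$ (with $a_1<a_{-1}$) if $\mathsf a_k=-\infty$ and $b_l=+\infty$ for some $k,l$. *)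

theory Defs
  imports "HOL-Analysis.Analysis"
begin

section \<open>Cayley--Dickson algebras\<close>

text \<open>
  Doubling on coordinate sequences. An element of \<open>A\<^sub>r\<close> occupies the positions \<open>0, \<dots>, 2 ^ r - 1\<close>;
  all other positions are irrelevant. In \<open>A\<^bsub>r + 1\<^esub> = A\<^sub>r \<oplus> A\<^sub>r l\<close> the component in \<open>A\<^sub>r l\<close> occupies the
  positions \<open>2 ^ r, \<dots>, 2 ^ (r + 1) - 1\<close>, so the standard basis is ordered by \<open>i\<^bsub>2 ^ r + k\<^esub> = i\<^sub>k l\<close>.
\<close>

fun cdc :: "nat \<Rightarrow> (nat \<Rightarrow> real) \<Rightarrow> nat \<Rightarrow> real" where
  "cdc 0 x = x"
| "cdc (Suc r) x = (\<lambda>k. if k < 2 ^ r then cdc r x k else - x k)"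

fun cdm :: "nat \<Rightarrow> (nat \<Rightarrow> real) \<Rightarrow> (nat \<Rightarrow> real) \<Rightarrow> nat \<Rightarrow> real" where
  "cdm 0 x y = (\<lambda>k. x 0 * y 0)"
| "cdm (Suc r) x y =
    (let \<xi> = x; \<eta> = (\<lambda>k. x (2 ^ r + k)); \<gamma> = y; \<delta> = (\<lambda>k. y (2 ^ r + k)) in
     (\<lambda>k. if k < 2 ^ r
          then cdm r \<xi> \<gamma> k - cdm r (cdc r \<delta>) \<eta> k
          else cdm r \<delta> \<xi> (k - 2 ^ r) + cdm r \<eta> (cdc r \<gamma>) (k - 2 ^ r)))"

text \<open>
  The underlying real vector space of \<open>A\<^sub>r\<close> is a Euclidean space \<open>'a\<close> of dimension \<open>2 ^ r\<close>. Its
  orthonormal basis is enumerated by \<open>e\<close>, with \<open>e k\<close> in the role of \<open>i\<^sub>k\<close> and in particular \<open>e 0\<close> in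
  the role of \<open>1\<close>. The coordinate \<open>z\<^sub>k\<close> is \<open>z \<bullet> e k\<close>.
\<close>

definition cd_basis :: "nat \<Rightarrow> (nat \<Rightarrow> 'a::euclidean_space) \<Rightarrow> bool" where
  "cd_basis r e \<longleftrightarrow> bij_betw e {..<2 ^ r} Basis"

definition cd_conj :: "nat \<Rightarrow> (nat \<Rightarrow> 'a::euclidean_space) \<Rightarrow> 'a \<Rightarrow> 'a" where
  "cd_conj r e z = (\<Sum>k<2 ^ r. cdc r (\<lambda>m. z \<bullet> e m) k *\<^sub>R e k)"

definition cd_mult :: "nat \<Rightarrow> (nat \<Rightarrow> 'a::euclidean_space) \<Rightarrow> 'a \<Rightarrow> 'a \<Rightarrow> 'a" where
  "cd_mult r e x y = (\<Sum>k<2 ^ r. cdm r (\<lambda>m. x \<bullet> e m) (\<lambda>m. y \<bullet> e m) k *\<^sub>R e k)"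

definition cd_Re :: "nat \<Rightarrow> (nat \<Rightarrow> 'a::euclidean_space) \<Rightarrow> 'a \<Rightarrow> real" where
  "cd_Re r e z = ((1 / 2) *\<^sub>R (z + cd_conj r e z)) \<bullet> e 0"

primrec cd_power :: "nat \<Rightarrow> (nat \<Rightarrow> 'a::euclidean_space) \<Rightarrow> 'a \<Rightarrow> nat \<Rightarrow> 'a" where
  "cd_power r e z 0 = e 0"
| "cd_power r e z (Suc k) = cd_mult r e z (cd_power r e z k)"

definition cd_exp :: "nat \<Rightarrow> (nat \<Rightarrow> 'a::euclidean_space) \<Rightarrow> 'a \<Rightarrow> 'a" where
  "cd_exp r e z = (\<Sum>k. (1 / fact k) *\<^sub>R cd_power r e z k)"

section \<open>Originals\<close>

text \<open>
  A point \<open>t = (t\<^sub>1, \<dots>, t\<^sub>n)\<close> of \<open>R\<^sup>n\<close> is an extensional function on \<open>{1..n}\<close>. For \<open>I = {1..n}\<close>,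
  \<open>lebesgue_on_coords I\<close> is the (complete) Lebesgue measure on \<open>R\<^sup>n\<close>. For smaller \<open>I\<close> it is the
  Lebesgue measure on the coordinates in \<open>I\<close>, and the Dirac measure of the only point if \<open>I = {}\<close>.
\<close>

abbreviation Rn :: "nat \<Rightarrow> (nat \<Rightarrow> real) set" where
  "Rn n \<equiv> {1..n} \<rightarrow>\<^sub>E UNIV"

definition lebesgue_on_coords :: "nat set \<Rightarrow> (nat \<Rightarrow> real) measure" where
  "lebesgue_on_coords I = completion (Pi\<^sub>M I (\<lambda>_. lborel))"

definition first_kind_discontinuity :: "(real \<Rightarrow> 'a::euclidean_space) \<Rightarrow> real \<Rightarrow> bool" where
  "first_kind_discontinuity g x \<longleftrightarrow>
     \<not> isCont g x \<and> (\<exists>L. (g \<longlongrightarrow> L) (at_left x)) \<and> (\<exists>L. (g \<longlongrightarrow> L) (at_right x))"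

text \<open>\<open>a1\<close> and \<open>am1\<close> are the exponents \<open>a\<^sub>1(f)\<close> and \<open>a\<^bsub>-1\<^esub>(f)\<close>.\<close>

definition growth :: "nat \<Rightarrow> real \<Rightarrow> real \<Rightarrow> ((nat \<Rightarrow> real) \<Rightarrow> 'a::euclidean_space) \<Rightarrow> bool" where
  "growth n a1 am1 f \<longleftrightarrow>
     (\<forall>v \<in> {1..n} \<rightarrow>\<^sub>E {-1, 1 :: real}. \<exists>C>0. \<forall>t \<in> Rn n.
        (\<forall>j\<in>{1..n}. v j * t j \<ge> 0) \<longrightarrow>
        norm (f t) < C * exp (\<Sum>j=1..n. (if v j = 1 then a1 else am1) * t j))"

definition original :: "nat \<Rightarrow> ((nat \<Rightarrow> real) \<Rightarrow> 'a::euclidean_space) \<Rightarrow> bool" where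
  "original n f \<longleftrightarrow>
     (AE t in lebesgue_on_coords {1..n}. continuous (at t within Rn n) f) \<and>
     (\<forall>t \<in> Rn n. \<forall>j\<in>{1..n}. let g = (\<lambda>x. f (t(j := x))) in
        \<forall>c d. finite {x\<in>{c..d}. \<not> isCont g x} \<and>
              (\<forall>x\<in>{c..d}. \<not> isCont g x \<longrightarrow> first_kind_discontinuity g x)) \<and>
     (\<forall>t \<in> Rn n. \<forall>j\<in>{1..n}. let g = (\<lambda>x. f (t(j := x))) in
        \<not> first_kind_discontinuity g (t j) \<longrightarrow>
        (\<exists>\<alpha> A \<delta>. 0 < \<alpha> \<and> \<alpha> \<le> 1 \<and> 0 < A \<and> 0 < \<delta> \<and>
           (\<forall>h. \<bar>h\<bar> < \<delta> \<longrightarrow> norm (g (t j + h) - g (t j)) \<le> A * \<bar>h\<bar> powr \<alpha>))) \<and>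
     (\<exists>a1 am1. growth n a1 am1 f)"

section \<open>Kernels and the operators \<open>R\<close>\<close>

datatype kernel = Spherical | Cartesian

definition u_cartesian ::
    "nat \<Rightarrow> (nat \<Rightarrow> 'a::euclidean_space) \<Rightarrow> 'a \<Rightarrow> (nat \<Rightarrow> real) \<Rightarrow> 'a \<Rightarrow> 'a" where
  "u_cartesian n e p t \<zeta> =
     ((p \<bullet> e 0) * (\<Sum>j=1..n. t j)) *\<^sub>R e 0 + (\<Sum>j=1..n. ((p \<bullet> e j) * t j) *\<^sub>R e j) + \<zeta>"

text \<open>The sum \<open>s\<^sub>j\<close> is empty for \<open>j > n\<close>, in accordance with \<open>t\<^sub>m = 0\<close> for \<open>m > n\<close>.\<close>

definition u_spherical ::
    "nat \<Rightarrow> nat \<Rightarrow> (nat \<Rightarrow> 'a::euclidean_space) \<Rightarrow> 'a \<Rightarrow> (nat \<Rightarrow> real) \<Rightarrow> 'a \<Rightarrow> 'a" where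
  "u_spherical r n e p t \<zeta> =
     (let K = 2 ^ r - 1;
          s = (\<lambda>j. \<Sum>k=j..n. t k);
          \<phi> = (\<lambda>j. (p \<bullet> e j) * s j + \<zeta> \<bullet> e j);
          M = \<phi> 1 *\<^sub>R ((\<Sum>k=1..K - 1. ((\<Prod>m=2..k. sin (\<phi> m)) * cos (\<phi> (k + 1))) *\<^sub>R e k)
                       + (\<Prod>m=2..K. sin (\<phi> m)) *\<^sub>R e K)
      in ((p \<bullet> e 0) * s 1) *\<^sub>R e 0 + M + (\<zeta> \<bullet> e 0) *\<^sub>R e 0)"

fun u_kernel ::
    "kernel \<Rightarrow> nat \<Rightarrow> nat \<Rightarrow> (nat \<Rightarrow> 'a::euclidean_space) \<Rightarrow> 'a \<Rightarrow> (nat \<Rightarrow> real) \<Rightarrow> 'a \<Rightarrow> 'a" where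
  "u_kernel Spherical r n e = u_spherical r n e"
| "u_kernel Cartesian r n e = u_cartesian n e"

definition S_op ::
    "(nat \<Rightarrow> 'a::euclidean_space) \<Rightarrow> nat \<Rightarrow> ('a \<Rightarrow> 'a) \<Rightarrow> 'a \<Rightarrow> 'a" where
  "S_op e k G \<zeta> = - vector_derivative (\<lambda>x. G (\<zeta> + x *\<^sub>R e k)) (at 0)"

fun R_op ::
    "kernel \<Rightarrow> (nat \<Rightarrow> 'a::euclidean_space) \<Rightarrow> 'a \<Rightarrow> nat \<Rightarrow> ('a \<Rightarrow> 'a) \<Rightarrow> 'a \<Rightarrow> 'a" where
  "R_op Spherical e p k G \<zeta> = (p \<bullet> e 0) *\<^sub>R G \<zeta> + (\<Sum>m=1..k. (p \<bullet> e m) *\<^sub>R S_op e m G \<zeta>)"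
| "R_op Cartesian e p k G \<zeta> = (p \<bullet> e 0) *\<^sub>R G \<zeta> + (p \<bullet> e k) *\<^sub>R S_op e k G \<zeta>"

text \<open>
  \<open>R_pow \<kappa> n e p m\<close> is \<open>R\<^sub>1 ^ m\<^sub>1 \<circ> \<dots> \<circ> R\<^sub>n ^ m\<^sub>n\<close>, acting on functions of \<open>\<zeta>\<close>.
\<close>

definition R_pow ::
    "kernel \<Rightarrow> nat \<Rightarrow> (nat \<Rightarrow> 'a::euclidean_space) \<Rightarrow> 'a \<Rightarrow> (nat \<Rightarrow> nat) \<Rightarrow> ('a \<Rightarrow> 'a) \<Rightarrow> 'a \<Rightarrow> 'a" where
  "R_pow \<kappa> n e p m = foldr (\<lambda>k. R_op \<kappa> e p k ^^ m k) [1..<Suc n]"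

section \<open>Boxes, partial derivatives and faces\<close>

definition box_Q :: "nat \<Rightarrow> (nat \<Rightarrow> ereal) \<Rightarrow> (nat \<Rightarrow> ereal) \<Rightarrow> (nat \<Rightarrow> real) set" where
  "box_Q n a b = {t \<in> Rn n. \<forall>k\<in>{1..n}. a k \<le> ereal (t k) \<and> ereal (t k) \<le> b k}"

text \<open>
  Partial derivatives are taken within the box. They are two-sided at interior points of the
  \<open>k\<close>-th edge and one-sided at its end points.
\<close>

definition edge :: "(nat \<Rightarrow> ereal) \<Rightarrow> (nat \<Rightarrow> ereal) \<Rightarrow> nat \<Rightarrow> real set" where
  "edge a b k = {x. a k \<le> ereal x \<and> ereal x \<le> b k}"

definition pderiv1 ::
    "(nat \<Rightarrow> ereal) \<Rightarrow> (nat \<Rightarrow> ereal) \<Rightarrow> nat \<Rightarrow> ((nat \<Rightarrow> real) \<Rightarrow> 'a::euclidean_space)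
      \<Rightarrow> (nat \<Rightarrow> real) \<Rightarrow> 'a" where
  "pderiv1 a b k f t = vector_derivative (\<lambda>x. f (t(k := x))) (at (t k) within edge a b k)"

text \<open>
  \<open>mpderiv n a b m f\<close> is \<open>\<partial>\<^sub>1 ^ m\<^sub>1 (\<dots> (\<partial>\<^sub>n ^ m\<^sub>n f))\<close>. The predicate \<open>mpderivs_exist n a b j f\<close> says
  that all of these iterated derivatives with \<open>m \<le> j\<close> exist at every point of the box: the one
  with \<open>m\<^sub>1 = \<dots> = m\<^bsub>k - 1\<^esub> = 0\<close> and \<open>m\<^sub>k < j\<^sub>k\<close> is the one to which \<open>\<partial>\<^sub>k\<close> is applied next.
\<close>

definition mpderiv ::
    "nat \<Rightarrow> (nat \<Rightarrow> ereal) \<Rightarrow> (nat \<Rightarrow> ereal) \<Rightarrow> (nat \<Rightarrow> nat)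
      \<Rightarrow> ((nat \<Rightarrow> real) \<Rightarrow> 'a::euclidean_space) \<Rightarrow> (nat \<Rightarrow> real) \<Rightarrow> 'a" where
  "mpderiv n a b m = foldr (\<lambda>k. pderiv1 a b k ^^ m k) [1..<Suc n]"

definition multi_le :: "nat \<Rightarrow> (nat \<Rightarrow> nat) \<Rightarrow> (nat \<Rightarrow> nat) set" where
  "multi_le n j = (\<Pi>\<^sub>E k\<in>{1..n}. {0..j k})"

definition mpderivs_exist ::
    "nat \<Rightarrow> (nat \<Rightarrow> ereal) \<Rightarrow> (nat \<Rightarrow> ereal) \<Rightarrow> (nat \<Rightarrow> nat)
      \<Rightarrow> ((nat \<Rightarrow> real) \<Rightarrow> 'a::euclidean_space) \<Rightarrow> bool" where
  "mpderivs_exist n a b j f \<longleftrightarrow>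
     (\<forall>m \<in> multi_le n j. \<forall>k\<in>{1..n}. m k < j k \<and> (\<forall>i\<in>{1..<k}. m i = 0) \<longrightarrow>
        (\<forall>t \<in> box_Q n a b.
           (\<lambda>x. mpderiv n a b m f (t(k := x))) differentiable (at (t k) within edge a b k)))"

definition restrict_Q ::
    "nat \<Rightarrow> (nat \<Rightarrow> ereal) \<Rightarrow> (nat \<Rightarrow> ereal) \<Rightarrow> ((nat \<Rightarrow> real) \<Rightarrow> 'a::euclidean_space)
      \<Rightarrow> (nat \<Rightarrow> real) \<Rightarrow> 'a" where
  "restrict_Q n a b f t = indicator (box_Q n a b) t *\<^sub>R f t"

definition sign0 :: "nat \<Rightarrow> nat" where
  "sign0 k = (if k = 0 then 0 else 1)"

text \<open>The face \<open>(l)\<close> is parametrised by its free coordinates, those \<open>k\<close> with \<open>l\<^sub>k = 0\<close>.\<close>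

definition free_coords :: "nat \<Rightarrow> (nat \<Rightarrow> nat) \<Rightarrow> nat set" where
  "free_coords n l = {k\<in>{1..n}. l k = 0}"

definition face_params ::
    "nat \<Rightarrow> (nat \<Rightarrow> ereal) \<Rightarrow> (nat \<Rightarrow> ereal) \<Rightarrow> (nat \<Rightarrow> nat) \<Rightarrow> (nat \<Rightarrow> real) set" where
  "face_params n a b l =
     {y \<in> free_coords n l \<rightarrow>\<^sub>E UNIV. \<forall>k\<in>free_coords n l. a k < ereal (y k) \<and> ereal (y k) < b k}"

definition face_point ::
    "nat \<Rightarrow> (nat \<Rightarrow> ereal) \<Rightarrow> (nat \<Rightarrow> ereal) \<Rightarrow> (nat \<Rightarrow> nat) \<Rightarrow> (nat \<Rightarrow> real) \<Rightarrow> nat \<Rightarrow> real" where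
  "face_point n a b l y =
     (\<lambda>k\<in>{1..n}. if l k = 0 then y k else if l k = 1 then real_of_ereal (a k)
                 else real_of_ereal (b k))"

definition face_finite ::
    "nat \<Rightarrow> (nat \<Rightarrow> ereal) \<Rightarrow> (nat \<Rightarrow> ereal) \<Rightarrow> (nat \<Rightarrow> nat) \<Rightarrow> bool" where
  "face_finite n a b l \<longleftrightarrow>
     (\<forall>k\<in>{1..n}. (l k = 1 \<longrightarrow> \<bar>a k\<bar> \<noteq> \<infinity>) \<and> (l k = 2 \<longrightarrow> \<bar>b k\<bar> \<noteq> \<infinity>))"

section \<open>Transforms\<close>

definition transform ::
    "kernel \<Rightarrow> nat \<Rightarrow> nat \<Rightarrow> (nat \<Rightarrow> 'a::euclidean_space) \<Rightarrow> ((nat \<Rightarrow> real) \<Rightarrow> 'a)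
      \<Rightarrow> 'a \<Rightarrow> 'a \<Rightarrow> 'a" where
  "transform \<kappa> r n e f p \<zeta> =
     (LINT t|lebesgue_on_coords {1..n}. cd_mult r e (f t) (cd_exp r e (- u_kernel \<kappa> r n e p t \<zeta>)))"

text \<open>The value \<open>0\<close> for a face at infinity is the convention made for the addenda of the sum.\<close>

definition face_transform ::
    "kernel \<Rightarrow> nat \<Rightarrow> nat \<Rightarrow> (nat \<Rightarrow> 'a::euclidean_space) \<Rightarrow> (nat \<Rightarrow> ereal) \<Rightarrow> (nat \<Rightarrow> ereal)
      \<Rightarrow> (nat \<Rightarrow> nat) \<Rightarrow> ((nat \<Rightarrow> real) \<Rightarrow> 'a) \<Rightarrow> 'a \<Rightarrow> 'a \<Rightarrow> 'a" where
  "face_transform \<kappa> r n e a b l g p \<zeta> =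
     (if face_finite n a b l
      then LINT y:face_params n a b l|lebesgue_on_coords (free_coords n l).
             cd_mult r e (g (face_point n a b l y))
               (cd_exp r e (- u_kernel \<kappa> r n e p (face_point n a b l y) \<zeta>))
      else 0)"

text \<open>\<open>A1\<close> and \<open>Am1\<close> are the numbers \<open>a\<^sub>1\<close> and \<open>a\<^bsub>-1\<^esub>\<close>.\<close>

definition domain_W ::
    "nat \<Rightarrow> nat \<Rightarrow> (nat \<Rightarrow> 'a::euclidean_space) \<Rightarrow> (nat \<Rightarrow> ereal) \<Rightarrow> (nat \<Rightarrow> ereal)
      \<Rightarrow> real \<Rightarrow> real \<Rightarrow> 'a set" where
  "domain_W r n e a b A1 Am1 =
     (if (\<forall>k\<in>{1..n}. a k \<noteq> - \<infinity>) \<and> (\<forall>k\<in>{1..n}. b k \<noteq> \<infinity>) then UNIV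
      else if \<forall>k\<in>{1..n}. a k \<noteq> - \<infinity> then {p. A1 < cd_Re r e p}
      else if \<forall>k\<in>{1..n}. b k \<noteq> \<infinity> then {p. cd_Re r e p < Am1}
      else {p. A1 < cd_Re r e p \<and> cd_Re r e p < Am1})"

definition lj :: "(nat \<Rightarrow> nat) \<Rightarrow> (nat \<Rightarrow> nat) \<Rightarrow> nat \<Rightarrow> nat" where
  "lj l j = (\<lambda>k. l k * sign0 (j k))"

definition addenda ::
    "nat \<Rightarrow> (nat \<Rightarrow> ereal) \<Rightarrow> (nat \<Rightarrow> ereal) \<Rightarrow> (nat \<Rightarrow> nat)
      \<Rightarrow> ((nat \<Rightarrow> nat) \<times> (nat \<Rightarrow> nat) \<times> (nat \<Rightarrow> nat)) set" where
  "addenda n a b j =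
     {(l, m, q). l \<in> {1..n} \<rightarrow>\<^sub>E {0, 1, 2} \<and> m \<in> {1..n} \<rightarrow>\<^sub>E UNIV \<and> q \<in> {1..n} \<rightarrow>\<^sub>E UNIV \<and>
        (\<forall>k\<in>{1..n}. j k = 0 \<longrightarrow> l k = 0) \<and>
        (\<forall>k\<in>{1..n}. a k = - \<infinity> \<and> b k = \<infinity> \<longrightarrow> l k = 0) \<and>
        1 \<le> (\<Sum>k=1..n. lj l j k) \<and>
        (\<forall>k\<in>{1..n}. m k + q k + sign0 (l k * j k) = j k \<and> (l k * j k = 0 \<longrightarrow> q k = 0))}"

section \<open>Consistency checks\<close>

lemma finite_addenda: "finite (addenda n a b j)"
proof (rule finite_subset)
  show "addenda n a b j \<subseteq> ({1..n} \<rightarrow>\<^sub>E {0, 1, 2}) \<times> multi_le n j \<times> multi_le n j"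
  proof
    fix x assume "x \<in> addenda n a b j"
    then obtain l m q where x: "x = (l, m, q)" and "(l, m, q) \<in> addenda n a b j"
      by (cases x) auto
    then have l: "l \<in> {1..n} \<rightarrow>\<^sub>E {0, 1, 2}" and mq: "m \<in> {1..n} \<rightarrow>\<^sub>E UNIV" "q \<in> {1..n} \<rightarrow>\<^sub>E UNIV"
      and s: "\<And>k. k \<in> {1..n} \<Longrightarrow> m k + q k + sign0 (l k * j k) = j k"
      by (simp_all add: addenda_def)
    have "m k \<le> j k \<and> q k \<le> j k" if "k \<in> {1..n}" for k using s[OF that] by linarith
    with l mq show "x \<in> ({1..n} \<rightarrow>\<^sub>E {0, 1, 2}) \<times> multi_le n j \<times> multi_le n j"
      by (simp add: x multi_le_def PiE_iff)
  qed
  show "finite (({1..n} \<rightarrow>\<^sub>E {0, 1, 2 :: nat}) \<times> multi_le n j \<times> multi_le n j)"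
    unfolding multi_le_def by (intro finite_cartesian_product finite_PiE) auto
qed

text \<open>
  In \<open>A\<^sub>r\<close> one has \<open>z z\<^sup>* = |z|\<^sup>2\<close> for the Euclidean norm, and \<open>e\<close> satisfies the relations of the
  standard basis.
\<close>

lemma cdc_nth: "cdc r x k = (if k = 0 \<or> r = 0 then x k else - x k)"
  by (induction r arbitrary: x) auto

lemma cdm_cong:
  "(\<And>i. i < 2 ^ r \<Longrightarrow> x i = x' i) \<Longrightarrow> (\<And>i. i < 2 ^ r \<Longrightarrow> y i = y' i) \<Longrightarrow> k < 2 ^ r
    \<Longrightarrow> cdm r x y k = cdm r x' y' k"
proof (induction r arbitrary: x x' y y' k)
  case (Suc r)
  have "cdm r x y i = cdm r x' y' i"
    "cdm r (cdc r (\<lambda>k. y (2 ^ r + k))) (\<lambda>k. x (2 ^ r + k)) i =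
     cdm r (cdc r (\<lambda>k. y' (2 ^ r + k))) (\<lambda>k. x' (2 ^ r + k)) i"
    "cdm r (\<lambda>k. y (2 ^ r + k)) x i = cdm r (\<lambda>k. y' (2 ^ r + k)) x' i"
    "cdm r (\<lambda>k. x (2 ^ r + k)) (cdc r y) i = cdm r (\<lambda>k. x' (2 ^ r + k)) (cdc r y') i"
    if "i < 2 ^ r" for i
    by (rule Suc.IH; use Suc.prems that in \<open>simp add: cdc_nth\<close>)+
  then show ?case using Suc.prems(3) by (simp add: Let_def)
qed auto

lemma cdm_add_scale:
  "cdm r (\<lambda>i. x i + c * x' i) y k = cdm r x y k + c * cdm r x' y k"
  "cdm r x (\<lambda>i. y i + c * y' i) k = cdm r x y k + c * cdm r x y' k"
proof (induction r arbitrary: x x' y y' k)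
  case (Suc r)
  have c: "cdc r (\<lambda>i. z i + c * z' i) = (\<lambda>i. cdc r z i + c * cdc r z' i)" for z z'
    by (auto simp: fun_eq_iff cdc_nth)
  { case 1 then show ?case by (simp add: Let_def Suc algebra_simps) }
  { case 2 then show ?case by (simp add: Let_def Suc c algebra_simps) }
qed (auto simp: algebra_simps)

lemma cdm_uminus: "cdm r x (\<lambda>i. - y i) k = - cdm r x y k"
  "cdm r (\<lambda>i. - x i) y k = - cdm r x y k"
proof -
  have "cdm r (\<lambda>_. 0) y k = 0" "cdm r x (\<lambda>_. 0) k = 0"
    using cdm_add_scale(1)[of r "\<lambda>_. 0" 1 "\<lambda>_. 0" y k] cdm_add_scale(2)[of r x "\<lambda>_. 0" 1 "\<lambda>_. 0" k]
    by auto
  then show "cdm r x (\<lambda>i. - y i) k = - cdm r x y k" "cdm r (\<lambda>i. - x i) y k = - cdm r x y k"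
    using cdm_add_scale(2)[of r x "\<lambda>_. 0" "-1" y k] cdm_add_scale(1)[of r "\<lambda>_. 0" "-1" x y k] by auto
qed

lemma sum_double: "(\<Sum>i<2 ^ Suc r. g i) = (\<Sum>i<2 ^ r. g i) + (\<Sum>i<2 ^ r. g (2 ^ r + i))"
  for g :: "nat \<Rightarrow> real"
proof -
  have "(\<Sum>i<2 ^ Suc r. g i) = (\<Sum>i<2 ^ r. g i) + (\<Sum>i\<in>{2 ^ r..<2 ^ Suc r}. g i)"
    by (subst sum.union_disjoint[symmetric]) (auto intro!: sum.cong)
  also have "(\<Sum>i\<in>{2 ^ r..<2 ^ Suc r}. g i) = (\<Sum>i<2 ^ r. g (2 ^ r + i))"
    by (rule sum.reindex_bij_witness[of _ "\<lambda>i. 2 ^ r + i" "\<lambda>i. i - 2 ^ r"]) auto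
  finally show ?thesis .
qed

lemma cdm_cdc:
  "k < 2 ^ r \<Longrightarrow> cdm r x (cdc r x) k = (if k = 0 then \<Sum>i<2 ^ r. (x i)\<^sup>2 else 0)"
  "k < 2 ^ r \<Longrightarrow> cdm r (cdc r x) x k = (if k = 0 then \<Sum>i<2 ^ r. (x i)\<^sup>2 else 0)"
proof (induction r arbitrary: x k)
  case (Suc r)
  have high:
    "cdm r (cdc r (\<lambda>k. cdc (Suc r) x (2 ^ r + k))) (\<lambda>k. x (2 ^ r + k)) i =
      - cdm r (cdc r (\<lambda>k. x (2 ^ r + k))) (\<lambda>k. x (2 ^ r + k)) i"
    "cdm r (cdc r (\<lambda>k. x (2 ^ r + k))) (\<lambda>k. cdc (Suc r) x (2 ^ r + k)) i =
      - cdm r (cdc r (\<lambda>k. x (2 ^ r + k))) (\<lambda>k. x (2 ^ r + k)) i"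
    "cdm r (\<lambda>k. cdc (Suc r) x (2 ^ r + k)) y i = - cdm r (\<lambda>k. x (2 ^ r + k)) y i"
    if "i < 2 ^ r" for x y i
      apply (subst cdm_uminus(2)[symmetric], rule cdm_cong; use that in \<open>simp add: cdc_nth\<close>)
     apply (subst cdm_uminus(1)[symmetric], rule cdm_cong; use that in \<open>simp add: cdc_nth\<close>)
    apply (subst cdm_uminus(2)[symmetric], rule cdm_cong; use that in \<open>simp add: cdc_nth\<close>)
    done
  have low: "cdm r x (cdc (Suc r) x) i = cdm r x (cdc r x) i"
    "cdm r (cdc (Suc r) x) x i = cdm r (cdc r x) x i"
    "cdm r y (cdc r (cdc (Suc r) x)) i = cdm r y x i"
    "cdm r y (cdc (Suc r) x) i = cdm r y (cdc r x) i"
    if "i < 2 ^ r" for x y i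
    by (rule cdm_cong; use that in \<open>simp add: cdc_nth\<close>)+
  { case 1
    then show ?case
      unfolding cdm.simps(2) Let_def sum_double[of _ r]
      by (simp add: low high Suc del: cdc.simps) }
  { case 2
    then show ?case
      unfolding cdm.simps(2) Let_def sum_double[of _ r]
      by (simp add: low high Suc del: cdc.simps) }
qed (auto simp: power2_eq_square)

lemma cd_mult_conj:
  assumes "cd_basis r e"
  shows "cd_mult r e z (cd_conj r e z) = (norm z)\<^sup>2 *\<^sub>R e 0"
proof -
  have inj: "inj_on e {..<2 ^ r}" and img: "e ` {..<2 ^ r} = Basis"
    using assms by (auto simp: cd_basis_def bij_betw_def)
  have ip: "e i \<bullet> e m = (if i = m then 1 else 0)" if "i < 2 ^ r" "m < 2 ^ r" for i m
    using that inj img by (subst inner_Basis) (auto dest: inj_onD)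
  have "cd_conj r e z \<bullet> e i = cdc r (\<lambda>m. z \<bullet> e m) i" if "i < 2 ^ r" for i
    using that by (simp add: cd_conj_def inner_sum_left ip if_distrib sum.delta cong: if_cong)
  then have "cd_mult r e z (cd_conj r e z) =
      (\<Sum>k<2 ^ r. cdm r (\<lambda>m. z \<bullet> e m) (cdc r (\<lambda>m. z \<bullet> e m)) k *\<^sub>R e k)"
    unfolding cd_mult_def by (intro sum.cong arg_cong2[of _ _ _ _ scaleR] cdm_cong) auto
  also have "\<dots> = (\<Sum>k<2 ^ r. (if k = 0 then \<Sum>i<2 ^ r. (z \<bullet> e i)\<^sup>2 else 0) *\<^sub>R e k)"
    by (intro sum.cong arg_cong2[of _ _ _ _ scaleR] cdm_cdc) auto
  also have "\<dots> = (\<Sum>i<2 ^ r. (z \<bullet> e i)\<^sup>2) *\<^sub>R e 0"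
    by (simp add: if_distrib[of "\<lambda>c. c *\<^sub>R _"] sum.delta cong: if_cong)
  also have "(\<Sum>i<2 ^ r. (z \<bullet> e i)\<^sup>2) = (\<Sum>b\<in>Basis. (z \<bullet> b)\<^sup>2)"
    unfolding img[symmetric] by (simp add: sum.reindex[OF inj])
  also have "\<dots> = (norm z)\<^sup>2"
    by (subst power2_norm_eq_inner, subst euclidean_inner) (simp add: power2_eq_square)
  finally show ?thesis .
qed

lemma cd_basis_square_and_anticommute:
  assumes e: "cd_basis r e" and k: "1 \<le> k" "k < 2 ^ r" and m: "1 \<le> m" "m < 2 ^ r"
  shows "cd_mult r e (e k) (e k) = - e 0"
    and "k \<noteq> m \<Longrightarrow> cd_mult r e (e k) (e m) = - cd_mult r e (e m) (e k)"
proof -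
  have inj: "inj_on e {..<2 ^ r}" and img: "e ` {..<2 ^ r} = Basis"
    using e by (auto simp: cd_basis_def bij_betw_def)
  have ip: "e i \<bullet> e m = (if i = m then 1 else 0)" if "i < 2 ^ r" "m < 2 ^ r" for i m
    using that inj img by (subst inner_Basis) (auto dest: inj_onD)
  have r: "r \<noteq> 0" using k by (cases r) auto
  have expand: "(\<Sum>i<2 ^ r. (z \<bullet> e i) *\<^sub>R e i) = z" for z
    using euclidean_representation[of z] unfolding img[symmetric] by (simp add: sum.reindex[OF inj])
  have conj: "cd_conj r e z = - z" if z: "z \<bullet> e 0 = 0" for z
  proof -
    have "cd_conj r e z = - (\<Sum>i<2 ^ r. (z \<bullet> e i) *\<^sub>R e i)"
      unfolding cd_conj_def sum_negf[symmetric] by (intro sum.cong) (auto simp: cdc_nth r z)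
    then show ?thesis by (simp add: expand)
  qed
  have sq: "cd_mult r e z z = - ((norm z)\<^sup>2 *\<^sub>R e 0)" if "z \<bullet> e 0 = 0" for z
  proof -
    have "cd_mult r e z (- z) = - cd_mult r e z z"
      by (simp add: cd_mult_def cdm_uminus sum_negf)
    then show ?thesis using cd_mult_conj[OF e, of z] conj[OF that] by (metis minus_minus)
  qed
  have add: "cd_mult r e (x + x') y = cd_mult r e x y + cd_mult r e x' y"
    "cd_mult r e y (x + x') = cd_mult r e y x + cd_mult r e y x'" for x x' y
    using cdm_add_scale(1)[of r _ 1] cdm_add_scale(2)[of r _ _ 1]
    by (simp_all add: cd_mult_def inner_add_left scaleR_add_left sum.distrib)
  have z: "e k \<bullet> e 0 = 0" "e m \<bullet> e 0 = 0" using k m by (auto simp: ip)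
  have n1: "(norm (e k))\<^sup>2 = 1" "(norm (e m))\<^sup>2 = 1"
    using k m by (simp_all add: power2_norm_eq_inner ip)
  show "cd_mult r e (e k) (e k) = - e 0" using sq[OF z(1)] n1 by simp
  assume "k \<noteq> m"
  then have "(norm (e k + e m))\<^sup>2 = 2"
    using k m by (simp add: power2_norm_eq_inner inner_add_left inner_add_right ip)
  then have "cd_mult r e (e k + e m) (e k + e m) = - (2 *\<^sub>R e 0)"
    using sq[of "e k + e m"] z by (simp add: inner_add_left)
  then show "cd_mult r e (e k) (e m) = - cd_mult r e (e m) (e k)"
    using sq[OF z(1)] sq[OF z(2)] n1 by (simp add: add scaleR_2 eq_neg_iff_add_eq_0 add.commute)
qed

end

theory Submission
  imports Defs
begin

text \<open>
  Both kernels have the form \<open>exp(-u) = w(t) \<Psi>(\<zeta> + \<tau>(t))\<close> with the scalar weight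
  \<open>w(t) = exp(-p\<^sub>0 (t\<^sub>1 + \<dots> + t\<^sub>n))\<close>, a linear map \<open>\<tau>\<close> with imaginary values and a smooth function \<open>\<Psi>\<close>
  all of whose derivatives grow subexponentially in the imaginary directions. The chain rule gives
  \<open>\<partial>exp(-u)/\<partial>t\<^sub>k = - R\<^sub>k exp(-u)\<close>. For \<open>p \<in> W\<close> the integrands decay exponentially on the box, so \<open>R\<^sub>k\<close> may be
  taken out of the integral, and one integration by parts in \<open>t\<^sub>k\<close> lowers the order of the derivative by
  one at the cost of the two faces \<open>t\<^sub>k = a\<^sub>k\<close> and \<open>t\<^sub>k = b\<^sub>k\<close>. Treating \<open>t\<^sub>1, \<dots>, t\<^sub>n\<close> in this order produces the
  operators \<open>R\<^sub>1, \<dots>, R\<^sub>n\<close> in the required order.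

  The derivatives of \<open>f\<close> are only assumed to exist in one order of differentiation. On the faces they
  are needed in another order; there the growth bounds make the difference quotients converge
  uniformly, so that the derivatives commute. Almost everywhere continuity of \<open>f\<close> says nothing about the
  lower-dimensional faces, on which measurability comes from continuity across the face.
\<close>

section \<open>Exponentials in Cayley--Dickson algebras\<close>

text \<open>The algebra need not be associative, but only products of a value of f with one
  exponential occur. So two facts suffice: multiplication is bounded bilinear, and an exponential
  lies in a plane R + R y isomorphic to the complex numbers. The R_k have real coefficients and act
  on zeta, hence on the right factor. The norm |v| of an imaginary v is not smooth at 0; the
  Cartesian kernel is therefore written with entire functions of |v|^2. Subexponential growth is the
  right condition because W restricts only Re(p): zeta + tau(t) moves linearly in t at a speed that
  nothing bounds, while the gap between Re(p) and a_1 or a_{-1} may be arbitrarily small. Exchanging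
  d/dt_k with d/dt_i uses a bound on a derivative with one more order in t_i. The expansion leaves
  that order free: a variable already treated has q_i = 0 or q_i < j_i. \<open>S_op\<close> is
  linear only on differentiable functions, so the iterated operators are applied inside the span of
  the face transforms, which they preserve.\<close>

lemma cdm_zero: "cdm r (\<lambda>_. 0) y k = 0" "cdm r x (\<lambda>_. 0) k = 0"
  using cdm_add_scale(1)[of r "\<lambda>_. 0" 1 "\<lambda>_. 0" y k] cdm_add_scale(2)[of r x "\<lambda>_. 0" 1 "\<lambda>_. 0" k]
  by auto

text \<open>The two unit laws go up together: the summand \<delta>\<xi> of the doubled product turns
  a left unit into a right one.\<close>

lemma cdm_one:
  assumes "k < 2 ^ r"
  shows "cdm r (\<lambda>i. if i = 0 then 1 else 0) y k = y k"
    and "cdm r y (\<lambda>i. if i = 0 then 1 else 0) k = y k"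
  using assms
proof (induction r arbitrary: y k)
  case (Suc r)
  have c: "cdc r (\<lambda>i. if i = 0 then 1 else (0::real)) = (\<lambda>i. if i = 0 then 1 else 0)"
    by (auto simp: fun_eq_iff cdc_nth)
  have c0: "cdc r (\<lambda>_. 0) = (\<lambda>_. 0)"
    by (auto simp: fun_eq_iff cdc_nth)
  { case 1 then show ?case by (simp add: Let_def Suc cdm_zero) }
  { case 2 then show ?case by (simp add: Let_def Suc cdm_zero c c0) }
qed auto

locale cayley_dickson =
  fixes r :: nat and e :: "nat \<Rightarrow> 'a::euclidean_space"
  assumes r_ge_2: "2 \<le> r" and basis: "cd_basis r e"
begin

lemma inner_e: "i < 2 ^ r \<Longrightarrow> m < 2 ^ r \<Longrightarrow> e i \<bullet> e m = (if i = m then 1 else 0)"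
  using basis by (subst inner_Basis) (auto simp: cd_basis_def bij_betw_def dest: inj_onD)

lemma e_expand: "(\<Sum>i<2 ^ r. (z \<bullet> e i) *\<^sub>R e i) = z"
proof -
  have inj: "inj_on e {..<2 ^ r}" and img: "e ` {..<2 ^ r} = Basis"
    using basis by (auto simp: cd_basis_def bij_betw_def)
  show ?thesis
    using euclidean_representation[of z] unfolding img[symmetric] by (simp add: sum.reindex[OF inj])
qed

lemma e_eqI: "(\<And>k. k < 2 ^ r \<Longrightarrow> x \<bullet> e k = y \<bullet> e k) \<Longrightarrow> x = y"
  by (subst (1 2) e_expand[symmetric]) simp

lemma inner_sum_e: "k < 2 ^ r \<Longrightarrow> (\<Sum>i<2 ^ r. c i *\<^sub>R e i) \<bullet> e k = c k"
  by (simp add: inner_sum_left inner_e if_distrib sum.delta cong: if_cong)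

lemma cd_mult_inner: "k < 2 ^ r \<Longrightarrow> cd_mult r e x y \<bullet> e k = cdm r (\<lambda>m. x \<bullet> e m) (\<lambda>m. y \<bullet> e m) k"
  unfolding cd_mult_def by (rule inner_sum_e)

lemma cd_mult_add_left: "cd_mult r e (x + x') y = cd_mult r e x y + cd_mult r e x' y"
  and cd_mult_add_right: "cd_mult r e y (x + x') = cd_mult r e y x + cd_mult r e y x'"
  using cdm_add_scale(1)[of r _ 1] cdm_add_scale(2)[of r _ _ 1]
  by (simp_all add: cd_mult_def inner_add_left scaleR_add_left sum.distrib)

lemma cd_mult_scaleR_left: "cd_mult r e (c *\<^sub>R x) y = c *\<^sub>R cd_mult r e x y"
  and cd_mult_scaleR_right: "cd_mult r e x (c *\<^sub>R y) = c *\<^sub>R cd_mult r e x y"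
  using cdm_add_scale(1)[of r "\<lambda>_. 0" c] cdm_add_scale(2)[of r _ "\<lambda>_. 0" c]
  by (simp_all add: cd_mult_def scaleR_sum_right cdm_zero)

lemma bounded_bilinear_cd_mult: "bounded_bilinear (cd_mult r e)"
  by (intro bilinear_conv_bounded_bilinear[THEN iffD1])
    (auto simp: bilinear_def linear_iff cd_mult_add_left cd_mult_add_right
      cd_mult_scaleR_left cd_mult_scaleR_right)

lemma inner_e0: "m < 2 ^ r \<Longrightarrow> e 0 \<bullet> e m = (if m = 0 then 1 else 0)"
  by (auto simp: inner_e)

lemma cd_mult_e0: "cd_mult r e (e 0) y = y" "cd_mult r e y (e 0) = y"
proof -
  show "cd_mult r e (e 0) y = y"
  proof (rule e_eqI)
    fix k :: nat assume k: "k < 2 ^ r"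
    have "cdm r (\<lambda>m. e 0 \<bullet> e m) (\<lambda>m. y \<bullet> e m) k
        = cdm r (\<lambda>i. if i = 0 then 1 else 0) (\<lambda>m. y \<bullet> e m) k"
      by (rule cdm_cong) (use k in \<open>auto simp: inner_e0\<close>)
    then show "cd_mult r e (e 0) y \<bullet> e k = y \<bullet> e k" by (simp add: cd_mult_inner k cdm_one)
  qed
  show "cd_mult r e y (e 0) = y"
  proof (rule e_eqI)
    fix k :: nat assume k: "k < 2 ^ r"
    have "cdm r (\<lambda>m. y \<bullet> e m) (\<lambda>m. e 0 \<bullet> e m) k
        = cdm r (\<lambda>m. y \<bullet> e m) (\<lambda>i. if i = 0 then 1 else 0) k"
      by (rule cdm_cong) (use k in \<open>auto simp: inner_e0\<close>)
    then show "cd_mult r e y (e 0) \<bullet> e k = y \<bullet> e k" by (simp add: cd_mult_inner k cdm_one)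
  qed
qed

lemma cd_conj_imaginary:
  assumes "z \<bullet> e 0 = 0"
  shows "cd_conj r e z = - z"
proof -
  have "cd_conj r e z = - (\<Sum>i<2 ^ r. (z \<bullet> e i) *\<^sub>R e i)"
    unfolding cd_conj_def sum_negf[symmetric]
    using r_ge_2 by (intro sum.cong) (auto simp: cdc_nth assms)
  then show ?thesis by (simp add: e_expand)
qed

lemma cd_Re_eq: "cd_Re r e z = z \<bullet> e 0"
  using inner_sum_e[of 0 "cdc r (\<lambda>m. z \<bullet> e m)"]
  by (simp add: cd_Re_def cd_conj_def inner_add_left cdc_nth)

text \<open>The conjugate of an imaginary y is -y, so the norm identity y y^* = |y|^2 reads y^2 =
  -1.\<close>

lemma cd_square_imaginary:
  assumes "y \<bullet> e 0 = 0" "norm y = 1"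
  shows "cd_mult r e y y = - e 0"
proof -
  have "cd_mult r e y (- y) = - cd_mult r e y y"
    using cd_mult_scaleR_right[of y "-1" y] by simp
  then show ?thesis
    using cd_mult_conj[OF basis, of y] cd_conj_imaginary[OF assms(1)] assms(2)
    by (metis minus_minus one_power2 scaleR_one)
qed

text \<open>The span of 1 and an imaginary unit is a copy of the complex numbers.\<close>

lemma cd_power_complex:
  assumes "y \<bullet> e 0 = 0" "norm y = 1"
  shows "cd_power r e (Re w *\<^sub>R e 0 + Im w *\<^sub>R y) k = Re (w ^ k) *\<^sub>R e 0 + Im (w ^ k) *\<^sub>R y"
proof (induction k)
  case (Suc k)
  show ?case
    unfolding cd_power.simps Suc
    by (simp add: cd_mult_add_left cd_mult_add_right cd_mult_scaleR_left cd_mult_scaleR_right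
        cd_mult_e0 cd_square_imaginary[OF assms] algebra_simps)
qed auto

text \<open>The real-linear embedding \<open>L\<close> of the complex numbers with i mapped to y is
  continuous, so it carries the exponential series of w term by term to that of the algebra.\<close>

lemma cd_exp_complex:
  assumes "y \<bullet> e 0 = 0" "norm y = 1"
  shows "cd_exp r e (c *\<^sub>R e 0 + \<rho> *\<^sub>R y) = exp c *\<^sub>R (cos \<rho> *\<^sub>R e 0 + sin \<rho> *\<^sub>R y)"
proof -
  define w where "w = Complex c \<rho>"
  define L where "L = (\<lambda>w. Re w *\<^sub>R e 0 + Im w *\<^sub>R y)"
  have bl: "bounded_linear L"
    unfolding L_def by (intro bounded_linear_intros bounded_linear_Re bounded_linear_Im)
  have "(\<lambda>k. (1 / fact k) *\<^sub>R w ^ k) sums exp w"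
    using exp_converges[of w] by (simp add: field_simps inverse_eq_divide)
  then have "(\<lambda>k. L ((1 / fact k) *\<^sub>R w ^ k)) sums L (exp w)"
    by (rule bounded_linear.sums[OF bl])
  moreover have "L ((1 / fact k) *\<^sub>R w ^ k) = (1 / fact k) *\<^sub>R cd_power r e (c *\<^sub>R e 0 + \<rho> *\<^sub>R y) k" for k
    using cd_power_complex[OF assms, of w k] linear_cmul[OF bounded_linear.linear[OF bl], of "1 / fact k" "w ^ k"]
    by (simp add: w_def L_def)
  ultimately have "cd_exp r e (c *\<^sub>R e 0 + \<rho> *\<^sub>R y) = L (exp w)"
    unfolding cd_exp_def by (simp add: sums_iff)
  then show ?thesis
    by (simp add: L_def w_def Re_exp Im_exp algebra_simps)
qed

end

section \<open>The entire functions behind \<open>cos\<close> of a square root\<close>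

text \<open>The m-th derivative of s \<mapsto> cos(sqrt s), taken formally on the power series. The
  series is entire, so s = 0, where the square root is not differentiable, is an ordinary
  point.\<close>

definition psi :: "nat \<Rightarrow> real \<Rightarrow> real" where
  "psi m s = (\<Sum>i. (diffs ^^ m) (\<lambda>i. (-1) ^ i / fact (2 * i)) i * s ^ i)"

text \<open>Since (2i)! \<ge> i!, the series of exp |s| dominates; termwise differentiation keeps
  convergence on the whole line.\<close>

lemma summable_psi: "summable (\<lambda>i. (diffs ^^ m) (\<lambda>i. (-1) ^ i / fact (2 * i)) i * (s::real) ^ i)"
proof (induction m arbitrary: s)
  case 0
  have "norm ((-1) ^ i / fact (2 * i) * s ^ i) \<le> inverse (fact i) * \<bar>s\<bar> ^ i" for i
  proof -
    have "fact i \<le> (fact (2 * i) :: real)" by (rule fact_mono) auto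
    then have "inverse (fact (2 * i)) \<le> (inverse (fact i) :: real)"
      by (intro le_imp_inverse_le) auto
    then have "inverse (fact (2 * i)) * \<bar>s\<bar> ^ i \<le> inverse (fact i) * \<bar>s\<bar> ^ i"
      by (rule mult_right_mono) auto
    moreover have "norm ((-1) ^ i / fact (2 * i) * s ^ i) = inverse (fact (2 * i)) * \<bar>s\<bar> ^ i"
      unfolding real_norm_def abs_mult abs_divide power_abs by (simp add: inverse_eq_divide)
    ultimately show ?thesis by (rule ord_eq_le_trans[rotated])
  qed
  then show ?case
    unfolding funpow_0
    by (intro summable_comparison_test[OF _ summable_exp[of "\<bar>s\<bar>"]]) auto
next
  case (Suc m)
  show ?case
    unfolding funpow.simps o_apply by (rule termdiff_converges_all[OF Suc])
qed

lemma DERIV_psi: "(psi m has_real_derivative psi (Suc m) s) (at s)"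
  unfolding psi_def using termdiffs_strong_converges_everywhere[OF summable_psi[of m]] by simp

lemma psi_0: "s \<ge> 0 \<Longrightarrow> psi 0 s = cos (sqrt s)"
  using cos_paired[of "sqrt s"] by (simp add: psi_def sums_iff power_mult)

text \<open>Near each s > 0 the function \<open>psi 0\<close> coincides with cos(sqrt s), so the
  derivatives coincide. Hence 2 \<open>psi 1\<close> (|v|^2) = - sin |v| / |v|, the second function
  in the Cartesian kernel.\<close>

lemma psi_1:
  assumes "s > 0" shows "psi (Suc 0) s = - sin (sqrt s) / (2 * sqrt s)"
proof -
  have "((\<lambda>s. cos (sqrt s)) has_real_derivative - sin (sqrt s) / (2 * sqrt s)) (at s)"
    using assms by (auto intro!: derivative_eq_intros simp: field_simps)
  then have "(psi 0 has_real_derivative - sin (sqrt s) / (2 * sqrt s)) (at s)"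
    by (rule DERIV_cong_ev[THEN iffD1, rotated -1, OF _ refl _ refl])
      (use assms in \<open>auto intro!: eventually_mono[OF eventually_nhds_in_open[of "{0<..}"]] simp: psi_0\<close>)
  then show ?thesis using DERIV_psi[of 0 s] by (auto dest: DERIV_unique)
qed

text \<open>Cleared of the denominator because it serves as the case m = 0 of the differential
  equation.\<close>

lemma psi_2:
  assumes "s > 0" shows "4 * s * psi 2 s = - cos (sqrt s) + sin (sqrt s) / sqrt s"
proof -
  have "((\<lambda>s. - sin (sqrt s) / (2 * sqrt s)) has_real_derivative
      (- cos (sqrt s) + sin (sqrt s) / sqrt s) / (4 * s)) (at s)"
  proof -
    define t where "t = sqrt s"
    have t: "t > 0" "s = t * t" using assms by (auto simp: t_def)
    have "((\<lambda>s. - sin (sqrt s) / (2 * sqrt s)) has_real_derivative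
      (- (cos t * (inverse t / 2)) * (2 * t) - - sin t * (2 * (inverse t / 2))) / (2 * t * (2 * t))) (at s)"
      unfolding t_def using assms by (auto intro!: derivative_eq_intros simp: field_simps)
    also have "(- (cos t * (inverse t / 2)) * (2 * t) - - sin t * (2 * (inverse t / 2))) / (2 * t * (2 * t))
      = (- cos t + sin t / t) / (4 * s)"
      using t(1) unfolding t(2) by (simp add: field_simps)
    finally show ?thesis by (simp add: t_def)
  qed
  then have "(psi (Suc 0) has_real_derivative (- cos (sqrt s) + sin (sqrt s) / sqrt s) / (4 * s)) (at s)"
    by (rule DERIV_cong_ev[THEN iffD1, rotated -1, OF _ refl _ refl])
      (use assms in \<open>auto intro!: eventually_mono[OF eventually_nhds_in_open[of "{0<..}"]] simp: psi_1\<close>)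
  then have "psi 2 s = (- cos (sqrt s) + sin (sqrt s) / sqrt s) / (4 * s)"
    using DERIV_psi[of "Suc 0" s] by (auto dest: DERIV_unique simp: numeral_2_eq_2)
  then show ?thesis using assms by simp
qed

text \<open>The differential equation of \<open>cos (sqrt s)\<close>, differentiated \<open>m\<close> times, bounds each derivative
  at infinity by the two preceding ones.\<close>

lemma psi_ode: "s > 0 \<Longrightarrow> 4 * s * psi (m + 2) s + (4 * real m + 2) * psi (m + 1) s + psi m s = 0"
proof (induction m arbitrary: s)
  case 0
  have "2 * psi (Suc 0) s = - sin (sqrt s) / sqrt s" using psi_1[OF 0] by simp
  then show ?case using psi_0[of s] psi_2[OF 0] 0 by (simp add: numeral_2_eq_2)
next
  case (Suc m)
  let ?E = "\<lambda>s. 4 * s * psi (m + 2) s + (4 * real m + 2) * psi (m + 1) s + psi m s"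
  \<comment> \<open>Differentiating the factor 4 s adds 4 to the middle coefficient, and 4 m + 6 = 4
    (m + 1) + 2.\<close>
  have "(?E has_real_derivative (4 * psi (m + 2) s + 4 * s * psi (Suc (m + 2)) s
     + (4 * real m + 2) * psi (Suc (m + 1)) s + psi (Suc m) s)) (at s)"
    by (auto intro!: derivative_eq_intros DERIV_psi)
  moreover have "(?E has_real_derivative 0) (at s)"
    by (rule DERIV_cong_ev[THEN iffD1, rotated -1, OF DERIV_const[of 0] refl _ refl])
      (use Suc.prems Suc.IH in \<open>auto intro!: eventually_mono[OF eventually_nhds_in_open[of "{0<..}"]] simp: add.commute\<close>)
  ultimately have "4 * psi (m + 2) s + 4 * s * psi (Suc (m + 2)) s
     + (4 * real m + 2) * psi (Suc (m + 1)) s + psi (Suc m) s = 0"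
    by (rule DERIV_unique)
  then show ?case by (simp add: algebra_simps)
qed

text \<open>Compactness settles [0, 1]. For s \<ge> 1 the factor 4 s of the equation is at least 1
  and may be dropped; the induction carries two consecutive orders because the equation has order
  two.\<close>

lemma psi_bounded: "\<exists>B. \<forall>s\<ge>0. \<bar>psi m s\<bar> \<le> B"
proof -
  have loc: "\<exists>B. \<forall>s\<in>{0..1}. \<bar>psi m s\<bar> \<le> B" for m
  proof -
    have "continuous_on {0..1} (psi m)"
      by (intro continuous_at_imp_continuous_on ballI DERIV_isCont[OF DERIV_psi])
    then have "bounded (psi m ` {0..1})"
      by (intro compact_imp_bounded compact_continuous_image) auto
    then show ?thesis by (auto simp: bounded_iff)
  qed
  have "\<exists>B. \<forall>s\<ge>1. \<bar>psi m s\<bar> \<le> B \<and> \<bar>psi (Suc m) s\<bar> \<le> B"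
  proof (induction m)
    case 0
    have "\<bar>psi 1 s\<bar> \<le> 1" if "s \<ge> 1" for s
    proof -
      have "\<bar>sin (sqrt s)\<bar> \<le> 1" "1 \<le> sqrt s" using that by auto
      then have "\<bar>sin (sqrt s)\<bar> \<le> 2 * sqrt s" by linarith
      then show ?thesis using that by (simp add: psi_1 abs_divide abs_mult)
    qed
    then show ?case by (intro exI[of _ 1]) (auto simp: psi_0)
  next
    case (Suc m)
    then obtain B where B: "\<And>s. s \<ge> 1 \<Longrightarrow> \<bar>psi m s\<bar> \<le> B \<and> \<bar>psi (Suc m) s\<bar> \<le> B" by blast
    have "\<bar>psi (Suc (Suc m)) s\<bar> \<le> (4 * real m + 3) * B" if "s \<ge> 1" for s
    proof -
      have eq: "4 * s * psi (m + 2) s = - ((4 * real m + 2) * psi (m + 1) s + psi m s)"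
        using psi_ode[of s m] that by linarith
      have "4 * s * \<bar>psi (m + 2) s\<bar> = \<bar>4 * s * psi (m + 2) s\<bar>"
        using that by (simp add: abs_mult)
      also have "\<dots> = \<bar>(4 * real m + 2) * psi (m + 1) s + psi m s\<bar>"
        unfolding eq by (rule abs_minus_cancel)
      also have "\<dots> \<le> (4 * real m + 2) * \<bar>psi (m + 1) s\<bar> + \<bar>psi m s\<bar>"
        by (rule order_trans[OF abs_triangle_ineq]) (simp add: abs_mult)
      also have "\<dots> \<le> (4 * real m + 2) * B + B"
        using B[OF that] by (intro add_mono mult_left_mono) auto
      finally have *: "4 * s * \<bar>psi (m + 2) s\<bar> \<le> (4 * real m + 3) * B" by (simp add: algebra_simps)
      have "1 * \<bar>psi (m + 2) s\<bar> \<le> 4 * s * \<bar>psi (m + 2) s\<bar>"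
        using that by (intro mult_right_mono) auto
      then show ?thesis using * by simp
    qed
    then have "\<bar>psi (Suc m) s\<bar> \<le> max B ((4 * real m + 3) * B) \<and> \<bar>psi (Suc (Suc m)) s\<bar> \<le> max B ((4 * real m + 3) * B)"
      if "s \<ge> 1" for s using B[OF that] that by (auto simp: le_max_iff_disj)
    then show ?case by meson
  qed
  then obtain B where B: "\<And>s. s \<ge> 1 \<Longrightarrow> \<bar>psi m s\<bar> \<le> B" by blast
  obtain B' where "\<And>s. s \<in> {0..1} \<Longrightarrow> \<bar>psi m s\<bar> \<le> B'" using loc[of m] by blast
  with B have "\<bar>psi m s\<bar> \<le> max B B'" if "s \<ge> 0" for s
    using that by (cases "s \<ge> 1") (auto simp: le_max_iff_disj)
  then show ?thesis by blast
qed

lemma has_derivative_psi [derivative_intros]: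
  "(g has_derivative g') (at x within S) \<Longrightarrow>
    ((\<lambda>x. psi m (g x)) has_derivative (\<lambda>h. psi (Suc m) (g x) * g' h)) (at x within S)"
  using DERIV_compose_FDERIV[OF DERIV_psi] by (simp add: mult.commute)

section \<open>Symbols\<close>

context cayley_dickson
begin

definition imag_sq where "imag_sq z = (\<Sum>k=1..<2 ^ r. (z \<bullet> e k)\<^sup>2)"

text \<open>An algebra of functions that is closed under partial derivatives and contains the coordinates of
  both kernels, up to a translation of the argument. Fixing \<open>z \<bullet> e 0\<close> leaves only the
  imaginary directions, in which the growth is subexponential.\<close>

inductive symbol :: "('a \<Rightarrow> real) \<Rightarrow> bool" where
  const: "symbol (\<lambda>_. c)"
| coord: "k < 2 ^ r \<Longrightarrow> symbol (\<lambda>z. z \<bullet> e k)"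
| sin: "k < 2 ^ r \<Longrightarrow> symbol (\<lambda>z. sin (z \<bullet> e k))"
| cos: "k < 2 ^ r \<Longrightarrow> symbol (\<lambda>z. cos (z \<bullet> e k))"
| exp: "symbol (\<lambda>z. exp (- (z \<bullet> e 0)))"
| psi: "symbol (\<lambda>z. psi m (imag_sq z))"
| add: "symbol F \<Longrightarrow> symbol G \<Longrightarrow> symbol (\<lambda>z. F z + G z)"
| mult: "symbol F \<Longrightarrow> symbol G \<Longrightarrow> symbol (\<lambda>z. F z * G z)"

lemma symbol_prod: "(\<And>i. i \<in> A \<Longrightarrow> symbol (F i)) \<Longrightarrow> symbol (\<lambda>z. \<Prod>i\<in>A. F i z)"
  by (induction A rule: infinite_finite_induct) (auto intro: symbol.intros)

lemma symbol_uminus: "symbol F \<Longrightarrow> symbol (\<lambda>z. - F z)"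
  using symbol.mult[OF symbol.const[of "-1"]] by simp

lemma sum_pick: "k < 2 ^ r \<Longrightarrow> (\<Sum>i<2 ^ r. (v \<bullet> e i) * (if i = k then c else 0)) = (v \<bullet> e k) * c"
  by (simp add: if_distrib[of "\<lambda>c. _ * c"] sum.delta cong: if_cong)

text \<open>Structural induction. The generators are stable under differentiation because
  \<open>psi m\<close> goes over into \<open>psi (Suc m)\<close> times a coordinate, and closure
  under sums and products absorbs the Leibniz rule. \<open>D k\<close> is the k-th partial
  derivative.\<close>

lemma symbol_derivative:
  assumes "symbol F"
  shows "\<exists>D. (\<forall>k. symbol (D k)) \<and>
    (\<forall>z. (F has_derivative (\<lambda>v. \<Sum>k<2 ^ r. (v \<bullet> e k) * D k z)) (at z))"
  using assms
proof induction
  case (const c)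
  then show ?case by (intro exI[of _ "\<lambda>_ _. 0"]) (auto intro: symbol.intros)
next
  case (coord k)
  then show ?case
    by (intro exI[of _ "\<lambda>i z. if i = k then 1 else 0"])
      (auto intro!: symbol.intros derivative_eq_intros simp: sum_pick)
next
  case (sin k)
  have "symbol (\<lambda>z. if i = k then cos (z \<bullet> e k) else 0)" for i
    using sin by (cases "i = k") (auto intro: symbol.intros)
  then show ?case using sin
    by (intro exI[of _ "\<lambda>i z. if i = k then cos (z \<bullet> e k) else 0"])
      (auto intro!: derivative_eq_intros simp: sum_pick)
next
  case (cos k)
  have "symbol (\<lambda>z. if i = k then - sin (z \<bullet> e k) else 0)" for i
    using cos by (cases "i = k") (auto intro: symbol.intros symbol_uminus)
  then show ?case using cos
    by (intro exI[of _ "\<lambda>i z. if i = k then - sin (z \<bullet> e k) else 0"])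
      (auto intro!: derivative_eq_intros simp: sum_pick simp del: mult_minus_right)
next
  case exp
  have "symbol (\<lambda>z. if i = 0 then - exp (- (z \<bullet> e 0)) else 0)" for i :: nat
    by (cases "i = 0") (auto intro: symbol.intros symbol_uminus)
  then show ?case
    by (intro exI[of _ "\<lambda>i z. if i = 0 then - exp (- (z \<bullet> e 0)) else 0"])
      (auto intro!: derivative_eq_intros simp: sum_pick simp del: mult_minus_right)
next
  case (psi m)
  let ?D = "\<lambda>i z. if 1 \<le> i \<and> i < 2 ^ r then psi (Suc m) (imag_sq z) * (2 * (z \<bullet> e i)) else 0"
  have s: "symbol (?D i)" for i
    by (cases "1 \<le> i \<and> i < 2 ^ r") (auto intro!: symbol.intros)
  have "((\<lambda>z. psi m (imag_sq z)) has_derivative (\<lambda>v. \<Sum>k<2 ^ r. (v \<bullet> e k) * ?D k z)) (at z)" for z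
  proof -
    have "((\<lambda>z. psi m (imag_sq z)) has_derivative
        (\<lambda>v. psi (Suc m) (imag_sq z) * (\<Sum>k=1..<2 ^ r. 2 * (z \<bullet> e k) * (v \<bullet> e k)))) (at z)"
      unfolding imag_sq_def by (auto intro!: derivative_eq_intros sum.cong simp: fun_eq_iff)
    also have "(\<lambda>v. psi (Suc m) (imag_sq z) * (\<Sum>k=1..<2 ^ r. 2 * (z \<bullet> e k) * (v \<bullet> e k))) =
        (\<lambda>v. \<Sum>k<2 ^ r. (v \<bullet> e k) * ?D k z)"
      unfolding sum_distrib_left
      by (intro ext sum.mono_neutral_cong_left) auto
    finally show ?thesis .
  qed
  then show ?case using s by (intro exI[of _ ?D] conjI allI)
next
  case (add F G)
  then obtain D D' where *: "\<forall>k. symbol (D k)" "\<forall>k. symbol (D' k)"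
    "\<And>z. (F has_derivative (\<lambda>v. \<Sum>k<2 ^ r. (v \<bullet> e k) * D k z)) (at z)"
    "\<And>z. (G has_derivative (\<lambda>v. \<Sum>k<2 ^ r. (v \<bullet> e k) * D' k z)) (at z)" by blast
  show ?case
  proof (intro exI[of _ "\<lambda>k z. D k z + D' k z"] conjI allI)
    show "symbol (\<lambda>z. D k z + D' k z)" for k
      by (intro symbol.add *(1,2)[rule_format])
    show "((\<lambda>z. F z + G z) has_derivative (\<lambda>v. \<Sum>k<2 ^ r. (v \<bullet> e k) * (D k z + D' k z))) (at z)" for z
      by (rule has_derivative_eq_rhs[OF has_derivative_add[OF *(3) *(4)]])
        (simp add: distrib_left sum.distrib)
  qed
next
  case (mult F G)
  then obtain D D' where *: "\<forall>k. symbol (D k)" "\<forall>k. symbol (D' k)"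
    "\<And>z. (F has_derivative (\<lambda>v. \<Sum>k<2 ^ r. (v \<bullet> e k) * D k z)) (at z)"
    "\<And>z. (G has_derivative (\<lambda>v. \<Sum>k<2 ^ r. (v \<bullet> e k) * D' k z)) (at z)" by blast
  show ?case
  proof (intro exI[of _ "\<lambda>k z. F z * D' k z + D k z * G z"] conjI allI)
    show "symbol (\<lambda>z. F z * D' k z + D k z * G z)" for k
      by (intro symbol.add symbol.mult *(1,2)[rule_format] mult.hyps)
    show "((\<lambda>z. F z * G z) has_derivative
        (\<lambda>v. \<Sum>k<2 ^ r. (v \<bullet> e k) * (F z * D' k z + D k z * G z))) (at z)" for z
      by (rule has_derivative_eq_rhs[OF has_derivative_mult[OF *(3) *(4)]])
        (unfold sum_distrib_left sum_distrib_right sum.distrib[symmetric],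
          intro ext sum.cong, auto simp: algebra_simps)
  qed
qed

lemma norm_e: "k < 2 ^ r \<Longrightarrow> norm (e k) = 1"
  by (simp add: norm_eq_sqrt_inner inner_e)

lemma abs_inner_e_le: "k < 2 ^ r \<Longrightarrow> \<bar>z \<bullet> e k\<bar> \<le> norm z"
  using Cauchy_Schwarz_ineq2[of z "e k"] by (simp add: norm_e)

text \<open>On a hyperplane of fixed real part the exponential generator is constant, a coordinate
  is beaten by every exponential, and the other generators are bounded. In a product each factor
  gets \<delta> / 2, which is why \<delta> is quantified inside the induction.\<close>

lemma symbol_bound:
  assumes "symbol F"
  shows "\<forall>c. \<forall>\<delta>>0. \<exists>C. \<forall>z. z \<bullet> e 0 = c \<longrightarrow> \<bar>F z\<bar> \<le> C * exp (\<delta> * norm z)"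
  using assms
proof induction
  case (const c)
  show ?case by (intro allI impI exI[of _ "\<bar>c\<bar>"]) (simp add: mult_le_cancel_left1)
next
  case (coord k)
  show ?case
  proof (intro allI impI exI)
    fix \<delta> :: real and z :: 'a assume "\<delta> > 0"
    moreover have "\<delta> * norm z \<le> exp (\<delta> * norm z)"
      using exp_ge_add_one_self[of "\<delta> * norm z"] by linarith
    ultimately have "norm z \<le> (1 / \<delta>) * exp (\<delta> * norm z)"
      by (simp add: field_simps)
    then show "\<bar>z \<bullet> e k\<bar> \<le> (1 / \<delta>) * exp (\<delta> * norm z)"
      using abs_inner_e_le[OF coord, of z] by linarith
  qed
next
  case (sin k)
  show ?case by (intro allI impI exI[of _ 1]) (auto intro: order_trans[OF abs_sin_le_one])
next
  case (cos k)
  show ?case by (intro allI impI exI[of _ 1]) (auto intro: order_trans[OF abs_cos_le_one])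
next
  case exp
  show ?case
  proof (intro allI impI)
    fix c \<delta> :: real assume "\<delta> > 0"
    then show "\<exists>C. \<forall>z. z \<bullet> e 0 = c \<longrightarrow> \<bar>exp (- (z \<bullet> e 0))\<bar> \<le> C * exp (\<delta> * norm z)"
      by (intro exI[of _ "exp (- c)"]) (auto simp: mult_le_cancel_left1)
  qed
next
  case (psi m)
  obtain B where B: "\<And>s. s \<ge> 0 \<Longrightarrow> \<bar>psi m s\<bar> \<le> B" using psi_bounded by blast
  have "0 \<le> B" using B[of 0] by linarith
  show ?case
  proof (intro allI impI exI)
    fix \<delta> :: real and z :: 'a assume "\<delta> > 0"
    then have "B * 1 \<le> B * exp (\<delta> * norm z)" using \<open>0 \<le> B\<close> by (intro mult_left_mono) auto
    moreover have "imag_sq z \<ge> 0" by (auto simp: imag_sq_def intro: sum_nonneg)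
    ultimately show "\<bar>psi m (imag_sq z)\<bar> \<le> B * exp (\<delta> * norm z)" using B[of "imag_sq z"] by linarith
  qed
next
  case (add F G)
  show ?case
  proof (intro allI impI)
    fix c \<delta> :: real assume "\<delta> > 0"
    with add.IH obtain C D where
      *: "\<And>z. z \<bullet> e 0 = c \<Longrightarrow> \<bar>F z\<bar> \<le> C * exp (\<delta> * norm z)" "\<And>z. z \<bullet> e 0 = c \<Longrightarrow> \<bar>G z\<bar> \<le> D * exp (\<delta> * norm z)"
      by meson
    show "\<exists>C. \<forall>z. z \<bullet> e 0 = c \<longrightarrow> \<bar>F z + G z\<bar> \<le> C * exp (\<delta> * norm z)"
    proof (intro exI allI impI)
      fix z assume "z \<bullet> e 0 = c"
      from *[OF this] show "\<bar>F z + G z\<bar> \<le> (C + D) * exp (\<delta> * norm z)"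
        unfolding distrib_right by linarith
    qed
  qed
next
  case (mult F G)
  show ?case
  proof (intro allI impI)
    fix c \<delta> :: real assume "\<delta> > 0"
    then have "\<delta> / 2 > 0" by simp
    with mult.IH obtain C D where
      *: "\<And>z. z \<bullet> e 0 = c \<Longrightarrow> \<bar>F z\<bar> \<le> C * exp (\<delta> / 2 * norm z)"
         "\<And>z. z \<bullet> e 0 = c \<Longrightarrow> \<bar>G z\<bar> \<le> D * exp (\<delta> / 2 * norm z)"
      by meson
    show "\<exists>C. \<forall>z. z \<bullet> e 0 = c \<longrightarrow> \<bar>F z * G z\<bar> \<le> C * exp (\<delta> * norm z)"
    proof (intro exI allI impI)
      fix z assume "z \<bullet> e 0 = c"
      from *[OF this] have "\<bar>F z\<bar> * \<bar>G z\<bar> \<le> (C * exp (\<delta> / 2 * norm z)) * (D * exp (\<delta> / 2 * norm z))"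
        by (intro mult_mono) auto
      also have "\<dots> = (C * D) * exp (\<delta> * norm z)" by (simp flip: exp_add)
      finally show "\<bar>F z * G z\<bar> \<le> (C * D) * exp (\<delta> * norm z)" by (simp add: abs_mult)
    qed
  qed
qed

definition vsymbol :: "('a \<Rightarrow> 'a) \<Rightarrow> bool" where
  "vsymbol \<Psi> \<longleftrightarrow> (\<forall>k<2 ^ r. symbol (\<lambda>z. \<Psi> z \<bullet> e k))"

lemma vsymbol_add: "vsymbol \<Psi> \<Longrightarrow> vsymbol \<Phi> \<Longrightarrow> vsymbol (\<lambda>z. \<Psi> z + \<Phi> z)"
  by (auto simp: vsymbol_def inner_add_left intro: symbol.intros)

lemma vsymbol_scaleR_const: "vsymbol \<Psi> \<Longrightarrow> vsymbol (\<lambda>z. c *\<^sub>R \<Psi> z)"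
  by (auto simp: vsymbol_def intro: symbol.intros)

lemma vsymbol_scaleR: "symbol F \<Longrightarrow> vsymbol \<Psi> \<Longrightarrow> vsymbol (\<lambda>z. F z *\<^sub>R \<Psi> z)"
  by (auto simp: vsymbol_def intro: symbol.intros)

lemma vsymbol_const: "vsymbol (\<lambda>_. c)"
  by (auto simp: vsymbol_def intro: symbol.intros)

lemma vsymbol_sum: "(\<And>i. i \<in> A \<Longrightarrow> vsymbol (F i)) \<Longrightarrow> vsymbol (\<lambda>z. \<Sum>i\<in>A. F i z)"
  by (induction A rule: infinite_finite_induct) (auto intro: vsymbol_const vsymbol_add)

lemma vsymbol_derivative:
  assumes "vsymbol \<Psi>"
  shows "\<exists>D. (\<forall>k. vsymbol (D k)) \<and>
    (\<forall>z. (\<Psi> has_derivative (\<lambda>v. \<Sum>k<2 ^ r. (v \<bullet> e k) *\<^sub>R D k z)) (at z))"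
proof -
  have "\<forall>i\<in>{..<2 ^ r}. \<exists>D. (\<forall>k. symbol (D k)) \<and>
    (\<forall>z. ((\<lambda>z. \<Psi> z \<bullet> e i) has_derivative (\<lambda>v. \<Sum>k<2 ^ r. (v \<bullet> e k) * D k z)) (at z))"
    using assms by (intro ballI symbol_derivative) (auto simp: vsymbol_def)
  from bchoice[OF this] obtain D where D: "\<And>i k. i < 2 ^ r \<Longrightarrow> symbol (D i k)"
    "\<And>i z. i < 2 ^ r \<Longrightarrow> ((\<lambda>z. \<Psi> z \<bullet> e i) has_derivative (\<lambda>v. \<Sum>k<2 ^ r. (v \<bullet> e k) * D i k z)) (at z)"
    by auto
  show ?thesis
  proof (intro exI conjI allI)
    show "vsymbol (\<lambda>z. \<Sum>i<2 ^ r. D i k z *\<^sub>R e i)" for k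
      using D(1) by (auto simp: vsymbol_def inner_sum_e)
    fix z
    have "((\<lambda>z. \<Sum>i<2 ^ r. (\<Psi> z \<bullet> e i) *\<^sub>R e i) has_derivative
       (\<lambda>v. \<Sum>i<2 ^ r. (\<Sum>k<2 ^ r. (v \<bullet> e k) * D i k z) *\<^sub>R e i)) (at z)"
      by (auto intro!: derivative_intros D(2))
    also have "(\<lambda>v. \<Sum>i<2 ^ r. (\<Sum>k<2 ^ r. (v \<bullet> e k) * D i k z) *\<^sub>R e i) =
       (\<lambda>v. \<Sum>k<2 ^ r. (v \<bullet> e k) *\<^sub>R (\<Sum>i<2 ^ r. D i k z *\<^sub>R e i))"
      by (simp add: scaleR_sum_left scaleR_sum_right) (subst sum.swap, rule refl)
    finally show "(\<Psi> has_derivative (\<lambda>v. \<Sum>k<2 ^ r. (v \<bullet> e k) *\<^sub>R (\<Sum>i<2 ^ r. D i k z *\<^sub>R e i))) (at z)"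
      by (simp add: e_expand)
  qed
qed

lemma vsymbol_continuous: "vsymbol \<Psi> \<Longrightarrow> continuous_on UNIV \<Psi>"
  by (intro continuous_at_imp_continuous_on ballI)
    (use vsymbol_derivative has_derivative_continuous in blast)

lemma vsymbol_bound:
  assumes "vsymbol \<Psi>" "\<delta> > 0"
  shows "\<exists>C. \<forall>z. z \<bullet> e 0 = c \<longrightarrow> norm (\<Psi> z) \<le> C * exp (\<delta> * norm z)"
proof -
  have "\<forall>k\<in>{..<2 ^ r}. \<exists>C. \<forall>z. z \<bullet> e 0 = c \<longrightarrow> \<bar>\<Psi> z \<bullet> e k\<bar> \<le> C * exp (\<delta> * norm z)"
    using symbol_bound assms unfolding vsymbol_def by blast
  from bchoice[OF this] obtain C where
    C: "\<And>k z. k < 2 ^ r \<Longrightarrow> z \<bullet> e 0 = c \<Longrightarrow> \<bar>\<Psi> z \<bullet> e k\<bar> \<le> C k * exp (\<delta> * norm z)" by auto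
  show ?thesis
  proof (intro exI allI impI)
    fix z assume z: "z \<bullet> e 0 = c"
    have "norm (\<Psi> z) = norm (\<Sum>k<2 ^ r. (\<Psi> z \<bullet> e k) *\<^sub>R e k)" by (simp add: e_expand)
    also have "\<dots> \<le> (\<Sum>k<2 ^ r. \<bar>\<Psi> z \<bullet> e k\<bar>)"
      by (rule order_trans[OF norm_sum]) (auto intro!: sum_mono simp: norm_e)
    also have "\<dots> \<le> (\<Sum>k<2 ^ r. C k * exp (\<delta> * norm z))"
      using C z by (intro sum_mono) auto
    finally show "norm (\<Psi> z) \<le> (\<Sum>k<2 ^ r. C k) * exp (\<delta> * norm z)"
      by (simp add: sum_distrib_right)
  qed
qed

end

section \<open>The kernels as translated symbols\<close>

context cayley_dickson
begin

lemma norm_eq_sum_e: "(norm x)\<^sup>2 = (\<Sum>k<2 ^ r. (x \<bullet> e k)\<^sup>2)"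
proof -
  have "(norm x)\<^sup>2 = x \<bullet> (\<Sum>k<2 ^ r. (x \<bullet> e k) *\<^sub>R e k)"
    by (simp add: power2_norm_eq_inner e_expand)
  then show ?thesis by (simp add: inner_sum_right power2_eq_square)
qed

text \<open>This is exp(-z) = exp(-z_0) (cos |v| - v sin |v| / |v|) for the imaginary part v of z,
  in a form that is smooth at v = 0.\<close>

definition cartesian_symbol :: "'a \<Rightarrow> 'a" where
  "cartesian_symbol z = exp (- (z \<bullet> e 0)) *\<^sub>R
     (psi 0 (imag_sq z) *\<^sub>R e 0 + (2 * psi 1 (imag_sq z)) *\<^sub>R (\<Sum>k=1..<2 ^ r. (z \<bullet> e k) *\<^sub>R e k))"

text \<open>Spherical coordinates on the unit sphere of the imaginary elements, with the angles z_2,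
  ..., z_K for K = 2^r - 1. The last coordinate has sines only.\<close>

definition direction_coord :: "'a \<Rightarrow> nat \<Rightarrow> real" where
  "direction_coord z k =
     (if k = 0 then 0 else if k < 2 ^ r - 1 then (\<Prod>m=2..k. sin (z \<bullet> e m)) * cos (z \<bullet> e (k + 1))
      else \<Prod>m=2..2 ^ r - 1. sin (z \<bullet> e m))"

text \<open>Here z_1 is the signed length of M, so the sine and cosine of a coordinate appear and
  smoothness is immediate.\<close>

definition spherical_symbol :: "'a \<Rightarrow> 'a" where
  "spherical_symbol z = exp (- (z \<bullet> e 0)) *\<^sub>R
     (cos (z \<bullet> e 1) *\<^sub>R e 0 - sin (z \<bullet> e 1) *\<^sub>R (\<Sum>k<2 ^ r. direction_coord z k *\<^sub>R e k))"

lemma vsymbol_cartesian: "vsymbol cartesian_symbol"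
  unfolding cartesian_symbol_def
  by (intro vsymbol_scaleR symbol.intros vsymbol_add vsymbol_sum vsymbol_const) auto

lemma two_le_pow: "4 \<le> (2::nat) ^ r"
  using power_increasing[OF r_ge_2, of "2::nat"] by simp

lemma symbol_direction_coord: "k < 2 ^ r \<Longrightarrow> symbol (\<lambda>z. direction_coord z k)"
  unfolding direction_coord_def
  by (cases "k = 0"; cases "k < 2 ^ r - 1") (auto intro!: symbol.intros symbol_prod)

lemma vsymbol_spherical: "vsymbol spherical_symbol"
proof -
  have "vsymbol (\<lambda>z. exp (- (z \<bullet> e 0)) *\<^sub>R
     (cos (z \<bullet> e 1) *\<^sub>R e 0 + (- sin (z \<bullet> e 1)) *\<^sub>R (\<Sum>k<2 ^ r. direction_coord z k *\<^sub>R e k)))"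
    using two_le_pow
    by (intro vsymbol_scaleR symbol_uminus symbol.intros vsymbol_add vsymbol_sum vsymbol_const
        symbol_direction_coord) auto
  then show ?thesis by (simp add: spherical_symbol_def[abs_def])
qed

text \<open>Passing from K to K + 1 splits the square of the last product by s^2 + c^2 = 1.\<close>

lemma sum_spherical_coordinates:
  fixes s c :: "nat \<Rightarrow> real"
  assumes "\<And>m. (s m)\<^sup>2 + (c m)\<^sup>2 = 1"
  shows "(\<Sum>k=1..<Suc K. ((\<Prod>m=2..k. s m) * c (k + 1))\<^sup>2) + (\<Prod>m=2..Suc K. s m)\<^sup>2 = 1"
proof (induction K)
  case (Suc K)
  have "(\<Sum>k=1..<Suc (Suc K). ((\<Prod>m=2..k. s m) * c (k + 1))\<^sup>2) + (\<Prod>m=2..Suc (Suc K). s m)\<^sup>2 =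
    (\<Sum>k=1..<Suc K. ((\<Prod>m=2..k. s m) * c (k + 1))\<^sup>2) +
      (\<Prod>m=2..Suc K. s m)\<^sup>2 * ((s (Suc (Suc K)))\<^sup>2 + (c (Suc (Suc K)))\<^sup>2)"
    by (simp add: power_mult_distrib algebra_simps)
  then show ?case using Suc by (simp add: assms)
qed auto

lemma norm_direction: "norm (\<Sum>k<2 ^ r. direction_coord z k *\<^sub>R e k) = 1"
proof -
  \<comment> \<open>Chosen so that \<open>Suc K\<close> is the last index of the basis, the one
    without a cosine.\<close>
  define K where "K = 2 ^ r - (2::nat)"
  have K: "2 ^ r = Suc (Suc K)" using two_le_pow by (simp add: K_def)
  have "(norm (\<Sum>k<2 ^ r. direction_coord z k *\<^sub>R e k))\<^sup>2 = (\<Sum>k<2 ^ r. (direction_coord z k)\<^sup>2)"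
    unfolding norm_eq_sum_e by (intro sum.cong refl) (simp add: inner_sum_e)
  also have "\<dots> = (\<Sum>k<Suc K. (direction_coord z k)\<^sup>2) + (direction_coord z (Suc K))\<^sup>2"
    unfolding K by simp
  also have "(\<Sum>k<Suc K. (direction_coord z k)\<^sup>2) =
      (\<Sum>k=1..<Suc K. ((\<Prod>m=2..k. sin (z \<bullet> e m)) * cos (z \<bullet> e (k + 1)))\<^sup>2)"
    unfolding direction_coord_def K
    by (rule sum.mono_neutral_cong_right) auto
  also have "\<dots> + (direction_coord z (Suc K))\<^sup>2 = 1"
    using sum_spherical_coordinates[of "\<lambda>m. sin (z \<bullet> e m)" "\<lambda>m. cos (z \<bullet> e m)" K]
    unfolding direction_coord_def K by simp
  finally have "(norm (\<Sum>k<2 ^ r. direction_coord z k *\<^sub>R e k))\<^sup>2 = 1\<^sup>2" by simp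
  then show ?thesis by (rule power2_eq_imp_eq) simp_all
qed

text \<open>The scalar c stands for p_0 (t_1 + ... + t_n). It is kept apart from z because it alone
  varies with t in the real direction and becomes the weight, while z stays in a hyperplane of fixed
  real part.\<close>

lemma cd_exp_cartesian:
  "cd_exp r e (- (c *\<^sub>R e 0 + z)) = exp (- c) *\<^sub>R cartesian_symbol z"
proof -
  define v where "v = (\<Sum>k=1..<2 ^ r. (z \<bullet> e k) *\<^sub>R e k)"
  have split: "(\<Sum>k<2 ^ r. g k) = g 0 + (\<Sum>k=1..<2 ^ r. g k)" for g :: "nat \<Rightarrow> 'b::comm_monoid_add"
    by (simp add: sum.atLeast_Suc_lessThan lessThan_atLeast0)
  have z: "z = (z \<bullet> e 0) *\<^sub>R e 0 + v"
    unfolding v_def using e_expand[of z] split[of "\<lambda>k. (z \<bullet> e k) *\<^sub>R e k"] by simp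
  have ve: "v \<bullet> e k = (if k = 0 then 0 else z \<bullet> e k)" if "k < 2 ^ r" for k
  proof -
    have "v = (\<Sum>k<2 ^ r. (if k = 0 then 0 else z \<bullet> e k) *\<^sub>R e k)"
      unfolding v_def split by simp
    then show ?thesis by (simp only: inner_sum_e[OF that])
  qed
  have "(norm v)\<^sup>2 = imag_sq z"
    unfolding norm_eq_sum_e split imag_sq_def by (subst ve[of 0]; simp add: ve)
  then have N: "sqrt (imag_sq z) = norm v" "imag_sq z \<ge> 0"
    by (auto intro!: real_sqrt_unique simp: imag_sq_def sum_nonneg)
  let ?c = "- (c + z \<bullet> e 0)"
  have arg: "- (c *\<^sub>R e 0 + z) = ?c *\<^sub>R e 0 - v"
    by (subst z) (simp add: algebra_simps)
  have ec: "exp ?c = exp (- c) * exp (- (z \<bullet> e 0))" by (simp add: exp_add[symmetric])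
  show ?thesis
  proof (cases "v = 0")
    case True
    \<comment> \<open>There is no direction v / |v|; any imaginary unit will do, here
      \<open>e 1\<close> with angle 0.\<close>
    then show ?thesis
      using cd_exp_complex[of "e 1" ?c 0] N two_le_pow
      unfolding arg cartesian_symbol_def v_def[symmetric] scaleR_scaleR[symmetric] ec
      by (simp add: inner_e norm_e psi_0)
  next
    case False
    have "cd_exp r e (?c *\<^sub>R e 0 + (- norm v) *\<^sub>R ((1 / norm v) *\<^sub>R v)) =
        exp ?c *\<^sub>R (cos (- norm v) *\<^sub>R e 0 + sin (- norm v) *\<^sub>R ((1 / norm v) *\<^sub>R v))"
      by (rule cd_exp_complex) (use False ve[of 0] in auto)
    moreover have "imag_sq z > 0" using False \<open>(norm v)\<^sup>2 = imag_sq z\<close>[symmetric] by simp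
    ultimately show ?thesis using N False
      unfolding arg cartesian_symbol_def v_def[symmetric] scaleR_scaleR[symmetric] ec
      by (simp add: psi_0 psi_1)
  qed
qed

text \<open>The direction has norm 1 for all angles, so -z_1 is a legitimate angle in its complex
  plane, whatever its sign.\<close>

lemma cd_exp_spherical:
  "cd_exp r e (- (c *\<^sub>R e 0 + (z \<bullet> e 1) *\<^sub>R (\<Sum>k<2 ^ r. direction_coord z k *\<^sub>R e k) + (z \<bullet> e 0) *\<^sub>R e 0))
    = exp (- c) *\<^sub>R spherical_symbol z"
proof -
  let ?U = "\<Sum>k<2 ^ r. direction_coord z k *\<^sub>R e k"
  have "?U \<bullet> e 0 = 0" by (simp add: inner_sum_e direction_coord_def)
  note cd_exp_complex[OF this norm_direction, of "- (c + z \<bullet> e 0)" "- (z \<bullet> e 1)"]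
  moreover have "exp (- (c + z \<bullet> e 0)) = exp (- c) * exp (- (z \<bullet> e 0))" by (simp add: exp_add[symmetric])
  ultimately show ?thesis by (simp add: spherical_symbol_def algebra_simps)
qed

end

section \<open>The common form of both kernels and the operators on symbols\<close>

locale cd_kernel = cayley_dickson r e for r :: nat and e :: "nat \<Rightarrow> 'a::euclidean_space" +
  fixes n :: nat and \<kappa> :: kernel and p :: 'a
  assumes n_le: "n \<le> 2 ^ r - 1"
begin

lemma n_less: "n < 2 ^ r" using n_le two_le_pow by linarith

text \<open>The indices m of those coordinates of the argument that move with t_k: in the spherical
  kernel s_m contains t_k exactly for m \<le> k. The same m index the terms \<open>S_op e m\<close>
  of R_k.\<close>

definition idx :: "nat \<Rightarrow> nat set" where
  "idx k = (case \<kappa> of Spherical \<Rightarrow> {1..k} | Cartesian \<Rightarrow> {k})"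

text \<open>\<open>dir k\<close> is the derivative of the argument of the kernel with respect to \<open>t\<^sub>k\<close>, without its
  real part.\<close>

definition dir :: "nat \<Rightarrow> 'a" where
  "dir k = (\<Sum>m\<in>idx k. (p \<bullet> e m) *\<^sub>R e m)"

definition shift :: "(nat \<Rightarrow> real) \<Rightarrow> 'a" where
  "shift t = (\<Sum>k=1..n. t k *\<^sub>R dir k)"

definition weight :: "(nat \<Rightarrow> real) \<Rightarrow> real" where
  "weight t = exp (- ((p \<bullet> e 0) * (\<Sum>k=1..n. t k)))"

definition ksymbol :: "'a \<Rightarrow> 'a" where
  "ksymbol = (case \<kappa> of Spherical \<Rightarrow> spherical_symbol | Cartesian \<Rightarrow> cartesian_symbol)"

lemma vsymbol_ksymbol: "vsymbol ksymbol"
  unfolding ksymbol_def by (cases \<kappa>) (auto simp: vsymbol_spherical vsymbol_cartesian)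

lemma finite_idx [simp]: "finite (idx k)" unfolding idx_def by (cases \<kappa>) auto

lemma idx_bounds: "k \<in> {1..n} \<Longrightarrow> m \<in> idx k \<Longrightarrow> 1 \<le> m \<and> m \<le> n \<and> m < 2 ^ r"
  using n_less unfolding idx_def by (cases \<kappa>) auto

lemma inner_dir:
  assumes "k \<in> {1..n}" "i < 2 ^ r"
  shows "dir k \<bullet> e i = (if i \<in> idx k then p \<bullet> e i else 0)"
proof -
  have "dir k \<bullet> e i = (\<Sum>m\<in>idx k. if i = m then p \<bullet> e i else 0)"
    unfolding dir_def inner_sum_left
    by (intro sum.cong refl) (use assms idx_bounds[OF assms(1)] in \<open>auto simp: inner_e\<close>)
  then show ?thesis by (simp add: sum.delta)
qed

lemma inner_shift:
  assumes "i < 2 ^ r"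
  shows "shift t \<bullet> e i = (\<Sum>k=1..n. if i \<in> idx k then (p \<bullet> e i) * t k else 0)"
  unfolding shift_def inner_sum_left
  by (intro sum.cong refl) (use assms in \<open>auto simp: inner_dir\<close>)

lemma zero_notin_idx: "k \<in> {1..n} \<Longrightarrow> 0 \<notin> idx k"
  using idx_bounds[of k 0] by auto

lemma shift_inner_e0: "shift t \<bullet> e 0 = 0"
  by (subst inner_shift) (auto intro!: sum.neutral simp: zero_notin_idx)

lemma shift_upd:
  assumes "k \<in> {1..n}"
  shows "shift (t(k := x)) = shift (t(k := 0)) + x *\<^sub>R dir k"
  unfolding shift_def using assms by (subst (1 2) sum.remove[of _ k]) auto

lemma sum_upd:
  assumes "k \<in> {1..n}"
  shows "(\<Sum>i=1..n. (t(k := x)) i) = (\<Sum>i=1..n. (t(k := 0)) i) + (x::real)"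
  using assms by (subst (1 2) sum.remove[of _ k]) auto

lemma norm_shift: "\<exists>c\<ge>0. \<forall>t. norm (shift t) \<le> c * (\<Sum>k=1..n. \<bar>t k\<bar>)"
proof (intro exI conjI allI)
  show "0 \<le> (\<Sum>k=1..n. norm (dir k))" by (intro sum_nonneg) auto
  fix t
  have "norm (shift t) \<le> (\<Sum>k=1..n. \<bar>t k\<bar> * norm (dir k))"
    unfolding shift_def by (rule order_trans[OF norm_sum]) simp
  also have "\<dots> \<le> (\<Sum>k=1..n. \<bar>t k\<bar> * (\<Sum>k=1..n. norm (dir k)))"
    by (intro sum_mono mult_left_mono member_le_sum) auto
  finally show "norm (shift t) \<le> (\<Sum>k=1..n. norm (dir k)) * (\<Sum>k=1..n. \<bar>t k\<bar>)"
    by (simp add: sum_distrib_right mult.commute)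
qed

lemma exp_kernel: "cd_exp r e (- u_kernel \<kappa> r n e p t \<zeta>) = weight t *\<^sub>R ksymbol (\<zeta> + shift t)"
proof (cases \<kappa>)
  case Cartesian
  have "shift t = (\<Sum>j=1..n. ((p \<bullet> e j) * t j) *\<^sub>R e j)"
    unfolding shift_def dir_def idx_def by (simp add: Cartesian mult.commute)
  then have u: "u_kernel \<kappa> r n e p t \<zeta> = ((p \<bullet> e 0) * (\<Sum>j=1..n. t j)) *\<^sub>R e 0 + (\<zeta> + shift t)"
    using Cartesian by (simp add: u_cartesian_def add_ac)
  have "ksymbol = cartesian_symbol" unfolding ksymbol_def by (simp add: Cartesian)
  then show ?thesis unfolding u cd_exp_cartesian weight_def by simp
next
  case Spherical
  define z where "z = \<zeta> + shift t"
  have idx: "idx k = {1..k}" for k unfolding idx_def by (simp add: Spherical)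
  let ?K = "2 ^ r - 1 :: nat"
  have K: "1 \<le> ?K" "2 ^ r = Suc ?K" using two_le_pow by auto
  \<comment> \<open>The sum s_j collects the t_k with j in \<open>idx k\<close>, so each \<phi>_j is
    a coordinate of z. For j > n both sides reduce to the coordinate of zeta.\<close>
  have \<phi>: "(p \<bullet> e j) * (\<Sum>k=j..n. t k) + \<zeta> \<bullet> e j = z \<bullet> e j" if "1 \<le> j" "j \<le> ?K" for j
  proof -
    have j: "j < 2 ^ r" using that K(2) by linarith
    have "shift t \<bullet> e j = (\<Sum>k\<in>{j..n}. (p \<bullet> e j) * t k)"
      unfolding inner_shift[OF j]
      by (rule sum.mono_neutral_cong_right) (use that in \<open>auto simp: idx\<close>)
    then show ?thesis by (simp add: z_def inner_add_left sum_distrib_left)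
  qed
  have "(\<Sum>k<2 ^ r. direction_coord z k *\<^sub>R e k) = (\<Sum>k\<in>{1..?K}. direction_coord z k *\<^sub>R e k)"
    by (rule sum.mono_neutral_right) (use K in \<open>auto simp: direction_coord_def\<close>)
  also have "{1..?K} = insert ?K {1..?K - 1}" using K by auto
  also have "(\<Sum>k\<in>\<dots>. direction_coord z k *\<^sub>R e k) =
     (\<Sum>k=1..?K - 1. direction_coord z k *\<^sub>R e k) + direction_coord z ?K *\<^sub>R e ?K"
    using K(1) by (subst sum.insert) (auto simp: add.commute)
  also have "(\<Sum>k=1..?K - 1. direction_coord z k *\<^sub>R e k) =
     (\<Sum>k=1..?K - 1. ((\<Prod>m=2..k. sin (z \<bullet> e m)) * cos (z \<bullet> e (k + 1))) *\<^sub>R e k)"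
    by (intro sum.cong refl) (auto simp: direction_coord_def)
  also have "\<dots> = (\<Sum>k=1..?K - 1. ((\<Prod>m=2..k. sin ((p \<bullet> e m) * (\<Sum>k=m..n. t k) + \<zeta> \<bullet> e m)) *
      cos ((p \<bullet> e (k + 1)) * (\<Sum>k=k + 1..n. t k) + \<zeta> \<bullet> e (k + 1))) *\<^sub>R e k)"
  proof (intro sum.cong refl)
    fix k assume k: "k \<in> {1..?K - 1}"
    have "(\<Prod>m=2..k. sin ((p \<bullet> e m) * (\<Sum>k=m..n. t k) + \<zeta> \<bullet> e m)) = (\<Prod>m=2..k. sin (z \<bullet> e m))"
      by (intro prod.cong refl) (subst \<phi>, use k in auto)
    moreover have "(p \<bullet> e (k + 1)) * (\<Sum>k=k + 1..n. t k) + \<zeta> \<bullet> e (k + 1) = z \<bullet> e (k + 1)"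
      by (rule \<phi>) (use k in auto)
    ultimately show "((\<Prod>m=2..k. sin (z \<bullet> e m)) * cos (z \<bullet> e (k + 1))) *\<^sub>R e k =
      ((\<Prod>m=2..k. sin ((p \<bullet> e m) * (\<Sum>k=m..n. t k) + \<zeta> \<bullet> e m)) *
      cos ((p \<bullet> e (k + 1)) * (\<Sum>k=k + 1..n. t k) + \<zeta> \<bullet> e (k + 1))) *\<^sub>R e k" by simp
  qed
  also have "direction_coord z ?K = (\<Prod>m=2..?K. sin ((p \<bullet> e m) * (\<Sum>k=m..n. t k) + \<zeta> \<bullet> e m))"
    unfolding direction_coord_def using K by (auto intro!: prod.cong simp: \<phi>)
  finally have u: "u_kernel \<kappa> r n e p t \<zeta> = ((p \<bullet> e 0) * (\<Sum>j=1..n. t j)) *\<^sub>R e 0 +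
      (z \<bullet> e 1) *\<^sub>R (\<Sum>k<2 ^ r. direction_coord z k *\<^sub>R e k) + (z \<bullet> e 0) *\<^sub>R e 0"
    unfolding Spherical u_kernel.simps u_spherical_def Let_def
    using \<phi>[of 1] K by (simp add: z_def inner_add_left shift_inner_e0)
  have "ksymbol = spherical_symbol" unfolding ksymbol_def by (simp add: Spherical)
  then show ?thesis unfolding u cd_exp_spherical weight_def z_def by simp
qed

text \<open>One choice of partial derivatives is fixed for every symbol, so that R_k can be written
  as an operation on symbols.\<close>

definition partial :: "('a \<Rightarrow> 'a) \<Rightarrow> nat \<Rightarrow> 'a \<Rightarrow> 'a" where
  "partial \<Psi> = (SOME D. (\<forall>k. vsymbol (D k)) \<and>
    (\<forall>z. (\<Psi> has_derivative (\<lambda>v. \<Sum>k<2 ^ r. (v \<bullet> e k) *\<^sub>R D k z)) (at z)))"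

lemma partial:
  assumes "vsymbol \<Psi>"
  shows "vsymbol (partial \<Psi> k)"
    and "(\<Psi> has_derivative (\<lambda>v. \<Sum>k<2 ^ r. (v \<bullet> e k) *\<^sub>R partial \<Psi> k z)) (at z)"
  using someI_ex[OF vsymbol_derivative[OF assms]] by (auto simp: partial_def)

text \<open>R_k acting on the symbol itself; the minus sign is that of S = - d/d zeta.\<close>

definition R_symbol :: "nat \<Rightarrow> ('a \<Rightarrow> 'a) \<Rightarrow> 'a \<Rightarrow> 'a" where
  "R_symbol k \<Psi> z = (p \<bullet> e 0) *\<^sub>R \<Psi> z - (\<Sum>m\<in>idx k. (p \<bullet> e m) *\<^sub>R partial \<Psi> m z)"

lemma vsymbol_R_symbol: "vsymbol \<Psi> \<Longrightarrow> vsymbol (R_symbol k \<Psi>)"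
  using vsymbol_add[OF vsymbol_scaleR_const[of \<Psi> "p \<bullet> e 0"]
      vsymbol_scaleR_const[OF vsymbol_sum[of "idx k" "\<lambda>m z. (p \<bullet> e m) *\<^sub>R partial \<Psi> m z"], of "-1"]]
  by (simp add: R_symbol_def[abs_def] vsymbol_scaleR_const partial(1))

lemma R_op_eq:
  "R_op \<kappa> e p k G \<zeta> = (p \<bullet> e 0) *\<^sub>R G \<zeta> + (\<Sum>m\<in>idx k. (p \<bullet> e m) *\<^sub>R S_op e m G \<zeta>)"
  unfolding idx_def by (cases \<kappa>) simp_all

lemma kernel_derivative:
  assumes \<Psi>: "vsymbol \<Psi>" and k: "k \<in> {1..n}"
  shows "((\<lambda>x. weight (t(k := x)) *\<^sub>R \<Psi> (\<zeta> + shift (t(k := x)))) has_vector_derivative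
    - (weight (t(k := x)) *\<^sub>R R_symbol k \<Psi> (\<zeta> + shift (t(k := x))))) (at x within S)"
proof -
  define s c where "s = \<zeta> + shift (t(k := 0))" and "c = (\<Sum>i=1..n. (t(k := 0)) i)"
  let ?z = "\<lambda>x. s + x *\<^sub>R dir k"
  let ?w = "\<lambda>x. exp (- ((p \<bullet> e 0) * (c + x)))"
  have z: "\<zeta> + shift (t(k := x)) = ?z x" for x unfolding s_def by (subst shift_upd[OF k]) simp
  have w: "weight (t(k := x)) = ?w x" for x unfolding weight_def c_def by (subst sum_upd[OF k]) simp
  have D: "(\<Sum>i<2 ^ r. (dir k \<bullet> e i) *\<^sub>R partial \<Psi> i y) = (\<Sum>m\<in>idx k. (p \<bullet> e m) *\<^sub>R partial \<Psi> m y)" for y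
    by (rule sum.mono_neutral_cong_right) (use idx_bounds[OF k] in \<open>auto simp: inner_dir[OF k]\<close>)
  have "(?z has_derivative (\<lambda>h. h *\<^sub>R dir k)) (at x within S)"
    by (auto intro!: derivative_eq_intros)
  from has_derivative_compose[OF this partial(2)[OF \<Psi>]]
  have "((\<lambda>x. \<Psi> (?z x)) has_derivative (\<lambda>h. \<Sum>i<2 ^ r. ((h *\<^sub>R dir k) \<bullet> e i) *\<^sub>R partial \<Psi> i (?z x))) (at x within S)" .
  also have "(\<lambda>h. \<Sum>i<2 ^ r. ((h *\<^sub>R dir k) \<bullet> e i) *\<^sub>R partial \<Psi> i (?z x)) =
      (\<lambda>h. h *\<^sub>R (\<Sum>m\<in>idx k. (p \<bullet> e m) *\<^sub>R partial \<Psi> m (?z x)))"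
    unfolding D[symmetric] by (simp add: scaleR_sum_right)
  finally have 1: "((\<lambda>x. \<Psi> (?z x)) has_vector_derivative (\<Sum>m\<in>idx k. (p \<bullet> e m) *\<^sub>R partial \<Psi> m (?z x))) (at x within S)"
    by (simp add: has_vector_derivative_def)
  have 2: "(?w has_real_derivative - (p \<bullet> e 0) * ?w x) (at x within S)"
    by (auto intro!: derivative_eq_intros)
  have "((\<lambda>x. ?w x *\<^sub>R \<Psi> (?z x)) has_vector_derivative
     ?w x *\<^sub>R (\<Sum>m\<in>idx k. (p \<bullet> e m) *\<^sub>R partial \<Psi> m (?z x)) + (- (p \<bullet> e 0) * ?w x) *\<^sub>R \<Psi> (?z x)) (at x within S)"
    by (rule has_vector_derivative_scaleR[OF 2 1])
  moreover have "?w x *\<^sub>R (\<Sum>m\<in>idx k. (p \<bullet> e m) *\<^sub>R partial \<Psi> m (?z x)) + (- (p \<bullet> e 0) * ?w x) *\<^sub>R \<Psi> (?z x)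
     = - (?w x *\<^sub>R R_symbol k \<Psi> (?z x))"
    by (simp add: R_symbol_def scaleR_diff_right mult.commute)
  ultimately show ?thesis unfolding z w by simp
qed

lemma symbol_direction_derivative:
  assumes \<Psi>: "vsymbol \<Psi>" and m: "m < 2 ^ r"
  shows "((\<lambda>x. \<Psi> (z + x *\<^sub>R e m)) has_vector_derivative partial \<Psi> m (z + x *\<^sub>R e m)) (at x within S)"
proof -
  have "((\<lambda>x. z + x *\<^sub>R e m) has_derivative (\<lambda>h. h *\<^sub>R e m)) (at x within S)"
    by (auto intro!: derivative_eq_intros)
  from has_derivative_compose[OF this partial(2)[OF \<Psi>]] m show ?thesis
    by (simp add: has_vector_derivative_def inner_e if_distrib[of "\<lambda>c. c *\<^sub>R _"] if_distrib[of "\<lambda>c. _ * c"] sum.delta cong: if_cong)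
qed

end

section \<open>Completed product measures\<close>

text \<open>Outside a null set B the preimages agree, and inside B every set is measurable for the
  completion.\<close>

lemma borel_measurable_completion_cong_AE:
  assumes f': "f' \<in> borel_measurable (completion M)" and ae: "AE x in M. f x = f' x"
  shows "f \<in> borel_measurable (completion M)"
proof -
  from ae obtain B where B: "B \<in> null_sets M" "{x \<in> space M. f x \<noteq> f' x} \<subseteq> B"
    unfolding eventually_ae_filter by blast
  show ?thesis
  proof (rule measurableI)
    fix A :: "'b set" assume A: "A \<in> sets borel"
    have "f -` A \<inter> space M = ((f' -` A \<inter> space (completion M)) - B) \<union> (f -` A \<inter> space M \<inter> B)"
      using B by auto
    moreover have "(f' -` A \<inter> space (completion M)) - B \<in> sets (completion M)"
      using measurable_sets[OF f' A] B(1) by (intro sets.Diff) auto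
    moreover have "f -` A \<inter> space M \<inter> B \<in> null_sets (completion M)"
      using B(1) unfolding null_sets_completion_iff2 by auto
    ultimately show "f -` A \<inter> space (completion M) \<in> sets (completion M)"
      by (metis null_setsD2 sets.Un space_completion)
  qed auto
qed

lemma completion_ex_borel_measurable_euclidean:
  fixes f :: "'a \<Rightarrow> 'b::euclidean_space"
  assumes f: "f \<in> borel_measurable (completion M)"
  shows "\<exists>f'\<in>borel_measurable M. AE x in M. f x = f' x"
proof -
  have "\<exists>g. g \<in> borel_measurable M \<and> (AE x in M. f x \<bullet> i = g x)" for i
    using completion_ex_borel_measurable_real[of "\<lambda>x. f x \<bullet> i" M] f by auto
  then have "\<forall>i\<in>Basis. \<exists>g. g \<in> borel_measurable M \<and> (AE x in M. f x \<bullet> i = g x)" by blast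
  from bchoice[OF this] obtain g where g: "\<And>i. i \<in> Basis \<Longrightarrow> g i \<in> borel_measurable M"
    "\<And>i. i \<in> Basis \<Longrightarrow> AE x in M. f x \<bullet> i = g i x" by auto
  have "AE x in M. \<forall>i\<in>Basis. f x \<bullet> i = g i x"
    by (intro AE_finite_allI finite_Basis g(2))
  then have "AE x in M. f x = (\<Sum>i\<in>Basis. g i x *\<^sub>R i)"
  proof eventually_elim
    case (elim x)
    have "f x = (\<Sum>i\<in>Basis. (f x \<bullet> i) *\<^sub>R i)" by (simp add: euclidean_representation)
    then show ?case using elim by simp
  qed
  moreover have "(\<lambda>x. \<Sum>i\<in>Basis. g i x *\<^sub>R i) \<in> borel_measurable M"
    by (intro borel_measurable_sum borel_measurable_scaleR g(1) borel_measurable_const)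
  ultimately show ?thesis by (rule rev_bexI[rotated])
qed

abbreviation coords_borel :: "nat set \<Rightarrow> (nat \<Rightarrow> real) measure" where
  "coords_borel I \<equiv> Pi\<^sub>M I (\<lambda>_. lborel)"

interpretation coords: product_sigma_finite "\<lambda>_::nat. lborel :: real measure" ..

lemma space_lebesgue_on_coords [simp]: "space (lebesgue_on_coords I) = I \<rightarrow>\<^sub>E UNIV"
  by (simp add: lebesgue_on_coords_def space_PiM)

lemma AE_lebesgue_on_coords: "(AE t in lebesgue_on_coords I. P t) \<longleftrightarrow> (AE t in coords_borel I. P t)"
  unfolding lebesgue_on_coords_def by (rule AE_completion_iff)

lemma measurable_lebesgue_on_coords:
  "f \<in> coords_borel I \<rightarrow>\<^sub>M borel \<Longrightarrow> f \<in> lebesgue_on_coords I \<rightarrow>\<^sub>M borel"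
  unfolding lebesgue_on_coords_def by (rule measurable_completion)

text \<open>Boxes determine the product measure, and on a box only the k-th factor moves, by a
  translation.\<close>

lemma distr_shift_coord:
  assumes "finite I" "k \<in> I"
  shows "distr (coords_borel I) (coords_borel I) (\<lambda>t. t(k := t k + c)) = coords_borel I"
proof (rule coords.PiM_eqI[OF assms(1)])
  have T: "(\<lambda>t. t(k := t k + c)) \<in> coords_borel I \<rightarrow>\<^sub>M coords_borel I"
    using assms(2) by (intro measurable_PiM_single')
      (auto simp: space_PiM fun_upd_def PiE_def extensional_def)
  fix A :: "nat \<Rightarrow> real set" assume A: "\<And>i. i \<in> I \<Longrightarrow> A i \<in> sets lborel"
  let ?A = "\<lambda>i. if i = k then (\<lambda>x. x + c) -` A k else A i"
  have Ak: "(\<lambda>x. x + c) -` A k \<in> sets lborel"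
    using measurable_sets[of "\<lambda>x. x + c" lborel lborel "A k"] A[OF assms(2)] by simp
  have "emeasure lborel (A k) = emeasure (distr lborel borel ((+) c)) (A k)"
    by (simp add: lborel_distr_plus)
  also have "\<dots> = emeasure lborel ((\<lambda>x. x + c) -` A k)"
    using A[OF assms(2)] by (subst emeasure_distr) (auto simp: vimage_def add.commute)
  finally have eq: "emeasure lborel (A i) = emeasure lborel (?A i)" for i by simp
  have "emeasure (distr (coords_borel I) (coords_borel I) (\<lambda>t. t(k := t k + c))) (Pi\<^sub>E I A)
      = emeasure (coords_borel I) ((\<lambda>t. t(k := t k + c)) -` Pi\<^sub>E I A \<inter> space (coords_borel I))"
    using T A assms by (intro emeasure_distr) auto
  also have "(\<lambda>t. t(k := t k + c)) -` Pi\<^sub>E I A \<inter> space (coords_borel I) = Pi\<^sub>E I ?A"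
    using assms(2) by (auto simp: space_PiM PiE_iff extensional_def split: if_splits)
  also have "emeasure (coords_borel I) (Pi\<^sub>E I ?A) = (\<Prod>i\<in>I. emeasure lborel (?A i))"
    using A Ak assms by (intro coords.emeasure_PiM) auto
  finally show "emeasure (distr (coords_borel I) (coords_borel I) (\<lambda>t. t(k := t k + c))) (Pi\<^sub>E I A)
     = (\<Prod>i\<in>I. emeasure lborel (A i))" unfolding eq .
qed simp

text \<open>For a completed measure it is not enough that the map is Borel: null sets must pull back
  to null sets. The shift even preserves the measure.\<close>

lemma measurable_shift_coord:
  fixes f :: "(nat \<Rightarrow> real) \<Rightarrow> 'b::euclidean_space"
  assumes "finite I" "k \<in> I" and f: "f \<in> borel_measurable (lebesgue_on_coords I)"
  shows "(\<lambda>t. f (t(k := t k + c))) \<in> borel_measurable (lebesgue_on_coords I)"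
proof -
  have T: "(\<lambda>t. t(k := t k + c)) \<in> coords_borel I \<rightarrow>\<^sub>M coords_borel I"
    using assms(2) by (intro measurable_PiM_single')
      (auto simp: space_PiM fun_upd_def PiE_def extensional_def)
  obtain f' where f': "f' \<in> borel_measurable (coords_borel I)" "AE t in coords_borel I. f t = f' t"
    using completion_ex_borel_measurable_euclidean[OF f[unfolded lebesgue_on_coords_def]] by auto
  have "AE t in coords_borel I. f (t(k := t k + c)) = f' (t(k := t k + c))"
    by (rule AE_distrD[OF T]) (unfold distr_shift_coord[OF assms(1,2)], rule f'(2))
  moreover have "(\<lambda>t. f' (t(k := t k + c))) \<in> borel_measurable (completion (coords_borel I))"
    by (intro measurable_completion measurable_compose[OF T f'(1)])
  ultimately show ?thesis
    unfolding lebesgue_on_coords_def by (rule borel_measurable_completion_cong_AE[rotated])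
qed

text \<open>Tonelli for the indicator of a measurable null set that contains the exceptions.\<close>

lemma AE_coords_insert:
  assumes I: "finite I" "k \<notin> I" and ae: "AE t in coords_borel (insert k I). P t"
  shows "AE t in coords_borel I. AE x in lborel. P (t(k := x))"
proof -
  from ae obtain B where B: "B \<in> null_sets (coords_borel (insert k I))"
    "{t \<in> space (coords_borel (insert k I)). \<not> P t} \<subseteq> B"
    unfolding eventually_ae_filter by blast
  have B': "B \<in> sets (coords_borel (insert k I))" "emeasure (coords_borel (insert k I)) B = 0"
    using B(1) by auto
  interpret pair_sigma_finite "coords_borel I" lborel
    using coords.sigma_finite[OF I(1)] by (intro pair_sigma_finite.intro sigma_finite_lborel)
  have upd: "(\<lambda>(t, x). t(k := x)) \<in> coords_borel I \<Otimes>\<^sub>M lborel \<rightarrow>\<^sub>M coords_borel (insert k I)"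
    by measurable
  have "0 = (\<integral>\<^sup>+ t. indicator B t \<partial>coords_borel (insert k I))"
    using B' by simp
  also have "\<dots> = (\<integral>\<^sup>+ t. \<integral>\<^sup>+ x. indicator B (t(k := x)) \<partial>lborel \<partial>coords_borel I)"
    using B'(1) by (intro coords.product_nn_integral_insert I) auto
  finally have "AE t in coords_borel I. (\<integral>\<^sup>+ x. indicator B (t(k := x)) \<partial>lborel) = 0"
    using measurable_compose[OF upd, of "indicator B"] B'(1)
    by (subst (asm) eq_commute, subst (asm) nn_integral_0_iff_AE)
      (auto intro!: borel_measurable_nn_integral simp: split_beta')
  with AE_space show ?thesis
  proof eventually_elim
    case (elim t)
    have m: "(\<lambda>x. t(k := x)) \<in> lborel \<rightarrow>\<^sub>M coords_borel (insert k I)"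
      using measurable_component_update[OF elim(1) I(2)] by simp
    have "(\<lambda>x. indicator B (t(k := x)) :: ennreal) \<in> borel_measurable lborel"
      by (rule measurable_compose[OF m borel_measurable_indicator[OF B'(1)]])
    with elim(2) have "AE x in lborel. indicator B (t(k := x)) = (0 :: ennreal)"
      by (subst (asm) nn_integral_0_iff_AE) auto
    then show ?case
    proof eventually_elim
      case (elim x)
      have "t(k := x) \<in> space (coords_borel (insert k I))"
        using measurable_space[OF m] by simp
      with B(2) elim show ?case by (auto simp: indicator_def split: if_splits)
    qed
  qed
qed

context
  fixes I :: "nat set" and k :: nat
  assumes I: "finite I" "k \<notin> I"
begin

text \<open>A section of F may fail to be measurable. Those of a Borel version F' never do, and
  almost every section of F agrees with that of F' almost everywhere.\<close>

lemma section_borel_version: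
  fixes F :: "(nat \<Rightarrow> real) \<Rightarrow> 'b::euclidean_space"
  assumes "F \<in> borel_measurable (lebesgue_on_coords (insert k I))"
  obtains F' where "F' \<in> borel_measurable (coords_borel (insert k I))"
    "AE t in coords_borel (insert k I). F t = F' t"
    "AE t in coords_borel I. AE x in lborel. F (t(k := x)) = F' (t(k := x))"
    "\<forall>t\<in>space (coords_borel I). (\<lambda>x. F' (t(k := x))) \<in> borel_measurable lborel"
    "(\<lambda>(t, x). F' (t(k := x))) \<in> borel_measurable (coords_borel I \<Otimes>\<^sub>M lborel)"
proof -
  obtain F' where F': "F' \<in> borel_measurable (coords_borel (insert k I))"
    "AE t in coords_borel (insert k I). F t = F' t"
    using completion_ex_borel_measurable_euclidean[OF assms[unfolded lebesgue_on_coords_def]] by auto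
  have upd: "(\<lambda>(t, x). t(k := x)) \<in> coords_borel I \<Otimes>\<^sub>M lborel \<rightarrow>\<^sub>M coords_borel (insert k I)"
    by measurable
  show ?thesis
  proof (rule that[OF F' AE_coords_insert[OF I F'(2)]])
    show "\<forall>t\<in>space (coords_borel I). (\<lambda>x. F' (t(k := x))) \<in> borel_measurable lborel"
      by (intro ballI measurable_compose[OF measurable_component_update[OF _ I(2)] F'(1)])
    show "(\<lambda>(t, x). F' (t(k := x))) \<in> borel_measurable (coords_borel I \<Otimes>\<^sub>M lborel)"
      using measurable_compose[OF upd F'(1)] by (simp add: split_beta')
  qed
qed

text \<open>Here t_k is frozen and the other coordinates vary. A single slice is a null set, so
  measurability of F says nothing about a prescribed one, only about almost all. Tonelli, with t_k
  as the outer variable, shows this.\<close>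

lemma measurable_slice_AE:
  fixes F :: "(nat \<Rightarrow> real) \<Rightarrow> 'b::euclidean_space"
  assumes "F \<in> borel_measurable (lebesgue_on_coords (insert k I))"
  shows "AE x in lborel. (\<lambda>t. F (t(k := x))) \<in> borel_measurable (lebesgue_on_coords I)"
proof -
  obtain F' where F': "F' \<in> borel_measurable (coords_borel (insert k I))"
    "AE t in coords_borel (insert k I). F t = F' t"
    "AE t in coords_borel I. AE x in lborel. F (t(k := x)) = F' (t(k := x))"
    "\<forall>t\<in>space (coords_borel I). (\<lambda>x. F' (t(k := x))) \<in> borel_measurable lborel"
    "(\<lambda>(t, x). F' (t(k := x))) \<in> borel_measurable (coords_borel I \<Otimes>\<^sub>M lborel)"
    by (rule section_borel_version[OF assms])
  from F'(2) obtain B where B: "B \<in> null_sets (coords_borel (insert k I))"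
    "{t \<in> space (coords_borel (insert k I)). F t \<noteq> F' t} \<subseteq> B"
    unfolding eventually_ae_filter by blast
  have B': "B \<in> sets (coords_borel (insert k I))" "emeasure (coords_borel (insert k I)) B = 0"
    using B(1) by auto
  have upd: "(\<lambda>(x, t). t(k := x)) \<in> lborel \<Otimes>\<^sub>M coords_borel I \<rightarrow>\<^sub>M coords_borel (insert k I)"
    by measurable
  have m: "(\<lambda>t. t(k := x)) \<in> coords_borel I \<rightarrow>\<^sub>M coords_borel (insert k I)" for x
    using measurable_compose[OF measurable_Pair[OF measurable_const measurable_ident] upd, of x] by simp
  have "0 = (\<integral>\<^sup>+ t. indicator B t \<partial>coords_borel (insert k I))"
    using B' by simp
  also have "\<dots> = (\<integral>\<^sup>+ x. \<integral>\<^sup>+ t. indicator B (t(k := x)) \<partial>coords_borel I \<partial>lborel)"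
    using B'(1) by (intro coords.product_nn_integral_insert_rev I) auto
  finally have 0: "(\<integral>\<^sup>+ x. \<integral>\<^sup>+ t. indicator B (t(k := x)) \<partial>coords_borel I \<partial>lborel) = 0" ..
  have "(\<lambda>(x, t). indicator B (t(k := x)) :: ennreal) \<in> borel_measurable (lborel \<Otimes>\<^sub>M coords_borel I)"
    using measurable_compose[OF upd borel_measurable_indicator[OF B'(1)]] unfolding split_beta' .
  from sigma_finite_measure.borel_measurable_nn_integral[OF coords.sigma_finite[OF I(1)] this]
  have "AE x in lborel. (\<integral>\<^sup>+ t. indicator B (t(k := x)) \<partial>coords_borel I) = 0"
    using 0 by (rule nn_integral_0_iff_AE[THEN iffD1])
  then show ?thesis
  proof eventually_elim
    case (elim x)
    have "(\<lambda>t. indicator B (t(k := x)) :: ennreal) \<in> borel_measurable (coords_borel I)"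
      by (rule measurable_compose[OF m borel_measurable_indicator[OF B'(1)]])
    with elim have "AE t in coords_borel I. indicator B (t(k := x)) = (0 :: ennreal)"
      by (subst (asm) nn_integral_0_iff_AE) auto
    with AE_space have "AE t in coords_borel I. F (t(k := x)) = F' (t(k := x))"
    proof eventually_elim
      case (elim t)
      have "t(k := x) \<in> space (coords_borel (insert k I))"
        using measurable_space[OF m elim(1)] .
      with B(2) elim(2) show ?case by (auto simp: indicator_def split: if_splits)
    qed
    then show ?case
      unfolding lebesgue_on_coords_def
      by (rule borel_measurable_completion_cong_AE[OF measurable_completion, rotated])
        (rule measurable_compose[OF m F'(1)])
  qed
qed

lemma measurable_section_integral:
  fixes F :: "(nat \<Rightarrow> real) \<Rightarrow> 'b::euclidean_space"
  assumes "F \<in> borel_measurable (lebesgue_on_coords (insert k I))"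
  shows "(\<lambda>t. \<integral>x. F (t(k := x)) \<partial>lebesgue) \<in> borel_measurable (lebesgue_on_coords I)"
proof -
  obtain F' where F': "F' \<in> borel_measurable (coords_borel (insert k I))"
    "AE t in coords_borel (insert k I). F t = F' t"
    "AE t in coords_borel I. AE x in lborel. F (t(k := x)) = F' (t(k := x))"
    "\<forall>t\<in>space (coords_borel I). (\<lambda>x. F' (t(k := x))) \<in> borel_measurable lborel"
    "(\<lambda>(t, x). F' (t(k := x))) \<in> borel_measurable (coords_borel I \<Otimes>\<^sub>M lborel)"
    by (rule section_borel_version[OF assms])
  have "AE t in coords_borel I. (\<integral>x. F (t(k := x)) \<partial>lebesgue) = (\<integral>x. F' (t(k := x)) \<partial>lborel)"
    using AE_space F'(3)
  proof eventually_elim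
    case (elim t)
    have m: "(\<lambda>x. F' (t(k := x))) \<in> borel_measurable lborel" by (rule F'(4)[rule_format, OF elim(1)])
    have m': "(\<lambda>x. F (t(k := x))) \<in> borel_measurable lebesgue"
      by (rule borel_measurable_completion_cong_AE[OF measurable_completion[OF m] elim(2)])
    have "(\<integral>x. F (t(k := x)) \<partial>lebesgue) = (\<integral>x. F' (t(k := x)) \<partial>lebesgue)"
      by (rule integral_cong_AE[OF m' measurable_completion[OF m]]) (simp add: AE_completion_iff elim(2))
    then show ?case unfolding integral_completion[OF m] .
  qed
  moreover have "(\<lambda>t. \<integral>x. F' (t(k := x)) \<partial>lborel) \<in> borel_measurable (coords_borel I)"
    using F'(5) by (rule sigma_finite_measure.borel_measurable_lebesgue_integral[OF sigma_finite_lborel])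
  ultimately show ?thesis
    unfolding lebesgue_on_coords_def
    by (rule borel_measurable_completion_cong_AE[OF measurable_completion, rotated])
qed

text \<open>The three claims hold for the Borel version F' and pass to F because almost all sections
  agree almost everywhere.\<close>

lemma fubini_coord:
  fixes F :: "(nat \<Rightarrow> real) \<Rightarrow> 'b::euclidean_space"
  assumes int: "integrable (lebesgue_on_coords (insert k I)) F"
  shows "AE t in coords_borel I. integrable lebesgue (\<lambda>x. F (t(k := x)))"
    and "integrable (lebesgue_on_coords I) (\<lambda>t. \<integral>x. F (t(k := x)) \<partial>lebesgue)"
    and "(\<integral>t. F t \<partial>lebesgue_on_coords (insert k I)) =
      (\<integral>t. \<integral>x. F (t(k := x)) \<partial>lebesgue \<partial>lebesgue_on_coords I)"
proof -
  have meas: "F \<in> borel_measurable (lebesgue_on_coords (insert k I))" using int by auto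
  obtain F' where F': "F' \<in> borel_measurable (coords_borel (insert k I))"
    "AE t in coords_borel (insert k I). F t = F' t"
    "AE t in coords_borel I. AE x in lborel. F (t(k := x)) = F' (t(k := x))"
    "\<forall>t\<in>space (coords_borel I). (\<lambda>x. F' (t(k := x))) \<in> borel_measurable lborel"
    "(\<lambda>(t, x). F' (t(k := x))) \<in> borel_measurable (coords_borel I \<Otimes>\<^sub>M lborel)"
    by (rule section_borel_version[OF meas])
  have int': "integrable (coords_borel (insert k I)) F'"
  proof -
    have "integrable (lebesgue_on_coords (insert k I)) F'"
      by (rule integrable_cong_AE_imp[OF int measurable_lebesgue_on_coords[OF F'(1)]])
        (simp add: AE_lebesgue_on_coords F'(2))
    then show ?thesis using F'(1) by (simp add: lebesgue_on_coords_def integrable_completion)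
  qed
  have fin: "(\<integral>\<^sup>+ t. \<integral>\<^sup>+ x. norm (F' (t(k := x))) \<partial>lborel \<partial>coords_borel I) < \<infinity>"
    using int' F'(1) by (subst coords.product_nn_integral_insert[OF I, symmetric]) (auto simp: integrable_iff_bounded)
  have "(\<lambda>t. \<integral>\<^sup>+ x. norm (F' (t(k := x))) \<partial>lborel) \<in> borel_measurable (coords_borel I)"
    using F'(5) by (intro sigma_finite_measure.borel_measurable_nn_integral[OF sigma_finite_lborel])
      (auto simp: split_beta')
  from nn_integral_PInf_AE[OF this] fin
  have "AE t in coords_borel I. (\<integral>\<^sup>+ x. norm (F' (t(k := x))) \<partial>lborel) < \<infinity>"
    by (auto simp: less_top)
  with AE_space have int'_sec: "AE t in coords_borel I. integrable lborel (\<lambda>x. F' (t(k := x)))"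
    by eventually_elim (use F'(4) in \<open>simp add: integrable_iff_bounded\<close>)
  have sec: "AE t in coords_borel I. integrable lebesgue (\<lambda>x. F (t(k := x))) \<and>
      (\<integral>x. F (t(k := x)) \<partial>lebesgue) = (\<integral>x. F' (t(k := x)) \<partial>lborel)"
    using AE_space F'(3) int'_sec
  proof eventually_elim
    case (elim t)
    have m: "(\<lambda>x. F' (t(k := x))) \<in> borel_measurable lborel" by (rule F'(4)[rule_format, OF elim(1)])
    have m': "(\<lambda>x. F (t(k := x))) \<in> borel_measurable lebesgue"
      by (rule borel_measurable_completion_cong_AE[OF measurable_completion[OF m] elim(2)])
    have "integrable lebesgue (\<lambda>x. F (t(k := x))) \<longleftrightarrow> integrable lebesgue (\<lambda>x. F' (t(k := x)))"
      by (rule integrable_cong_AE[OF m' measurable_completion[OF m]]) (simp add: AE_completion_iff elim(2))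
    moreover have "(\<integral>x. F (t(k := x)) \<partial>lebesgue) = (\<integral>x. F' (t(k := x)) \<partial>lebesgue)"
      by (rule integral_cong_AE[OF m' measurable_completion[OF m]]) (simp add: AE_completion_iff elim(2))
    ultimately show ?case
      using elim(3) unfolding integral_completion[OF m] integrable_completion[OF m] by blast
  qed
  then show "AE t in coords_borel I. integrable lebesgue (\<lambda>x. F (t(k := x)))"
    by eventually_elim auto
  have meas_int': "(\<lambda>t. \<integral>x. F' (t(k := x)) \<partial>lborel) \<in> borel_measurable (coords_borel I)"
    using F'(5) by (rule sigma_finite_measure.borel_measurable_lebesgue_integral[OF sigma_finite_lborel])
  have int'_int: "integrable (coords_borel I) (\<lambda>t. \<integral>x. F' (t(k := x)) \<partial>lborel)"
    unfolding integrable_iff_bounded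
  proof
    have "(\<integral>\<^sup>+ t. norm (\<integral>x. F' (t(k := x)) \<partial>lborel) \<partial>coords_borel I)
       \<le> (\<integral>\<^sup>+ t. \<integral>\<^sup>+ x. norm (F' (t(k := x))) \<partial>lborel \<partial>coords_borel I)"
      using int'_sec
      by (intro nn_integral_mono_AE) (auto intro: integral_norm_bound_ennreal elim: eventually_mono)
    then show "(\<integral>\<^sup>+ t. norm (\<integral>x. F' (t(k := x)) \<partial>lborel) \<partial>coords_borel I) < \<infinity>"
      using fin by (rule order_le_less_trans)
  qed (rule meas_int')
  have ms: "(\<lambda>t. \<integral>x. F (t(k := x)) \<partial>lebesgue) \<in> borel_measurable (lebesgue_on_coords I)"
    by (rule measurable_section_integral[OF meas])
  have eq: "AE t in lebesgue_on_coords I. (\<integral>x. F (t(k := x)) \<partial>lebesgue) = (\<integral>x. F' (t(k := x)) \<partial>lborel)"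
    using sec unfolding AE_lebesgue_on_coords by eventually_elim auto
  show "integrable (lebesgue_on_coords I) (\<lambda>t. \<integral>x. F (t(k := x)) \<partial>lebesgue)"
  proof (rule integrable_cong_AE_imp[OF _ ms])
    show "integrable (lebesgue_on_coords I) (\<lambda>t. \<integral>x. F' (t(k := x)) \<partial>lborel)"
      using int'_int unfolding lebesgue_on_coords_def integrable_completion[OF meas_int'] .
  qed (use eq in \<open>auto elim: eventually_mono\<close>)
  have "(\<integral>t. F t \<partial>lebesgue_on_coords (insert k I)) = (\<integral>t. F' t \<partial>lebesgue_on_coords (insert k I))"
    by (rule integral_cong_AE[OF meas measurable_lebesgue_on_coords[OF F'(1)]])
      (simp add: AE_lebesgue_on_coords F'(2))
  also have "\<dots> = (\<integral>t. F' t \<partial>coords_borel (insert k I))"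
    unfolding lebesgue_on_coords_def by (rule integral_completion[OF F'(1)])
  also have "\<dots> = (\<integral>t. \<integral>x. F' (t(k := x)) \<partial>lborel \<partial>coords_borel I)"
    by (rule coords.product_integral_insert[OF I int'])
  also have "\<dots> = (\<integral>t. \<integral>x. F' (t(k := x)) \<partial>lborel \<partial>lebesgue_on_coords I)"
    unfolding lebesgue_on_coords_def by (rule integral_completion[OF meas_int', symmetric])
  also have "\<dots> = (\<integral>t. \<integral>x. F (t(k := x)) \<partial>lebesgue \<partial>lebesgue_on_coords I)"
    by (rule integral_cong_AE[OF measurable_lebesgue_on_coords[OF meas_int'] ms])
      (use eq in \<open>auto elim: eventually_mono\<close>)
  finally show "(\<integral>t. F t \<partial>lebesgue_on_coords (insert k I)) =
      (\<integral>t. \<integral>x. F (t(k := x)) \<partial>lebesgue \<partial>lebesgue_on_coords I)" .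
qed

end

text \<open>The exceptional set of an almost everywhere continuous function is only a subset of a null
  set, so the completion is needed here.\<close>

lemma AE_continuous_imp_measurable:
  fixes f :: "(nat \<Rightarrow> real) \<Rightarrow> 'b::euclidean_space"
  assumes "AE t in lebesgue_on_coords I. continuous (at t within I \<rightarrow>\<^sub>E UNIV) f"
  shows "f \<in> borel_measurable (lebesgue_on_coords I)"
proof (rule borel_measurableI)
  fix U :: "'b set" assume U: "open U"
  let ?X = "I \<rightarrow>\<^sub>E (UNIV :: real set)"
  \<comment> \<open>V catches every point of the preimage of U at which f is continuous; the rest
    lies in the exceptional null set.\<close>
  define V where "V = \<Union>{V. open V \<and> f ` (V \<inter> ?X) \<subseteq> U}"
  have V: "open V" "f ` (V \<inter> ?X) \<subseteq> U" by (auto simp: V_def)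
  \<comment> \<open>Openness refers to functions on all natural numbers. Coordinates outside I are
    constantly \<open>undefined\<close> on the space, hence measurable.\<close>
  have id: "(\<lambda>t. t) \<in> coords_borel I \<rightarrow>\<^sub>M (borel :: (nat \<Rightarrow> real) measure)"
  proof (rule measurable_coordinatewise_then_product)
    fix i
    show "(\<lambda>t. t i) \<in> borel_measurable (coords_borel I)"
    proof (cases "i \<in> I")
      case True
      then show ?thesis using measurable_component_singleton[of i I "\<lambda>_. lborel"] by simp
    next
      case False
      then have "t i = undefined" if "t \<in> space (coords_borel I)" for t
        using that by (auto simp: space_PiM PiE_iff extensional_def)
      then show ?thesis by (subst measurable_cong[where g="\<lambda>_. undefined"]) auto
    qed
  qed
  have "V \<inter> ?X \<in> sets (coords_borel I)"
    using measurable_sets[OF id, of V] V(1) by (simp add: space_PiM vimage_def Int_def)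
  then have 1: "V \<inter> ?X \<in> sets (lebesgue_on_coords I)" by (simp add: lebesgue_on_coords_def)
  have "{t \<in> ?X. f t \<in> U \<and> t \<notin> V} \<subseteq> {t \<in> ?X. \<not> continuous (at t within ?X) f}"
  proof safe
    fix t assume t: "t \<in> ?X" "f t \<in> U" "t \<notin> V" "continuous (at t within ?X) f"
    from t(4,2) U obtain A where "open A" "t \<in> A" "\<forall>y\<in>?X. y \<in> A \<longrightarrow> f y \<in> U"
      unfolding continuous_within_topological by blast
    then have "A \<subseteq> V" by (auto simp: V_def)
    with \<open>t \<in> A\<close> t(3) show False by auto
  qed
  moreover have "{t \<in> ?X. \<not> continuous (at t within ?X) f} \<in> null_sets (lebesgue_on_coords I)"
    using assms unfolding lebesgue_on_coords_def completion.AE_iff_null_sets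
    by (simp add: space_PiM)
  ultimately have "{t \<in> ?X. f t \<in> U \<and> t \<notin> V} \<in> null_sets (lebesgue_on_coords I)"
    unfolding lebesgue_on_coords_def by (rule null_sets_completion_subset)
  then have 2: "{t \<in> ?X. f t \<in> U \<and> t \<notin> V} \<in> sets (lebesgue_on_coords I)" by auto
  have "f -` U \<inter> space (lebesgue_on_coords I) = (V \<inter> ?X) \<union> {t \<in> ?X. f t \<in> U \<and> t \<notin> V}"
    using V(2) by auto
  then show "f -` U \<inter> space (lebesgue_on_coords I) \<in> sets (lebesgue_on_coords I)"
    using 1 2 by auto
qed

section \<open>Exponentially decaying majorants\<close>

lemma integrable_exp_abs:
  assumes "\<epsilon> > 0"
  shows "integrable lborel (\<lambda>x::real. exp (- (\<epsilon> * \<bar>x\<bar>)))"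
proof -
  define g where "g = (\<lambda>x. indicator {0..} x *\<^sub>R exp (- \<epsilon> * x) :: real)"
  have "(\<lambda>x. exp (- \<epsilon> * x)) absolutely_integrable_on {0..}"
    by (intro nonnegative_absolutely_integrable_1 integrable_on_exp_minus_to_infinity assms) auto
  then have "integrable lebesgue g" by (simp add: set_integrable_def g_def)
  moreover have m: "g \<in> borel_measurable lborel" unfolding g_def by measurable
  ultimately have g: "integrable lborel g" by (simp add: integrable_completion)
  \<comment> \<open>At x = 0 both halves contribute, so the sum is used as a majorant and not as an
    equal.\<close>
  then have "integrable lborel (\<lambda>x. g x + g (0 + (-1) * x))"
    by (intro Bochner_Integration.integrable_add lborel_integrable_real_affine) auto
  then show ?thesis
    by (rule Bochner_Integration.integrable_bound) (auto simp: g_def indicator_def)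
qed

text \<open>The exponential of a sum factors into one-dimensional integrable functions. This is the
  majorant for faces of every dimension, with I = {} for the vertices.\<close>

lemma integrable_exp_coords:
  assumes "finite I" "\<epsilon> > 0"
  shows "integrable (lebesgue_on_coords I) (\<lambda>t. exp (- (\<epsilon> * (\<Sum>i\<in>I. \<bar>t i\<bar>))))"
proof -
  have "integrable (coords_borel I) (\<lambda>t. \<Prod>i\<in>I. exp (- (\<epsilon> * \<bar>t i\<bar>)))"
    using coords.product_integrable_prod[OF assms(1), of "\<lambda>_ x. exp (- (\<epsilon> * \<bar>x\<bar>))"]
      integrable_exp_abs[OF assms(2)] by simp
  then have "integrable (lebesgue_on_coords I) (\<lambda>t. \<Prod>i\<in>I. exp (- (\<epsilon> * \<bar>t i\<bar>)))"
    unfolding lebesgue_on_coords_def by (subst integrable_completion) auto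
  then show ?thesis by (simp add: exp_sum[OF assms(1), symmetric] sum_negf sum_distrib_left)
qed

section \<open>Iterated partial derivatives on a box\<close>

lemma norm_diff_le_of_vector_derivative:
  fixes g :: "real \<Rightarrow> 'b::real_normed_vector"
  assumes "convex S" "\<And>x. x \<in> S \<Longrightarrow> (g has_vector_derivative g' x) (at x within S)"
    "\<And>x. x \<in> S \<Longrightarrow> norm (g' x) \<le> B" "x \<in> S" "y \<in> S"
  shows "norm (g x - g y) \<le> B * \<bar>x - y\<bar>"
  using differentiable_bound[OF assms(1), of g "\<lambda>x h. h *\<^sub>R g' x" B x y] assms(2-5)
  by (auto simp: has_vector_derivative_def onorm_scaleR_left bounded_linear_ident onorm_id)

text \<open>The distance at most 1 keeps the sequence in the region where a local bound on
  derivatives is available.\<close>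

lemma islimpt_approach:
  fixes x0 :: real
  assumes "x0 islimpt A"
  shows "\<exists>X :: nat \<Rightarrow> real. (\<forall>m. X m \<in> A \<and> X m \<noteq> x0 \<and> \<bar>X m - x0\<bar> \<le> 1) \<and> X \<longlonglongrightarrow> x0"
proof -
  have "x0 islimpt (A \<inter> ball x0 1)"
    by (rule islimpt_Int_eventually[OF assms eventually_at_in_open'[OF open_ball]]) simp
  then obtain X where X: "\<And>m. X m \<in> A \<inter> ball x0 1 - {x0}" "X \<longlonglongrightarrow> x0"
    unfolding islimpt_sequential by blast
  show ?thesis
    by (rule exI[of _ X]) (use X in \<open>auto simp: dist_real_def abs_minus_commute intro!: less_imp_le\<close>)
qed

lemma has_vector_derivative_iff_quotient:
  fixes g :: "real \<Rightarrow> 'b::real_normed_vector"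
  shows "(g has_vector_derivative D) (at x0 within A) \<longleftrightarrow>
    ((\<lambda>x. (g x - g x0) /\<^sub>R (x - x0)) \<longlongrightarrow> D) (at x0 within A)"
proof -
  have "norm (g x - g x0 - (x - x0) *\<^sub>R D) / norm (x - x0) = norm ((g x - g x0) /\<^sub>R (x - x0) - D)"
    if "x \<noteq> x0" for x
  proof -
    have "(g x - g x0) /\<^sub>R (x - x0) - D = (g x - g x0 - (x - x0) *\<^sub>R D) /\<^sub>R (x - x0)"
      using that by (simp add: scaleR_diff_right)
    then show ?thesis by (simp add: divide_inverse mult.commute)
  qed
  then have ev: "\<forall>\<^sub>F x in at x0 within A.
      norm (g x - g x0 - (x - x0) *\<^sub>R D) / norm (x - x0) = norm ((g x - g x0) /\<^sub>R (x - x0) - D)"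
    by (auto simp: eventually_at_filter)
  show ?thesis
    unfolding has_vector_derivative_def has_derivative_iff_norm tendsto_cong[OF ev]
      tendsto_norm_zero_iff Lim_null[of _ D, symmetric]
    by (simp add: bounded_linear_scaleR_left)
qed

lemmas vector_derivative_quotient = has_vector_derivative_iff_quotient[THEN iffD1]

text \<open>Mixed partial derivatives commute as soon as the iterated derivative \<open>w\<close> is bounded: the
  difference quotients in \<open>x\<close> of the \<open>y\<close>-derivatives then converge uniformly.\<close>

lemma mixed_partials:
  fixes g gy gyx w :: "real \<Rightarrow> real \<Rightarrow> 'b::euclidean_space"
  assumes cA: "convex A" and cB: "convex B" and x0: "x0 \<in> A" "x0 islimpt A" and y0: "y0 \<in> B"
    and gy: "\<And>x y. x \<in> A \<Longrightarrow> y \<in> B \<Longrightarrow> (g x has_vector_derivative gy x y) (at y within B)"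
    and gx: "\<And>y. y \<in> B \<Longrightarrow> ((\<lambda>x. g x y) has_vector_derivative gx y) (at x0 within A)"
    and gyx: "\<And>x y. x \<in> A \<Longrightarrow> y \<in> B \<Longrightarrow> ((\<lambda>x. gy x y) has_vector_derivative gyx x y) (at x within A)"
    and w: "\<And>x y. x \<in> A \<Longrightarrow> y \<in> B \<Longrightarrow> ((\<lambda>x. gyx x y) has_vector_derivative w x y) (at x within A)"
    and C: "\<And>x y. x \<in> A \<Longrightarrow> y \<in> B \<Longrightarrow> \<bar>x - x0\<bar> \<le> 1 \<Longrightarrow> \<bar>y - y0\<bar> \<le> 1 \<Longrightarrow> norm (w x y) \<le> C"
  shows "(gx has_vector_derivative gyx x0 y0) (at y0 within B)"
proof -
  obtain X :: "nat \<Rightarrow> real" where X: "\<And>m. X m \<in> A" "\<And>m. X m \<noteq> x0" "\<And>m. \<bar>X m - x0\<bar> \<le> 1" "X \<longlonglongrightarrow> x0"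
    using islimpt_approach[OF x0(2)] by blast
  \<comment> \<open>The part of B on which the bound C applies; near y0 it coincides with B.\<close>
  define S where "S = B \<inter> cball y0 1"
  have S: "convex S" "S \<subseteq> B" "y0 \<in> S" "\<And>y. y \<in> S \<Longrightarrow> \<bar>y - y0\<bar> \<le> 1"
    unfolding S_def using cB y0 by (auto simp: dist_real_def abs_minus_commute intro: convex_Int)
  define F where "F = (\<lambda>m y. (g (X m) y - g x0 y) /\<^sub>R (X m - x0))"
  define F' where "F' = (\<lambda>m y. (gy (X m) y - gy x0 y) /\<^sub>R (X m - x0))"
  have C0: "0 \<le> C" using C[OF x0(1) y0] by (auto intro: order_trans[OF norm_ge_zero])
  \<comment> \<open>By the bound on its derivative w, \<open>gyx\<close> is Lipschitz in x with
    constant C. Replacing its values by the one at x0 therefore costs at most C |X m - x0|,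
    uniformly in y.\<close>
  have bound: "norm (F' m y - gyx x0 y) \<le> C * \<bar>X m - x0\<bar>" if y: "y \<in> S" for m y
  proof -
    let ?S = "A \<inter> cball x0 \<bar>X m - x0\<bar>"
    have cS: "convex ?S" using cA by (intro convex_Int) auto
    have yB: "y \<in> B" using y S(2) by blast
    have le1: "\<bar>x - x0\<bar> \<le> 1" "\<bar>x - x0\<bar> \<le> \<bar>X m - x0\<bar>" "x \<in> A" if "x \<in> ?S" for x
      using that X(3)[of m] by (auto simp: dist_real_def abs_minus_commute)
    have x0S: "x0 \<in> ?S" and XS: "X m \<in> ?S" using x0 X(1) by (auto simp: dist_real_def abs_minus_commute)
    have 1: "norm (gyx x y - gyx x0 y) \<le> C * \<bar>X m - x0\<bar>" if "x \<in> ?S" for x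
    proof -
      have "norm (gyx x y - gyx x0 y) \<le> C * \<bar>x - x0\<bar>"
      proof (rule norm_diff_le_of_vector_derivative[OF cS _ _ that x0S, where g' = "\<lambda>x. w x y"])
        fix x assume x: "x \<in> ?S"
        then show "((\<lambda>x. gyx x y) has_vector_derivative w x y) (at x within ?S)"
          using w[OF _ yB] by (auto intro: has_vector_derivative_within_subset)
        show "norm (w x y) \<le> C" using le1[OF x] C[OF _ yB _ S(4)[OF y]] by auto
      qed
      also have "\<dots> \<le> C * \<bar>X m - x0\<bar>" using le1[OF that] C0 by (intro mult_left_mono) auto
      finally show ?thesis .
    qed
    have "norm (gy (X m) y - gy x0 y - (X m - x0) *\<^sub>R gyx x0 y) \<le> norm (X m - x0) * (C * \<bar>X m - x0\<bar>)"
    proof (rule vector_differentiable_bound_linearization[where S = ?S and f' = "\<lambda>x. gyx x y" and ?x0.0 = x0])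
      show "((\<lambda>x. gy x y) has_vector_derivative gyx x y) (at x within ?S)" if "x \<in> ?S" for x
        using gyx[OF _ yB] that by (auto intro: has_vector_derivative_within_subset)
      show "closed_segment x0 (X m) \<subseteq> ?S" by (rule closed_segment_subset[OF x0S XS cS])
    qed (use 1 x0S in auto)
    moreover have "F' m y - gyx x0 y = (gy (X m) y - gy x0 y - (X m - x0) *\<^sub>R gyx x0 y) /\<^sub>R (X m - x0)"
      using X(2)[of m] by (simp add: F'_def scaleR_diff_right)
    ultimately show ?thesis using X(2)[of m] by (simp add: divide_simps mult_ac)
  qed
  \<comment> \<open>Termwise differentiation: the derivatives \<open>F' m\<close> converge uniformly
    and the \<open>F m\<close> converge at y0. The limit h is then recognised as
    \<open>gx\<close>.\<close>
  have "\<exists>h. \<forall>y\<in>S. (\<lambda>m. F m y) \<longlonglongrightarrow> h y \<and> (h has_derivative (\<lambda>v. v *\<^sub>R gyx x0 y)) (at y within S)"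
  proof (rule has_derivative_sequence[OF S(1) _ _ S(3), where f' = "\<lambda>m y v. v *\<^sub>R F' m y" and l = "gx y0"])
    show "(F m has_derivative (\<lambda>v. v *\<^sub>R F' m y)) (at y within S)" if y: "y \<in> S" for m y
    proof -
      have "(F m has_vector_derivative F' m y) (at y within B)"
        unfolding F_def F'_def using y S(2)
        by (intro bounded_linear.has_vector_derivative[OF bounded_linear_scaleR_right]
            has_vector_derivative_diff gy X(1) x0(1)) auto
      then show ?thesis
        using S(2) by (auto simp: has_vector_derivative_def intro: has_derivative_subset)
    qed
    show "\<forall>\<^sub>F m in sequentially. \<forall>y\<in>S. \<forall>v. norm (v *\<^sub>R F' m y - v *\<^sub>R gyx x0 y) \<le> \<epsilon> * norm v"
      if "\<epsilon> > 0" for \<epsilon>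
    proof -
      have "(\<lambda>m. C * \<bar>X m - x0\<bar>) \<longlonglongrightarrow> C * \<bar>x0 - x0\<bar>"
        by (intro tendsto_intros X(4))
      then have "\<forall>\<^sub>F m in sequentially. C * \<bar>X m - x0\<bar> < \<epsilon>"
        using that by (intro order_tendstoD(2)) auto
      then show ?thesis
      proof eventually_elim
        case (elim m)
        show ?case
        proof (intro ballI allI)
          fix y v assume "y \<in> S"
          then have "norm (F' m y - gyx x0 y) \<le> \<epsilon>" using bound[of y m] elim by linarith
          then have "\<bar>v\<bar> * norm (F' m y - gyx x0 y) \<le> \<bar>v\<bar> * \<epsilon>" by (intro mult_left_mono) auto
          then show "norm (v *\<^sub>R F' m y - v *\<^sub>R gyx x0 y) \<le> \<epsilon> * norm v"
            by (simp add: scaleR_diff_right[symmetric] mult.commute)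
        qed
      qed
    qed
    show "(\<lambda>m. F m y0) \<longlonglongrightarrow> gx y0"
    proof -
      have "((\<lambda>x. (g x y0 - g x0 y0) /\<^sub>R (x - x0)) \<longlongrightarrow> gx y0) (at x0 within A)"
        by (rule vector_derivative_quotient[OF gx[OF y0]])
      then show ?thesis unfolding F_def
        by (rule filterlim_compose) (use X in \<open>auto simp: filterlim_at\<close>)
    qed
  qed
  then obtain h where h: "\<And>y. y \<in> S \<Longrightarrow> (\<lambda>m. F m y) \<longlonglongrightarrow> h y"
    "\<And>y. y \<in> S \<Longrightarrow> (h has_vector_derivative gyx x0 y) (at y within S)"
    unfolding has_vector_derivative_def by blast
  have "h y = gx y" if "y \<in> S" for y
  proof -
    have "((\<lambda>x. (g x y - g x0 y) /\<^sub>R (x - x0)) \<longlongrightarrow> gx y) (at x0 within A)"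
      using gx[of y] that S(2) by (intro vector_derivative_quotient) auto
    then have "(\<lambda>m. F m y) \<longlonglongrightarrow> gx y" unfolding F_def
      by (rule filterlim_compose) (use X in \<open>auto simp: filterlim_at\<close>)
    with h(1)[OF that] show ?thesis by (rule LIMSEQ_unique)
  qed
  then have "(gx has_vector_derivative gyx x0 y0) (at y0 within S)"
    by (intro has_vector_derivative_transform[OF S(3) _ h(2)[OF S(3)]]) auto
  moreover have "at y0 within S = at y0 within B"
    by (rule at_within_nhd[of _ "ball y0 1"]) (auto simp: S_def)
  ultimately show ?thesis by simp
qed

section \<open>Boxes, iterated derivatives and growth bounds\<close>

locale box =
  fixes n :: nat and a b :: "nat \<Rightarrow> ereal"
  assumes ab: "\<forall>k\<in>{1..n}. a k < b k"
begin

abbreviation "Q \<equiv> box_Q n a b"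

lemma convex_edge: "convex (edge a b k)"
  unfolding edge_def
  by (intro is_interval_convex is_interval_1[THEN iffD2])
    (auto, metis ereal_less_eq(3) order_trans, metis ereal_less_eq(3) order_trans)

lemma islimpt_edge:
  assumes "k \<in> {1..n}" "x \<in> edge a b k"
  shows "x islimpt edge a b k"
proof (rule connected_imp_perfect[OF convex_connected[OF convex_edge] assms(2)])
  obtain z where z: "a k < ereal z" "ereal z < b k" using ab assms(1) ereal_dense2 by blast
  obtain y where y: "ereal z < ereal y" "ereal y < b k" using z(2) ereal_dense2 by blast
  have "z \<in> edge a b k" "y \<in> edge a b k" "z \<noteq> y"
    using z y order.strict_trans[OF z(1) y(1)] by (auto simp: edge_def intro: less_imp_le)
  then show "edge a b k \<noteq> {x}" for x by (metis singletonD)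
qed

lemma box_Q_upd: "t \<in> Q \<Longrightarrow> k \<in> {1..n} \<Longrightarrow> x \<in> edge a b k \<Longrightarrow> t(k := x) \<in> Q"
  by (auto simp: box_Q_def edge_def PiE_iff extensional_def)

lemma box_Q_edge: "t \<in> Q \<Longrightarrow> k \<in> {1..n} \<Longrightarrow> t k \<in> edge a b k"
  by (auto simp: box_Q_def edge_def)

definition has_partial ::
    "nat \<Rightarrow> ((nat \<Rightarrow> real) \<Rightarrow> 'b::euclidean_space) \<Rightarrow> ((nat \<Rightarrow> real) \<Rightarrow> 'b) \<Rightarrow> bool" where
  "has_partial k g h \<longleftrightarrow>
     (\<forall>t\<in>Q. ((\<lambda>x. g (t(k := x))) has_vector_derivative h t) (at (t k) within edge a b k))"

lemma has_partialD:
  assumes "has_partial k g h" "t \<in> Q" "k \<in> {1..n}" "x \<in> edge a b k"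
  shows "((\<lambda>x. g (t(k := x))) has_vector_derivative h (t(k := x))) (at x within edge a b k)"
  using assms(1)[unfolded has_partial_def, rule_format, OF box_Q_upd[OF assms(2-4)]] by simp

lemma mpderiv_cong:
  assumes "\<And>i. i \<in> {1..n} \<Longrightarrow> m i = m' i"
  shows "mpderiv n a b m f = mpderiv n a b m' f"
  unfolding mpderiv_def by (rule foldr_cong) (use assms in auto)

lemma foldr_pderiv1_zero: "(\<And>k. k \<in> set ks \<Longrightarrow> m k = 0) \<Longrightarrow> foldr (\<lambda>k. pderiv1 a b k ^^ m k) ks f = f"
  by (induction ks) auto

lemma mpderiv_zero: "(\<And>i. i \<in> {1..n} \<Longrightarrow> m i = 0) \<Longrightarrow> mpderiv n a b m f = f"
  unfolding mpderiv_def by (rule foldr_pderiv1_zero) auto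

text \<open>If the orders below k vanish, d/dt_k is the outermost derivative, so raising its order
  is one more differentiation.\<close>

lemma mpderiv_Suc:
  fixes f :: "(nat \<Rightarrow> real) \<Rightarrow> 'b::euclidean_space"
  assumes k: "k \<in> {1..n}" and low: "\<And>i. i \<in> {1..<k} \<Longrightarrow> m i = 0"
  shows "mpderiv n a b (m(k := Suc (m k))) f = pderiv1 a b k (mpderiv n a b m f)"
proof -
  have ks: "[1..<Suc n] = [1..<k] @ k # [Suc k..<Suc n]"
    using k upt_add_eq_append[of 1 k "Suc n - k"] upt_conv_Cons[of k "Suc n"] by auto
  have l: "foldr (\<lambda>i. pderiv1 a b i ^^ (m(k := Suc (m k))) i) [1..<k] F = F"
    "foldr (\<lambda>i. pderiv1 a b i ^^ m i) [1..<k] F = F" for F :: "(nat \<Rightarrow> real) \<Rightarrow> 'b"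
    by (rule foldr_pderiv1_zero; use low in auto)+
  have h: "foldr (\<lambda>i. pderiv1 a b i ^^ (m(k := Suc (m k))) i) [Suc k..<Suc n] f =
      foldr (\<lambda>i. pderiv1 a b i ^^ m i) [Suc k..<Suc n] f"
    by (rule foldr_cong) auto
  show ?thesis
    unfolding mpderiv_def ks foldr_append foldr.simps o_apply h l by simp
qed

text \<open>Each t lies in the orthant given by its signs, and the finitely many constants are added
  up. Passing from c to A where t_k \<ge> 0 and from d to B where t_k < 0 only enlarges the
  exponent; thus a single pair of rates serves all derivatives.\<close>

lemma growth_bound:
  fixes h :: "(nat \<Rightarrow> real) \<Rightarrow> 'b::euclidean_space"
  assumes g: "growth n c d (restrict_Q n a b h)" and "c \<le> A" "B \<le> d"
  shows "\<exists>C\<ge>0. \<forall>t\<in>Q. norm (h t) \<le> C * exp (\<Sum>k=1..n. if 0 \<le> t k then A * t k else B * t k)"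
proof -
  let ?V = "{1..n} \<rightarrow>\<^sub>E {-1, 1 :: real}"
  have "\<forall>v\<in>?V. \<exists>C>0. \<forall>t\<in>Rn n. (\<forall>k\<in>{1..n}. v k * t k \<ge> 0) \<longrightarrow>
      norm (restrict_Q n a b h t) < C * exp (\<Sum>k=1..n. (if v k = 1 then c else d) * t k)"
    using g by (simp add: growth_def)
  from bchoice[OF this] obtain C where *: "\<forall>v\<in>?V. C v > 0 \<and> (\<forall>t\<in>Rn n. (\<forall>k\<in>{1..n}. v k * t k \<ge> 0) \<longrightarrow>
      norm (restrict_Q n a b h t) < C v * exp (\<Sum>k=1..n. (if v k = 1 then c else d) * t k))" ..
  have C: "C v > 0"
    "t \<in> Rn n \<Longrightarrow> (\<forall>k\<in>{1..n}. v k * t k \<ge> 0) \<Longrightarrow>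
      norm (restrict_Q n a b h t) < C v * exp (\<Sum>k=1..n. (if v k = 1 then c else d) * t k)"
    if "v \<in> ?V" for v t using *[rule_format, OF that] by blast+
  have fin: "finite ?V" by (intro finite_PiE) auto
  show ?thesis
  proof (intro exI conjI ballI)
    show "0 \<le> sum C ?V" using C(1) by (intro sum_nonneg) (auto intro: less_imp_le)
    fix t assume t: "t \<in> Q"
    define v where "v = (\<lambda>k\<in>{1..n}. if 0 \<le> t k then 1 else (-1::real))"
    have v: "v \<in> ?V" by (auto simp: v_def)
    have tR: "t \<in> Rn n" using t by (auto simp: box_Q_def)
    have "norm (h t) = norm (restrict_Q n a b h t)" using t by (simp add: restrict_Q_def)
    also have "\<dots> \<le> C v * exp (\<Sum>k=1..n. (if v k = 1 then c else d) * t k)"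
      by (intro less_imp_le C(2) v tR) (auto simp: v_def)
    also have "\<dots> \<le> sum C ?V * exp (\<Sum>k=1..n. if 0 \<le> t k then A * t k else B * t k)"
    proof (intro mult_mono)
      show "C v \<le> sum C ?V" using C(1) v fin by (intro member_le_sum) (auto intro: less_imp_le)
      have "(if v k = 1 then c else d) * t k \<le> (if 0 \<le> t k then A * t k else B * t k)"
        if "k \<in> {1..n}" for k
      proof (cases "0 \<le> t k")
        case True
        then show ?thesis using that assms(2) by (simp add: v_def mult_right_mono)
      next
        case False
        then show ?thesis using that assms(3) by (simp add: v_def mult_right_mono_neg)
      qed
      then show "exp (\<Sum>k=1..n. (if v k = 1 then c else d) * t k)
          \<le> exp (\<Sum>k=1..n. if 0 \<le> t k then A * t k else B * t k)"
        by (auto intro: sum_mono)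
    qed (use C(1) fin in \<open>auto intro!: sum_nonneg intro: less_imp_le\<close>)
    finally show "norm (h t) \<le> sum C ?V * exp (\<Sum>k=1..n. if 0 \<le> t k then A * t k else B * t k)" .
  qed
qed

text \<open>Bounded coordinates bound the exponent. This supplies the constant C of
  \<open>mixed_partials\<close>.\<close>

lemma growth_locally_bounded:
  fixes h :: "(nat \<Rightarrow> real) \<Rightarrow> 'b::euclidean_space"
  assumes g: "growth n c d (restrict_Q n a b h)"
  shows "\<exists>C. \<forall>t\<in>Q. (\<forall>k\<in>{1..n}. \<bar>t k\<bar> \<le> T) \<longrightarrow> norm (h t) \<le> C"
proof -
  obtain C where C: "C \<ge> 0"
    "\<And>t. t \<in> Q \<Longrightarrow> norm (h t) \<le> C * exp (\<Sum>k=1..n. if 0 \<le> t k then c * t k else d * t k)"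
    using growth_bound[OF g order_refl order_refl] by blast
  show ?thesis
  proof (intro exI ballI impI)
    fix t assume t: "t \<in> Q" "\<forall>k\<in>{1..n}. \<bar>t k\<bar> \<le> T"
    have "(if 0 \<le> t k then c * t k else d * t k) \<le> (\<bar>c\<bar> + \<bar>d\<bar>) * T" if k: "k \<in> {1..n}" for k
    proof -
      have "c * t k \<le> \<bar>c\<bar> * \<bar>t k\<bar>" "d * t k \<le> \<bar>d\<bar> * \<bar>t k\<bar>" "0 \<le> \<bar>c\<bar> * \<bar>t k\<bar>" "0 \<le> \<bar>d\<bar> * \<bar>t k\<bar>"
        by (simp_all flip: abs_mult)
      then have "(if 0 \<le> t k then c * t k else d * t k) \<le> (\<bar>c\<bar> + \<bar>d\<bar>) * \<bar>t k\<bar>"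
        unfolding distrib_right by (cases "0 \<le> t k"; simp only: if_True if_False; linarith)
      also have "\<dots> \<le> (\<bar>c\<bar> + \<bar>d\<bar>) * T" using t(2) k by (intro mult_left_mono) auto
      finally show ?thesis .
    qed
    then have "(\<Sum>k=1..n. if 0 \<le> t k then c * t k else d * t k) \<le> (\<Sum>k=1..n. (\<bar>c\<bar> + \<bar>d\<bar>) * T)"
      by (intro sum_mono) auto
    then have "C * exp (\<Sum>k=1..n. if 0 \<le> t k then c * t k else d * t k) \<le> C * exp (\<Sum>k=1..n. (\<bar>c\<bar> + \<bar>d\<bar>) * T)"
      using C(1) by (intro mult_left_mono) auto
    then show "norm (h t) \<le> C * exp (\<Sum>k=1..n. (\<bar>c\<bar> + \<bar>d\<bar>) * T)"
      using C(2)[OF t(1)] by linarith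
  qed
qed

end

section \<open>Partial derivatives in other orders\<close>

locale box_derivatives = box +
  fixes j :: "nat \<Rightarrow> nat" and f :: "(nat \<Rightarrow> real) \<Rightarrow> 'a::euclidean_space"
    and a1 am1 :: "(nat \<Rightarrow> nat) \<Rightarrow> real"
  assumes exist: "mpderivs_exist n a b j f"
    and growth_j: "\<forall>m\<in>multi_le n j. growth n (a1 m) (am1 m) (restrict_Q n a b (mpderiv n a b m f))"
begin

abbreviation pd :: "(nat \<Rightarrow> nat) \<Rightarrow> (nat \<Rightarrow> real) \<Rightarrow> 'a" where
  "pd q \<equiv> mpderiv n a b q f"

lemma pd_restrict: "pd (restrict q {1..n}) = pd q"
  by (rule mpderiv_cong) auto

lemma restrict_multi_le: "(\<And>i. i \<in> {1..n} \<Longrightarrow> q i \<le> j i) \<Longrightarrow> restrict q {1..n} \<in> multi_le n j"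
  by (auto simp: multi_le_def)

lemma pd_locally_bounded:
  assumes "\<And>i. i \<in> {1..n} \<Longrightarrow> q i \<le> j i"
  shows "\<exists>C. \<forall>t\<in>Q. (\<forall>k\<in>{1..n}. \<bar>t k\<bar> \<le> T) \<longrightarrow> norm (pd q t) \<le> C"
  using growth_locally_bounded[OF growth_j[rule_format, OF restrict_multi_le[OF assms]], of T]
  unfolding pd_restrict by blast

lemma pd_first:
  assumes le: "\<And>i. i \<in> {1..n} \<Longrightarrow> q i \<le> j i" and k: "k \<in> {1..n}" "q k < j k"
    and low: "\<And>i. i \<in> {1..<k} \<Longrightarrow> q i = 0"
  shows "has_partial k (pd q) (pd (q(k := Suc (q k))))"
  unfolding has_partial_def
proof
  have eq: "pd (q(k := Suc (q k))) = pderiv1 a b k (pd q)"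
    by (rule mpderiv_Suc) (use k low in auto)
  fix t assume t: "t \<in> Q"
  have "(\<lambda>x. pd q (t(k := x))) differentiable (at (t k) within edge a b k)"
    using exist[unfolded mpderivs_exist_def, rule_format, OF restrict_multi_le[OF le] k(1) _ t] k low
    unfolding pd_restrict by auto
  then show "((\<lambda>x. pd q (t(k := x))) has_vector_derivative pd (q(k := Suc (q k))) t) (at (t k) within edge a b k)"
    unfolding eq pderiv1_def by (simp add: vector_derivative_works)
qed

text \<open>Take the least i < k with q i > 0 and lower it by one to get q'. Then
  \<open>pd q\<close> is the t_i-derivative of \<open>pd q'\<close>, and the induction hypothesis
  gives the t_k-derivative of \<open>pd q'\<close>. Exchanging the two needs the further
  t_i-derivative of \<open>pd (q(k := Suc (q k)))\<close>, of order q i + 1. This is why a nonzero q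
  i has to stay below j i.\<close>

lemma pd_partial:
  assumes le: "\<And>i. i \<in> {1..n} \<Longrightarrow> q i \<le> j i" and k: "k \<in> {1..n}" "q k < j k"
    and low: "\<And>i. i \<in> {1..<k} \<Longrightarrow> q i = 0 \<or> q i < j i"
  shows "has_partial k (pd q) (pd (q(k := Suc (q k))))"
  using assms
proof (induction "\<Sum>i=1..<k. q i" arbitrary: q rule: less_induct)
  case less
  show ?case
  proof (cases "\<forall>i\<in>{1..<k}. q i = 0")
    case True
    then show ?thesis using less.prems by (intro pd_first) auto
  next
    case False
    let ?P = "\<lambda>i. i \<in> {1..<k} \<and> q i \<noteq> 0"
    have "\<exists>i. ?P i" using False by blast
    \<comment> \<open>For the least such i, d/dt_i is the outermost derivative in
      \<open>pd q\<close>, so \<open>pd_first\<close> applies to it.\<close>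
    then obtain i where i': "?P i" "\<forall>m<i. \<not> ?P m"
      unfolding exists_least_iff[of ?P] by blast
    have i: "i \<in> {1..<k}" "q i \<noteq> 0" using i'(1) by auto
    have il: "q m = 0" if "m \<in> {1..<i}" for m
      using i'(2)[rule_format, of m] that i by auto
    have ik: "i \<in> {1..n}" "i \<noteq> k" "q i < j i" "q i \<le> j i" "i < k"
      using i less.prems(2) less.prems(4)[OF i(1)] by auto
    define q' where "q' = q(i := q i - 1)"
    have qq: "q = q'(i := Suc (q' i))" using i by (auto simp: q'_def)
    have q'k: "q' k = q k" "q' i < j i" "Suc (q' i) < j i" using ik i by (auto simp: q'_def)
    have q'le: "q' m \<le> j m" if "m \<in> {1..n}" for m using less.prems(1)[OF that] by (auto simp: q'_def)
    have "(\<Sum>m=1..<k. q' m) < (\<Sum>m=1..<k. q m)"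
      by (rule sum_strict_mono_ex1) (use i in \<open>auto simp: q'_def\<close>)
    then have IH: "has_partial k (pd q') (pd (q'(k := Suc (q' k))))"
      by (rule less.hyps) (use less.prems q'le q'k in \<open>auto simp: q'_def\<close>)
    have P1: "has_partial i (pd q') (pd q)"
    proof -
      have "has_partial i (pd q') (pd (q'(i := Suc (q' i))))"
        by (rule pd_first[OF q'le ik(1) q'k(2)]) (simp_all add: q'_def il)
      then show ?thesis unfolding qq[symmetric] .
    qed
    let ?qk = "q(k := Suc (q k))"
    have P2: "has_partial i (pd (q'(k := Suc (q' k)))) (pd ?qk)"
    proof -
      have "has_partial i (pd (q'(k := Suc (q' k)))) (pd ((q'(k := Suc (q' k)))(i := Suc ((q'(k := Suc (q' k))) i))))"
        by (rule pd_first) (use q'le ik q'k less.prems(3) il in \<open>auto simp: q'_def Suc_leI\<close>)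
      moreover have "(q'(k := Suc (q' k)))(i := Suc ((q'(k := Suc (q' k))) i)) = ?qk"
        using ik i by (auto simp: q'_def)
      ultimately show ?thesis by simp
    qed
    have P3: "has_partial i (pd ?qk) (pd (?qk(i := Suc (?qk i))))"
      by (rule pd_first) (use less.prems(1,3) ik il in \<open>auto simp: Suc_leI\<close>)
    show ?thesis
      unfolding has_partial_def
    proof
      fix t assume t: "t \<in> Q"
      have ti: "t i \<in> edge a b i" and tk: "t k \<in> edge a b k"
        using box_Q_edge[OF t] ik(1) less.prems(2) by auto
      let ?t = "\<lambda>x y. t(i := x, k := y)"
      have sw: "?t x y = t(k := y, i := x)" for x y using ik(2) by (simp add: fun_upd_twist)
      \<comment> \<open>The summand 1 makes room for the moves by at most 1 in the coordinates i and
        k.\<close>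
      define T where "T = (\<Sum>m=1..n. \<bar>t m\<bar>) + 1"
      obtain C where C: "\<And>t. t \<in> Q \<Longrightarrow> (\<forall>k\<in>{1..n}. \<bar>t k\<bar> \<le> T) \<Longrightarrow> norm (pd (?qk(i := Suc (?qk i))) t) \<le> C"
      proof -
        have "\<exists>C. \<forall>t\<in>Q. (\<forall>k\<in>{1..n}. \<bar>t k\<bar> \<le> T) \<longrightarrow> norm (pd (?qk(i := Suc (?qk i))) t) \<le> C"
          by (rule pd_locally_bounded) (use less.prems(1,3) ik in \<open>auto simp: Suc_leI\<close>)
        then show ?thesis using that by blast
      qed
      have tT: "\<bar>t m\<bar> \<le> T - 1" if "m \<in> {1..n}" for m
        unfolding T_def using member_le_sum[of m "{1..n}" "\<lambda>m. \<bar>t m\<bar>"] that by auto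
      have inQ: "?t x y \<in> Q" if "x \<in> edge a b i" "y \<in> edge a b k" for x y
        by (intro box_Q_upd t ik(1) less.prems(2) that)
      have "((\<lambda>y. pd q (?t (t i) y)) has_vector_derivative pd ?qk (?t (t i) (t k))) (at (t k) within edge a b k)"
      proof (rule mixed_partials[where A = "edge a b i" and g = "\<lambda>x y. pd q' (?t x y)"
            and gy = "\<lambda>x y. pd (q'(k := Suc (q' k))) (?t x y)" and gyx = "\<lambda>x y. pd ?qk (?t x y)"
            and w = "\<lambda>x y. pd (?qk(i := Suc (?qk i))) (?t x y)" and C = C])
        fix x y assume x: "x \<in> edge a b i" and y: "y \<in> edge a b k"
        show "((\<lambda>y. pd q' (?t x y)) has_vector_derivative pd (q'(k := Suc (q' k))) (?t x y)) (at y within edge a b k)"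
          by (rule has_partialD[OF IH box_Q_upd[OF t ik(1) x] less.prems(2) y])
        show "((\<lambda>x. pd (q'(k := Suc (q' k))) (?t x y)) has_vector_derivative pd ?qk (?t x y)) (at x within edge a b i)"
          unfolding sw by (rule has_partialD[OF P2 box_Q_upd[OF t less.prems(2) y] ik(1) x])
        show "((\<lambda>x. pd ?qk (?t x y)) has_vector_derivative pd (?qk(i := Suc (?qk i))) (?t x y)) (at x within edge a b i)"
          unfolding sw by (rule has_partialD[OF P3 box_Q_upd[OF t less.prems(2) y] ik(1) x])
        assume "\<bar>x - t i\<bar> \<le> 1" "\<bar>y - t k\<bar> \<le> 1"
        then have "\<bar>?t x y m\<bar> \<le> T" if "m \<in> {1..n}" for m
          using tT[OF that] tT[OF ik(1)] tT[OF less.prems(2)] by auto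
        then show "norm (pd (?qk(i := Suc (?qk i))) (?t x y)) \<le> C" by (intro C inQ x y) auto
      next
        fix y assume y: "y \<in> edge a b k"
        show "((\<lambda>x. pd q' (?t x y)) has_vector_derivative pd q (?t (t i) y)) (at (t i) within edge a b i)"
          unfolding sw by (rule has_partialD[OF P1 box_Q_upd[OF t less.prems(2) y] ik(1) ti])
      qed (use ti tk convex_edge islimpt_edge[OF ik(1)] in auto)
      then show "((\<lambda>x. pd q (t(k := x))) has_vector_derivative pd ?qk t) (at (t k) within edge a b k)"
        by simp
    qed
  qed
qed

end

section \<open>Decay and measurability of the integrands\<close>

locale transform_problem =
  cd_kernel r e n \<kappa> p + box_derivatives n a b j f a1 am1
  for r and e :: "nat \<Rightarrow> 'a::euclidean_space" and n \<kappa> p a b j and f :: "(nat \<Rightarrow> real) \<Rightarrow> 'a" and a1 am1 +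
  assumes cont_f: "AE t in lebesgue_on_coords {1..n}. continuous (at t within Rn n) (restrict_Q n a b f)"
    and p_in_W: "p \<in> domain_W r n e a b (Max (a1 ` multi_le n j)) (Min (am1 ` multi_le n j))"
begin

abbreviation "Ap \<equiv> Max (a1 ` multi_le n j)"
abbreviation "Am \<equiv> Min (am1 ` multi_le n j)"

definition le_j :: "(nat \<Rightarrow> nat) \<Rightarrow> bool" where
  "le_j q \<longleftrightarrow> (\<forall>i\<in>{1..n}. q i \<le> j i)"

lemma decay_rate:
  "\<exists>\<epsilon>>0. \<forall>k\<in>{1..n}. (b k = \<infinity> \<longrightarrow> Ap + \<epsilon> \<le> p \<bullet> e 0) \<and> (a k = - \<infinity> \<longrightarrow> p \<bullet> e 0 + \<epsilon> \<le> Am)"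
proof -
  \<comment> \<open>The value 1 stands in when no edge is unbounded on that side and W imposes no
    inequality there.\<close>
  define \<epsilon>1 where "\<epsilon>1 = (if \<exists>k\<in>{1..n}. b k = \<infinity> then p \<bullet> e 0 - Ap else 1)"
  define \<epsilon>2 where "\<epsilon>2 = (if \<exists>k\<in>{1..n}. a k = - \<infinity> then Am - p \<bullet> e 0 else 1)"
  have "\<epsilon>1 > 0" "\<epsilon>2 > 0"
    using p_in_W by (auto simp: domain_W_def cd_Re_eq \<epsilon>1_def \<epsilon>2_def split: if_splits)
  moreover have "b k = \<infinity> \<Longrightarrow> \<epsilon>1 = p \<bullet> e 0 - Ap" "a k = - \<infinity> \<Longrightarrow> \<epsilon>2 = Am - p \<bullet> e 0" if "k \<in> {1..n}" for k
    using that by (auto simp: \<epsilon>1_def \<epsilon>2_def)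
  ultimately show ?thesis
    by (intro exI[of _ "min \<epsilon>1 \<epsilon>2"]) (auto simp: min_def)
qed

text \<open>Towards an infinite end the gap \<epsilon> between the rates gives the decay. Towards a
  finite end |x| is at most the absolute value of the end point, and K absorbs what is
  missing.\<close>

lemma edge_decay:
  fixes A B c \<epsilon> :: real
  assumes k: "k \<in> {1..n}" and \<epsilon>: "\<epsilon> > 0" "b k = \<infinity> \<longrightarrow> A + \<epsilon> \<le> c" "a k = - \<infinity> \<longrightarrow> c + \<epsilon> \<le> B"
  shows "\<exists>K. \<forall>x\<in>edge a b k. (if 0 \<le> x then A * x else B * x) - c * x \<le> K - \<epsilon> * \<bar>x\<bar>"
proof (intro exI ballI)
  define \<alpha> \<beta> where "\<alpha> = real_of_ereal (a k)" and "\<beta> = real_of_ereal (b k)"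
  let ?K1 = "(\<bar>A - c\<bar> + \<epsilon>) * \<bar>\<beta>\<bar>"
  let ?K2 = "(\<bar>B - c\<bar> + \<epsilon>) * \<bar>\<alpha>\<bar>"
  have K: "0 \<le> ?K1" "0 \<le> ?K2" using \<epsilon>(1) by auto
  fix x assume x: "x \<in> edge a b k"
  show "(if 0 \<le> x then A * x else B * x) - c * x \<le> (?K1 + ?K2) - \<epsilon> * \<bar>x\<bar>"
  proof (cases "0 \<le> x")
    case True
    have "(A - c + \<epsilon>) * x \<le> ?K1"
    proof (cases "b k = \<infinity>")
      case inf: True
      then have "(A - c + \<epsilon>) * x \<le> 0" using \<epsilon>(2) True by (intro mult_nonpos_nonneg) auto
      then show ?thesis using K(1) by linarith
    next
      case False
      with x have "x \<le> \<beta>" by (cases "b k") (auto simp: edge_def \<beta>_def)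
      with True have "(A - c + \<epsilon>) * x \<le> ?K1"
        using \<epsilon>(1) by (intro mult_mono) auto
      then show ?thesis .
    qed
    then show ?thesis using True K(2) by (simp add: algebra_simps)
  next
    case False
    have "(c + \<epsilon> - B) * (- x) \<le> ?K2"
    proof (cases "a k = - \<infinity>")
      case inf: True
      then have "(c + \<epsilon> - B) * (- x) \<le> 0" using \<epsilon>(3) False by (intro mult_nonpos_nonneg) auto
      then show ?thesis using K(2) by linarith
    next
      case inf: False
      with x False have "- x \<le> \<bar>\<alpha>\<bar>" by (cases "a k") (auto simp: edge_def \<alpha>_def)
      with False have "(c + \<epsilon> - B) * (- x) \<le> (\<bar>B - c\<bar> + \<epsilon>) * \<bar>\<alpha>\<bar>"
        using \<epsilon>(1) by (intro mult_mono) auto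
      then show ?thesis .
    qed
    then show ?thesis using False K(1) by (simp add: algebra_simps)
  qed
qed

lemma finite_multi_le: "finite (multi_le n j)"
  unfolding multi_le_def by (intro finite_PiE) auto

lemma pd_decay:
  assumes q: "le_j q"
  shows "\<exists>C\<ge>0. \<exists>\<epsilon>>0. \<forall>t\<in>Q. norm (pd q t) * weight t \<le> C * exp (- (\<epsilon> * (\<Sum>k=1..n. \<bar>t k\<bar>)))"
proof -
  let ?q = "restrict q {1..n}"
  have m: "?q \<in> multi_le n j" by (rule restrict_multi_le) (use q in \<open>auto simp: le_j_def\<close>)
  obtain C where C: "C \<ge> 0"
    "\<And>t. t \<in> Q \<Longrightarrow> norm (pd q t) \<le> C * exp (\<Sum>k=1..n. if 0 \<le> t k then Ap * t k else Am * t k)"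
    using growth_bound[OF growth_j[rule_format, OF m, unfolded pd_restrict], of "Ap" "Am"]
      m finite_multi_le by (auto simp: Max_ge Min_le)
  obtain \<epsilon> where \<epsilon>: "\<epsilon> > 0"
    "\<And>k. k \<in> {1..n} \<Longrightarrow> (b k = \<infinity> \<longrightarrow> Ap + \<epsilon> \<le> p \<bullet> e 0) \<and> (a k = - \<infinity> \<longrightarrow> p \<bullet> e 0 + \<epsilon> \<le> Am)"
    using decay_rate by blast
  have "\<forall>k\<in>{1..n}. \<exists>K. \<forall>x\<in>edge a b k.
      (if 0 \<le> x then Ap * x else Am * x) - (p \<bullet> e 0) * x \<le> K - \<epsilon> * \<bar>x\<bar>"
    using edge_decay[OF _ \<epsilon>(1)] \<epsilon>(2) by blast
  from bchoice[OF this] obtain K where K: "\<forall>k\<in>{1..n}. \<forall>x\<in>edge a b k.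
      (if 0 \<le> x then Ap * x else Am * x) - (p \<bullet> e 0) * x \<le> K k - \<epsilon> * \<bar>x\<bar>" ..
  have "norm (pd q t) * weight t \<le> (C * exp (\<Sum>k=1..n. K k)) * exp (- (\<epsilon> * (\<Sum>k=1..n. \<bar>t k\<bar>)))"
    if t: "t \<in> Q" for t
  proof -
    have "norm (pd q t) * weight t \<le>
        (C * exp (\<Sum>k=1..n. if 0 \<le> t k then Ap * t k else Am * t k)) * weight t"
      using C(2)[OF t] by (intro mult_right_mono) (auto simp: weight_def)
    also have "\<dots> = C * exp (\<Sum>k=1..n. (if 0 \<le> t k then Ap * t k else Am * t k) - (p \<bullet> e 0) * t k)"
      unfolding weight_def sum_subtractf sum_distrib_left[symmetric]
      by (simp only: diff_conv_add_uminus exp_add mult.assoc)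
    also have "\<dots> \<le> C * exp (\<Sum>k=1..n. K k - \<epsilon> * \<bar>t k\<bar>)"
    proof (intro mult_left_mono C(1))
      show "exp (\<Sum>k=1..n. (if 0 \<le> t k then Ap * t k else Am * t k) - (p \<bullet> e 0) * t k)
          \<le> exp (\<Sum>k=1..n. K k - \<epsilon> * \<bar>t k\<bar>)"
        using K box_Q_edge[OF t] by (subst exp_le_cancel_iff) (intro sum_mono, blast)
    qed
    also have "\<dots> = (C * exp (\<Sum>k=1..n. K k)) * exp (- (\<epsilon> * (\<Sum>k=1..n. \<bar>t k\<bar>)))"
      unfolding sum_subtractf sum_distrib_left[symmetric]
      by (simp only: diff_conv_add_uminus exp_add mult.assoc)
    finally show ?thesis .
  qed
  moreover have "0 \<le> C * exp (\<Sum>k=1..n. K k)" using C(1) by simp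
  ultimately show ?thesis using \<epsilon>(1) by blast
qed

text \<open>With \<Psi> = \<open>ksymbol\<close> this is the integrand of the transform of
  \<open>pd q\<close>; the other symbols arise from its derivatives in zeta.\<close>

definition kern :: "(nat \<Rightarrow> nat) \<Rightarrow> ('a \<Rightarrow> 'a) \<Rightarrow> 'a \<Rightarrow> (nat \<Rightarrow> real) \<Rightarrow> 'a" where
  "kern q \<Psi> \<zeta> t = weight t *\<^sub>R cd_mult r e (pd q t) (\<Psi> (\<zeta> + shift t))"

text \<open>The symbol costs at most a factor exp(\<delta> |z + shift t|), and |shift t| is at most
  s times the sum of the |t_k|. With \<delta> s \<le> \<epsilon> / 2 half of the decay survives.
  Uniformity in z is there for differentiation under the integral.\<close>

lemma kern_bound:
  assumes q: "le_j q" and \<Psi>: "vsymbol \<Psi>"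
  shows "\<exists>C\<ge>0. \<exists>\<epsilon>>0. \<forall>t\<in>Q. \<forall>z. z \<bullet> e 0 = c \<longrightarrow> norm z \<le> T \<longrightarrow>
    norm (kern q \<Psi> z t) \<le> C * exp (- (\<epsilon> * (\<Sum>k=1..n. \<bar>t k\<bar>)))"
proof -
  obtain C \<epsilon> where C: "C \<ge> 0" "\<epsilon> > 0"
    "\<And>t. t \<in> Q \<Longrightarrow> norm (pd q t) * weight t \<le> C * exp (- (\<epsilon> * (\<Sum>k=1..n. \<bar>t k\<bar>)))"
    using pd_decay[OF q] by blast
  obtain s where s: "s \<ge> 0" "\<And>t. norm (shift t) \<le> s * (\<Sum>k=1..n. \<bar>t k\<bar>)" using norm_shift by blast
  obtain M where M: "M > 0" "\<And>x y. norm (cd_mult r e x y) \<le> norm x * norm y * M"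
    using bounded_bilinear.pos_bounded[OF bounded_bilinear_cd_mult] by blast
  \<comment> \<open>The summand 1 covers the case s = 0.\<close>
  define \<delta> where "\<delta> = \<epsilon> / (2 * (s + 1))"
  have \<delta>: "\<delta> > 0" using C(2) s(1) by (simp add: \<delta>_def)
  have \<delta>s: "\<delta> * s \<le> \<epsilon> / 2"
  proof -
    have "\<delta> * s \<le> \<delta> * (s + 1)" using \<delta> by simp
    also have "\<dots> = \<epsilon> / 2" using s(1) by (simp add: \<delta>_def field_simps)
    finally show ?thesis .
  qed
  obtain D where D: "\<And>z. z \<bullet> e 0 = c \<Longrightarrow> norm (\<Psi> z) \<le> D * exp (\<delta> * norm z)"
    using vsymbol_bound[OF \<Psi> \<delta>] by blast
  let ?C = "C * \<bar>D\<bar> * exp (\<delta> * T) * M"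
  have "norm (kern q \<Psi> z t) \<le> ?C * exp (- (\<epsilon> / 2 * (\<Sum>k=1..n. \<bar>t k\<bar>)))"
    if t: "t \<in> Q" and z: "z \<bullet> e 0 = c" "norm z \<le> T" for t z
  proof -
    let ?S = "\<Sum>k=1..n. \<bar>t k\<bar>"
    have S: "0 \<le> ?S" by (intro sum_nonneg) auto
    have "norm (\<Psi> (z + shift t)) \<le> D * exp (\<delta> * norm (z + shift t))"
      by (rule D) (simp add: inner_add_left z shift_inner_e0)
    also have "\<dots> \<le> \<bar>D\<bar> * exp (\<delta> * (T + s * ?S))"
    proof (rule mult_mono)
      have "norm (z + shift t) \<le> T + s * ?S" using norm_triangle_ineq[of z "shift t"] s(2)[of t] z(2) by linarith
      then show "exp (\<delta> * norm (z + shift t)) \<le> exp (\<delta> * (T + s * ?S))" using \<delta> by simp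
    qed auto
    also have "\<dots> \<le> \<bar>D\<bar> * (exp (\<delta> * T) * exp (\<epsilon> / 2 * ?S))"
      using \<delta>s S mult_right_mono[OF \<delta>s S]
      by (intro mult_left_mono) (auto simp: exp_add[symmetric] algebra_simps)
    finally have \<Psi>b: "norm (\<Psi> (z + shift t)) \<le> \<bar>D\<bar> * (exp (\<delta> * T) * exp (\<epsilon> / 2 * ?S))" .
    have "norm (kern q \<Psi> z t) \<le> weight t * (norm (pd q t) * norm (\<Psi> (z + shift t)) * M)"
      unfolding kern_def norm_scaleR using M(2)[of "pd q t"]
      by (intro mult_mono) (auto simp: weight_def)
    also have "\<dots> = (norm (pd q t) * weight t) * norm (\<Psi> (z + shift t)) * M" by simp
    also have "\<dots> \<le> (C * exp (- (\<epsilon> * ?S))) * (\<bar>D\<bar> * (exp (\<delta> * T) * exp (\<epsilon> / 2 * ?S))) * M"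
      by (rule mult_right_mono[OF mult_mono[OF C(3)[OF t] \<Psi>b]]) (use C(1) M(1) in auto)
    also have "\<dots> = ?C * (exp (- (\<epsilon> * ?S)) * exp (\<epsilon> / 2 * ?S))" by simp
    also have "exp (- (\<epsilon> * ?S)) * exp (\<epsilon> / 2 * ?S) = exp (- (\<epsilon> / 2 * ?S))"
      unfolding exp_add[symmetric] by (simp add: field_simps)
    finally show ?thesis .
  qed
  moreover have "0 \<le> ?C" using C(1) M(1) by simp
  ultimately show ?thesis using C(2) by (intro exI[of _ ?C] conjI exI[of _ "\<epsilon> / 2"]) auto
qed

section \<open>Faces: parametrisation and measurability\<close>

abbreviation "par l \<equiv> face_params n a b l"
abbreviation "fp l \<equiv> face_point n a b l"
abbreviation "fin_face l \<equiv> face_finite n a b l"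

definition ternary :: "(nat \<Rightarrow> nat) \<Rightarrow> bool" where
  "ternary l \<longleftrightarrow> (\<forall>i\<in>{1..n}. l i \<le> 2)"

lemma finite_free_coords [simp]: "finite (free_coords n l)"
  by (simp add: free_coords_def)

lemma fp_in_Q:
  assumes "ternary l" "fin_face l" "y \<in> par l"
  shows "fp l y \<in> Q"
proof -
  have "a k \<le> ereal (fp l y k) \<and> ereal (fp l y k) \<le> b k" if k: "k \<in> {1..n}" for k
  proof -
    have abk: "a k < b k" using ab k by auto
    consider "l k = 0" | "l k = 1" | "l k = 2" using assms(1) k by (force simp: ternary_def)
    then show ?thesis
    proof cases
      case 1
      then show ?thesis using assms(3) k
        by (auto simp: face_point_def face_params_def free_coords_def intro: less_imp_le)
    next
      case 2
      then have "ereal (fp l y k) = a k" using assms(2) k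
        by (auto simp: face_point_def face_finite_def ereal_real)
      then show ?thesis using abk by auto
    next
      case 3
      then have "ereal (fp l y k) = b k" using assms(2) k
        by (auto simp: face_point_def face_finite_def ereal_real)
      then show ?thesis using abk by auto
    qed
  qed
  then show ?thesis by (auto simp: box_Q_def face_point_def)
qed

lemma sum_abs_fp: "(\<Sum>i\<in>free_coords n l. \<bar>y i\<bar>) \<le> (\<Sum>k=1..n. \<bar>fp l y k\<bar>)"
proof -
  have "(\<Sum>i\<in>free_coords n l. \<bar>y i\<bar>) = (\<Sum>i\<in>free_coords n l. \<bar>fp l y i\<bar>)"
    by (intro sum.cong refl) (auto simp: free_coords_def face_point_def)
  also have "\<dots> \<le> (\<Sum>k=1..n. \<bar>fp l y k\<bar>)"
    by (rule sum_mono2) (auto simp: free_coords_def)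
  finally show ?thesis .
qed

lemma par_sets: "par l \<in> sets (coords_borel (free_coords n l))"
proof -
  have "par l = Pi\<^sub>E (free_coords n l) (\<lambda>k. {x. a k < ereal x \<and> ereal x < b k})"
    by (auto simp: face_params_def PiE_iff extensional_def)
  then show ?thesis by (auto intro!: sets_PiM_I_finite)
qed

lemma fp_measurable:
  assumes "k \<in> {1..n}"
  shows "(\<lambda>y. fp l y k) \<in> borel_measurable (coords_borel (free_coords n l))"
proof (cases "l k = 0")
  case True
  then have "k \<in> free_coords n l" using assms by (simp add: free_coords_def)
  then show ?thesis
    using measurable_component_singleton[of k "free_coords n l" "\<lambda>_. lborel"] assms True
    by (simp add: face_point_def)
next
  case False
  then show ?thesis using assms by (simp add: face_point_def)
qed

lemma shift_measurable: "(\<lambda>y. shift (fp l y)) \<in> borel_measurable (coords_borel (free_coords n l))"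
  unfolding shift_def by (intro borel_measurable_sum borel_measurable_scaleR fp_measurable) auto

lemma weight_measurable: "(\<lambda>y. weight (fp l y)) \<in> borel_measurable (coords_borel (free_coords n l))"
proof -
  have [measurable]: "(\<lambda>y. \<Sum>k=1..n. fp l y k) \<in> borel_measurable (coords_borel (free_coords n l))"
    by (intro borel_measurable_sum fp_measurable)
  show ?thesis unfolding weight_def by measurable
qed

definition face_measurable :: "(nat \<Rightarrow> nat) \<Rightarrow> (nat \<Rightarrow> nat) \<Rightarrow> bool" where
  "face_measurable l q \<longleftrightarrow>
     (\<lambda>y. indicator (par l) y *\<^sub>R pd q (fp l y)) \<in> borel_measurable (lebesgue_on_coords (free_coords n l))"

lemma kern_measurable:
  assumes m: "face_measurable l q" and \<Psi>: "vsymbol \<Psi>"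
  shows "(\<lambda>y. indicator (par l) y *\<^sub>R kern q \<Psi> \<zeta> (fp l y)) \<in>
    borel_measurable (lebesgue_on_coords (free_coords n l))"
proof -
  let ?M = "lebesgue_on_coords (free_coords n l)"
  have 1: "(\<lambda>y. \<Psi> (\<zeta> + shift (fp l y))) \<in> borel_measurable ?M"
    by (intro measurable_lebesgue_on_coords
        measurable_compose[OF _ borel_measurable_continuous_onI[OF vsymbol_continuous[OF \<Psi>]]]
        borel_measurable_add shift_measurable) auto
  have c: "continuous_on UNIV (\<lambda>x. cd_mult r e (fst x) (snd x))"
    by (rule bounded_bilinear.continuous_on[OF bounded_bilinear_cd_mult]) (auto intro!: continuous_intros)
  have 2: "(\<lambda>y. cd_mult r e (indicator (par l) y *\<^sub>R pd q (fp l y)) (\<Psi> (\<zeta> + shift (fp l y)))) \<in> borel_measurable ?M"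
    by (rule borel_measurable_continuous_Pair[OF m[unfolded face_measurable_def] 1 c])
  have "(\<lambda>y. weight (fp l y) *\<^sub>R cd_mult r e (indicator (par l) y *\<^sub>R pd q (fp l y)) (\<Psi> (\<zeta> + shift (fp l y))))
      \<in> borel_measurable ?M"
    by (intro borel_measurable_scaleR 2 measurable_lebesgue_on_coords[OF weight_measurable])
  then show ?thesis by (simp add: kern_def cd_mult_scaleR_left mult.commute)
qed

lemma free_coords_zero: "(\<And>i. i \<in> {1..n} \<Longrightarrow> l i = 0) \<Longrightarrow> free_coords n l = {1..n}"
  by (auto simp: free_coords_def)

lemma fp_zero: "(\<And>i. i \<in> {1..n} \<Longrightarrow> l i = 0) \<Longrightarrow> y \<in> Rn n \<Longrightarrow> fp l y = y"
  by (auto simp: face_point_def fun_eq_iff PiE_iff extensional_def)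

lemma par_zero_subset: "(\<And>i. i \<in> {1..n} \<Longrightarrow> l i = 0) \<Longrightarrow> par l \<subseteq> Q"
  unfolding face_params_def box_Q_def by (subst (1 2) free_coords_zero) (auto intro: less_imp_le)

text \<open>The derivative is the limit of difference quotients of the extension of \<open>pd q\<close> by \<open>0\<close> from the
  open box.\<close>

lemma face_measurable_box:
  assumes l: "\<And>i. i \<in> {1..n} \<Longrightarrow> l i = 0" and q: "le_j q"
  shows "face_measurable l q"
  using q
proof (induction "\<Sum>i=1..n. q i" arbitrary: q rule: less_induct)
  case less
  let ?M = "lebesgue_on_coords {1..n}"
  have fc: "free_coords n l = {1..n}" by (rule free_coords_zero, rule l)
  have parQ: "par l \<subseteq> Q" by (rule par_zero_subset, rule l)
  have par: "par l \<in> sets ?M"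
    using par_sets[of l] unfolding fc lebesgue_on_coords_def by (rule sets_completionI_sets)
  have simp_meas: "face_measurable l q \<longleftrightarrow> (\<lambda>y. indicator (par l) y *\<^sub>R pd q y) \<in> borel_measurable ?M" for q
    unfolding face_measurable_def fc
    by (rule measurable_cong) (subst fp_zero; simp add: l[simplified])
  show ?case
  proof (cases "\<forall>i\<in>{1..n}. q i = 0")
    case True
    then have pd: "pd q = f" by (intro mpderiv_zero) auto
    have "restrict_Q n a b f \<in> borel_measurable ?M" by (rule AE_continuous_imp_measurable[OF cont_f])
    then have "(\<lambda>y. indicator (par l) y *\<^sub>R restrict_Q n a b f y) \<in> borel_measurable ?M"
      using par by (intro borel_measurable_scaleR) auto
    also have "(\<lambda>y. indicator (par l) y *\<^sub>R restrict_Q n a b f y) = (\<lambda>y. indicator (par l) y *\<^sub>R pd q y)"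
      using parQ by (auto simp: fun_eq_iff restrict_Q_def pd indicator_def)
    finally show ?thesis unfolding simp_meas .
  next
    case False
    let ?P = "\<lambda>i. i \<in> {1..n} \<and> q i \<noteq> 0"
    have "\<exists>i. ?P i" using False by blast
    \<comment> \<open>The least i makes d/dt_i the outermost derivative, so \<open>pd q\<close> is
      the derivative of \<open>pd q'\<close> along edge i at every point of the box.\<close>
    then obtain i where i': "?P i" "\<forall>m<i. \<not> ?P m"
      unfolding exists_least_iff[of ?P] by blast
    then have i: "i \<in> {1..n}" "q i \<noteq> 0" by auto
    define q' where "q' = q(i := q i - 1)"
    have qq: "q = q'(i := Suc (q' i))" using i by (auto simp: q'_def)
    have q'le: "q' m \<le> j m" if "m \<in> {1..n}" for m
      using less.prems that by (auto simp: q'_def le_j_def intro: order_trans[OF diff_le_self])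
    have q'i: "q' i < j i" using less.prems[unfolded le_j_def, rule_format, OF i(1)] i(2) by (simp add: q'_def)
    have low: "q' m = 0" if "m \<in> {1..<i}" for m
      using i'(2)[rule_format, of m] that i by (auto simp: q'_def)
    have P: "has_partial i (pd q') (pd q)"
      using pd_first[OF q'le i(1) q'i low] unfolding qq[symmetric] .
    have "(\<Sum>m=1..n. q' m) < (\<Sum>m=1..n. q m)"
      by (rule sum_strict_mono_ex1) (use i in \<open>auto simp: q'_def\<close>)
    then have "face_measurable l q'" by (rule less.hyps) (use q'le in \<open>auto simp: le_j_def\<close>)
    then have m: "(\<lambda>y. indicator (par l) y *\<^sub>R pd q' y) \<in> borel_measurable ?M" (is "?g \<in> _")
      unfolding simp_meas .
    define X where "X = (\<lambda>m::nat. inverse (real (Suc m)))"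
    have X: "X m \<noteq> 0" "X \<longlonglongrightarrow> 0" for m
      unfolding X_def by simp (rule LIMSEQ_inverse_real_of_nat)
    let ?d = "\<lambda>m y. indicator (par l) y *\<^sub>R ((?g (y(i := y i + X m)) - ?g y) /\<^sub>R X m)"
    have md: "?d m \<in> borel_measurable ?M" for m
      using par
      by (intro borel_measurable_scaleR borel_measurable_indicator borel_measurable_const
          borel_measurable_diff m measurable_shift_coord[OF _ i(1) m]) auto
    have "(\<lambda>y. indicator (par l) y *\<^sub>R pd q y) \<in> borel_measurable ?M"
    proof (rule borel_measurable_LIMSEQ_metric[OF md])
      fix y assume y: "y \<in> space ?M"
      show "(\<lambda>m. ?d m y) \<longlonglongrightarrow> indicator (par l) y *\<^sub>R pd q y"
      proof (cases "y \<in> par l")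
        case True
        then have yQ: "y \<in> Q" using parQ by blast
        have ai: "a i < ereal (y i)" "ereal (y i) < b i"
          using True i(1) by (auto simp: face_params_def fc)
        have "(\<lambda>m. y i + X m) \<longlonglongrightarrow> y i + 0" by (intro tendsto_intros X(2))
        then have lim: "(\<lambda>m. ereal (y i + X m)) \<longlonglongrightarrow> ereal (y i)" by simp
        \<comment> \<open>The shifted points stay in the open box for large m, so the extension by 0
          does not disturb the quotients.\<close>
        have ev: "\<forall>\<^sub>F m in sequentially. a i < ereal (y i + X m) \<and> ereal (y i + X m) < b i"
          using order_tendstoD[OF lim] ai by (intro eventually_conj) auto
        have ev2: "\<forall>\<^sub>F m in sequentially. (pd q' (y(i := y i + X m)) - pd q' y) /\<^sub>R X m = ?d m y"
          using ev
        proof eventually_elim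
          case (elim m)
          then have "y(i := y i + X m) \<in> par l"
            using True i(1) by (auto simp: face_params_def fc PiE_iff extensional_def)
          then show ?case using True by simp
        qed
        have "((\<lambda>x. (pd q' (y(i := x)) - pd q' (y(i := y i))) /\<^sub>R (x - y i)) \<longlongrightarrow> pd q y)
            (at (y i) within edge a b i)"
          using P yQ by (intro vector_derivative_quotient) (auto simp: has_partial_def)
        moreover have "filterlim (\<lambda>m. y i + X m) (at (y i) within edge a b i) sequentially"
          unfolding filterlim_at using ev X \<open>(\<lambda>m. y i + X m) \<longlonglongrightarrow> y i + 0\<close>
          by (auto simp: edge_def elim!: eventually_mono)
        ultimately have "(\<lambda>m. (pd q' (y(i := y i + X m)) - pd q' (y(i := y i))) /\<^sub>R (y i + X m - y i)) \<longlonglongrightarrow> pd q y"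
          by (rule filterlim_compose)
        then have "(\<lambda>m. (pd q' (y(i := y i + X m)) - pd q' y) /\<^sub>R X m) \<longlonglongrightarrow> pd q y" by simp
        from Lim_transform_eventually[OF this ev2] True show ?thesis by simp
      qed auto
    qed
    then show ?thesis unfolding simp_meas .
  qed
qed

end

section \<open>The transforms of faces\<close>

lemma exp_decay_null:
  fixes \<phi> :: "real \<Rightarrow> 'b::real_normed_vector" and x :: "nat \<Rightarrow> real"
  assumes \<epsilon>: "\<epsilon> > 0" and C: "\<And>m. norm (\<phi> (x m)) \<le> C * exp (- (\<epsilon> * \<bar>x m\<bar>))"
    and x: "\<And>m. real m - w \<le> \<bar>x m\<bar>"
  shows "(\<lambda>m. \<phi> (x m)) \<longlonglongrightarrow> 0"
proof (rule tendsto_norm_zero_cancel, rule tendsto_sandwich[OF _ _ tendsto_const])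
  have "norm (\<phi> (x m)) \<le> \<bar>C\<bar> * exp (\<epsilon> * w) * exp (- \<epsilon>) ^ m" for m
  proof -
    have "C * exp (- (\<epsilon> * \<bar>x m\<bar>)) \<le> \<bar>C\<bar> * exp (- (\<epsilon> * (real m - w)))"
      using \<epsilon> x[of m] by (intro mult_mono) auto
    also have "\<dots> = \<bar>C\<bar> * exp (\<epsilon> * w) * exp (- \<epsilon>) ^ m"
      by (simp add: exp_of_nat_mult[symmetric] exp_add[symmetric] algebra_simps)
    finally show ?thesis using C[of m] by linarith
  qed
  then show "\<forall>\<^sub>F m in sequentially. norm (\<phi> (x m)) \<le> \<bar>C\<bar> * exp (\<epsilon> * w) * exp (- \<epsilon>) ^ m" by auto
  have "(\<lambda>m. exp (- \<epsilon>) ^ m) \<longlonglongrightarrow> 0" using \<epsilon> by (intro LIMSEQ_power_zero) auto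
  then show "(\<lambda>m. \<bar>C\<bar> * exp (\<epsilon> * w) * exp (- \<epsilon>) ^ m) \<longlonglongrightarrow> 0" by (rule tendsto_mult_right_zero)
qed auto

text \<open>The fundamental theorem on compact intervals that exhaust the edge, followed by
  dominated convergence. The end values at infinity vanish by the decay of \<phi>.\<close>

lemma integral_derivative_edge:
  fixes \<phi> \<phi>' :: "real \<Rightarrow> 'b::euclidean_space" and \<alpha> \<beta> :: ereal
  assumes \<alpha>\<beta>: "\<alpha> < \<beta>"
    and deriv: "\<And>x. x \<in> {x. \<alpha> \<le> ereal x \<and> ereal x \<le> \<beta>} \<Longrightarrow>
      (\<phi> has_vector_derivative \<phi>' x) (at x within {x. \<alpha> \<le> ereal x \<and> ereal x \<le> \<beta>})"
    and int: "integrable lebesgue (\<lambda>x. indicator {x. \<alpha> < ereal x \<and> ereal x < \<beta>} x *\<^sub>R \<phi>' x)"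
    and decay: "\<epsilon> > 0" "\<And>x. x \<in> {x. \<alpha> \<le> ereal x \<and> ereal x \<le> \<beta>} \<Longrightarrow> norm (\<phi> x) \<le> C * exp (- (\<epsilon> * \<bar>x\<bar>))"
  shows "(\<integral>x. indicator {x. \<alpha> < ereal x \<and> ereal x < \<beta>} x *\<^sub>R \<phi>' x \<partial>lebesgue) =
    (if \<beta> = \<infinity> then 0 else \<phi> (real_of_ereal \<beta>)) - (if \<alpha> = - \<infinity> then 0 else \<phi> (real_of_ereal \<alpha>))"
proof -
  let ?E = "{x. \<alpha> \<le> ereal x \<and> ereal x \<le> \<beta>}"
  define F where "F = (\<lambda>x. indicator {x. \<alpha> < ereal x \<and> ereal x < \<beta>} x *\<^sub>R \<phi>' x)"
  obtain z where z: "\<alpha> < ereal z" "ereal z < \<beta>" using \<alpha>\<beta> ereal_dense2 by blast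
  \<comment> \<open>A finite end is reached by every interval; an infinite one is approached from
    the interior point z in steps of 1.\<close>
  define d where "d = (\<lambda>m::nat. if \<beta> = \<infinity> then z + real m else real_of_ereal \<beta>)"
  define c where "c = (\<lambda>m::nat. if \<alpha> = - \<infinity> then z - real m else real_of_ereal \<alpha>)"
  have dz: "z \<le> d m" "ereal (d m) \<le> \<beta>" "\<beta> \<noteq> \<infinity> \<Longrightarrow> ereal (d m) = \<beta>" for m
    using z(2) by (cases \<beta>; simp add: d_def)+
  have cz: "c m \<le> z" "\<alpha> \<le> ereal (c m)" "\<alpha> \<noteq> - \<infinity> \<Longrightarrow> ereal (c m) = \<alpha>" for m
    using z(1) by (cases \<alpha>; simp add: c_def)+
  have sub: "{c m..d m} \<subseteq> ?E" for m
  proof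
    fix x assume "x \<in> {c m..d m}"
    then have "ereal (c m) \<le> ereal x" "ereal x \<le> ereal (d m)" by auto
    from order_trans[OF cz(2) this(1)] order_trans[OF this(2) dz(2)] show "x \<in> ?E" by simp
  qed
  have val: "(LINT x:{c m..d m}|lebesgue. F x) = \<phi> (d m) - \<phi> (c m)" for m
  proof -
    have "(\<phi>' has_integral \<phi> (d m) - \<phi> (c m)) {c m..d m}"
    proof (rule fundamental_theorem_of_calculus)
      show "c m \<le> d m" using cz(1) dz(1) order_trans by blast
      show "(\<phi> has_vector_derivative \<phi>' x) (at x within {c m..d m})" if "x \<in> {c m..d m}" for x
        using deriv[of x] sub[of m] that by (intro has_vector_derivative_within_subset[OF _ sub]) auto
    qed
    \<comment> \<open>F carries the indicator of the open edge and may differ from \<phi>' at the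
      two end points only.\<close>
    then have 1: "(F has_integral \<phi> (d m) - \<phi> (c m)) {c m..d m}"
    proof (rule has_integral_spike_finite[where S = "{c m, d m}", rotated 2])
      fix x assume x: "x \<in> {c m..d m} - {c m, d m}"
      then have "ereal (c m) < ereal x" "ereal x < ereal (d m)" by auto
      then have "\<alpha> < ereal x \<and> ereal x < \<beta>"
        using order_le_less_trans[OF cz(2)] order_less_le_trans[OF _ dz(2)] by blast
      then show "F x = \<phi>' x" by (simp add: F_def)
    qed simp
    have "set_integrable lebesgue {c m..d m} F"
      unfolding set_integrable_def using int by (intro integrable_mult_indicator) (auto simp: F_def)
    from has_integral_unique[OF has_integral_set_lebesgue[OF this] 1] show ?thesis .
  qed
  have "(\<lambda>m. LINT x:{c m..d m}|lebesgue. F x) \<longlonglongrightarrow> (\<integral>x. F x \<partial>lebesgue)"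
    unfolding set_lebesgue_integral_def
  proof (rule integral_dominated_convergence[where w = "\<lambda>x. norm (F x)"])
    show "F \<in> borel_measurable lebesgue" using int by (auto simp: F_def)
    then show "(\<lambda>x. indicat_real {c m..d m} x *\<^sub>R F x) \<in> borel_measurable lebesgue" for m
      by (intro borel_measurable_scaleR borel_measurable_indicator) auto
    show "integrable lebesgue (\<lambda>x. norm (F x))"
      using int unfolding F_def by (rule integrable_norm)
    show "AE x in lebesgue. norm (indicat_real {c m..d m} x *\<^sub>R F x) \<le> norm (F x)" for m
      by (auto simp: indicator_def)
    show "AE x in lebesgue. (\<lambda>m. indicat_real {c m..d m} x *\<^sub>R F x) \<longlonglongrightarrow> F x"
    proof (rule AE_I2)
      fix x
      show "(\<lambda>m. indicat_real {c m..d m} x *\<^sub>R F x) \<longlonglongrightarrow> F x"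
      proof (cases "\<alpha> < ereal x \<and> ereal x < \<beta>")
        case False
        then show ?thesis by (simp add: F_def)
      next
        case True
        obtain M :: nat where M: "\<bar>z - x\<bar> \<le> real M" using real_arch_simple by blast
        have "indicat_real {c m..d m} x = 1" if "m \<ge> M" for m
        proof -
          have "real M \<le> real m" using that by simp
          then have "c m \<le> x" "x \<le> d m"
            using True M cz(3)[of m] dz(3)[of m] by (cases \<alpha>; cases \<beta>; auto simp: c_def d_def)+
          then show ?thesis by simp
        qed
        then have "\<forall>\<^sub>F m in sequentially. indicat_real {c m..d m} x *\<^sub>R F x = F x"
          by (intro eventually_sequentiallyI[of M]) simp
        then show ?thesis by (rule tendsto_eventually)
      qed
    qed
  qed
  moreover have "(\<lambda>m. LINT x:{c m..d m}|lebesgue. F x) \<longlonglongrightarrow>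
    (if \<beta> = \<infinity> then 0 else \<phi> (real_of_ereal \<beta>)) - (if \<alpha> = - \<infinity> then 0 else \<phi> (real_of_ereal \<alpha>))"
    unfolding val
  proof (rule tendsto_diff)
    have in_E: "d m \<in> ?E" "c m \<in> ?E" for m
      by (rule subsetD[OF sub[of m]], simp add: order_trans[OF cz(1)[of m] dz(1)[of m]])+
    show "(\<lambda>m. \<phi> (d m)) \<longlonglongrightarrow> (if \<beta> = \<infinity> then 0 else \<phi> (real_of_ereal \<beta>))"
    proof (cases "\<beta> = \<infinity>")
      case True
      have "(\<lambda>m. \<phi> (d m)) \<longlonglongrightarrow> 0"
        by (rule exp_decay_null[where x = d and w = "\<bar>z\<bar>", OF decay(1) decay(2)[OF in_E(1)]])
          (auto simp: d_def True)
      then show ?thesis using True by simp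
    qed (simp add: d_def)
    show "(\<lambda>m. \<phi> (c m)) \<longlonglongrightarrow> (if \<alpha> = - \<infinity> then 0 else \<phi> (real_of_ereal \<alpha>))"
    proof (cases "\<alpha> = - \<infinity>")
      case True
      have "(\<lambda>m. \<phi> (c m)) \<longlonglongrightarrow> 0"
        by (rule exp_decay_null[where x = c and w = "\<bar>z\<bar>", OF decay(1) decay(2)[OF in_E(2)]])
          (auto simp: c_def True)
      then show ?thesis using True by simp
    qed (simp add: c_def)
  qed
  ultimately show ?thesis unfolding F_def by (rule LIMSEQ_unique)
qed

text \<open>Intervals have positive measure. It provides measurable slices arbitrarily close to a
  face.\<close>

lemma AE_lborel_open_ex:
  assumes "AE x in lborel. P x" "d1 < (d2::real)"
  shows "\<exists>x. d1 < x \<and> x < d2 \<and> P x"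
proof (rule ccontr)
  assume "\<not> ?thesis"
  then have sub: "{d1<..<d2} \<subseteq> {x. \<not> P x}" by auto
  from assms(1) obtain B where B: "B \<in> null_sets lborel" "{x \<in> space lborel. \<not> P x} \<subseteq> B"
    unfolding eventually_ae_filter by blast
  have "emeasure lborel {d1<..<d2} \<le> emeasure lborel B"
    using sub B by (intro emeasure_mono) auto
  then have "ennreal (d2 - d1) = 0" using B(1) assms(2) by (auto simp: null_sets_def)
  then show False using assms(2) by (auto simp: ennreal_eq_0_iff)
qed

context transform_problem
begin

context
  fixes l :: "nat \<Rightarrow> nat" and k s :: nat
  assumes k: "k \<in> {1..n}" and lk: "l k = 0" and s: "s = 1 \<or> s = 2"
begin

lemma free_coords_upd:
  "free_coords n l = insert k (free_coords n (l(k := s)))" "k \<notin> free_coords n (l(k := s))"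
  using k lk s by (auto simp: free_coords_def)

lemma par_upd:
  assumes "y \<in> free_coords n (l(k := s)) \<rightarrow>\<^sub>E UNIV"
  shows "y(k := x) \<in> par l \<longleftrightarrow> y \<in> par (l(k := s)) \<and> a k < ereal x \<and> ereal x < b k"
  using assms free_coords_upd(2)
  unfolding face_params_def free_coords_upd(1) by (auto simp: PiE_iff extensional_def)

lemma fp_upd: "fp l (y(k := x)) = (fp (l(k := s)) y)(k := x)"
  using k lk by (auto simp: face_point_def fun_eq_iff)

lemma fin_face_upd:
  assumes "fin_face l"
  shows "fin_face (l(k := s)) \<longleftrightarrow> \<bar>if s = 1 then a k else b k\<bar> \<noteq> \<infinity>"
proof
  assume "fin_face (l(k := s))"
  from bspec[OF this[unfolded face_finite_def] k] s
  show "\<bar>if s = 1 then a k else b k\<bar> \<noteq> \<infinity>" by auto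
next
  assume *: "\<bar>if s = 1 then a k else b k\<bar> \<noteq> \<infinity>"
  show "fin_face (l(k := s))"
    unfolding face_finite_def
  proof
    fix i assume "i \<in> {1..n}"
    with assms * show "((l(k := s)) i = 1 \<longrightarrow> \<bar>a i\<bar> \<noteq> \<infinity>) \<and> ((l(k := s)) i = 2 \<longrightarrow> \<bar>b i\<bar> \<noteq> \<infinity>)"
      unfolding face_finite_def by (cases "i = k") auto
  qed
qed

lemma fp_upd_end: "fp (l(k := s)) y k = real_of_ereal (if s = 1 then a k else b k)"
  using k s by (auto simp: face_point_def)

end

text \<open>Almost every slice parallel to the face is measurable, and by continuity the values on the face
  are limits of the values on such slices.\<close>

lemma face_measurable_step:
  assumes k: "k \<in> {1..n}" and lk: "l k = 0" and s: "s = 1 \<or> s = 2" and tern: "ternary l"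
    and fin: "fin_face (l(k := s))" and meas: "face_measurable l q"
    and cont: "\<And>t. t \<in> Q \<Longrightarrow> continuous_on (edge a b k) (\<lambda>x. pd q (t(k := x)))"
  shows "face_measurable (l(k := s)) q"
proof -
  let ?l = "l(k := s)"
  let ?I = "free_coords n ?l"
  let ?F = "\<lambda>y. indicator (par l) y *\<^sub>R pd q (fp l y)"
  let ?P = "\<lambda>x. (\<lambda>y. ?F (y(k := x))) \<in> borel_measurable (lebesgue_on_coords ?I)"
  note upd = free_coords_upd[where k = k and l = l and s = s, OF k lk s]
  have AE: "AE x in lborel. ?P x"
    by (rule measurable_slice_AE[OF finite_free_coords upd(2)])
      (use meas in \<open>simp only: face_measurable_def upd(1)\<close>)
  define c where "c = real_of_ereal (if s = 1 then a k else b k)"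
  have c: "ereal c = (if s = 1 then a k else b k)"
    using fin[unfolded face_finite_def, rule_format, OF k] s by (auto simp: c_def ereal_real)
  obtain z where z: "a k < ereal z" "ereal z < b k" using ab k ereal_dense2 by blast
  \<comment> \<open>An interval adjacent to c of length at most 1/(m + 1) contains a good slice; the
    interior point z keeps this interval inside the edge.\<close>
  have "\<exists>x. \<bar>x - c\<bar> \<le> inverse (real (Suc m)) \<and> a k < ereal x \<and> ereal x < b k \<and> ?P x" for m
  proof (cases "s = 1")
    case True
    then have ca: "ereal c = a k" using c by simp
    have "c < min z (c + inverse (real (Suc m)))" using z(1) ca[symmetric] by simp
    from AE_lborel_open_ex[OF AE this] obtain x where
      x: "c < x" "x < min z (c + inverse (real (Suc m)))" "?P x" by (elim exE conjE)
    have "a k < ereal x" using x(1) ca[symmetric] by simp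
    moreover have "ereal x < b k" by (rule order.strict_trans[OF _ z(2)]) (use x(2) in simp)
    moreover have "\<bar>x - c\<bar> \<le> inverse (real (Suc m))" using x(1,2) by (simp add: min_less_iff_conj del: of_nat_Suc)
    ultimately show ?thesis using x(3) by (intro exI[of _ x] conjI)
  next
    case False
    then have ca: "ereal c = b k" using c by simp
    have "max z (c - inverse (real (Suc m))) < c" using z(2) ca[symmetric] by simp
    from AE_lborel_open_ex[OF AE this] obtain x where
      x: "max z (c - inverse (real (Suc m))) < x" "x < c" "?P x" by (elim exE conjE)
    have "ereal x < b k" using x(2) ca[symmetric] by simp
    moreover have "a k < ereal x" by (rule order.strict_trans[OF z(1)]) (use x(1) in simp)
    moreover have "\<bar>x - c\<bar> \<le> inverse (real (Suc m))" using x(1,2) by (simp add: max_less_iff_conj del: of_nat_Suc)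
    ultimately show ?thesis using x(3) by (intro exI[of _ x] conjI)
  qed
  then have "\<forall>m. \<exists>x. \<bar>x - c\<bar> \<le> inverse (real (Suc m)) \<and> a k < ereal x \<and> ereal x < b k \<and> ?P x" by (rule allI)
  from choice[OF this] obtain X where
    X': "\<forall>m. \<bar>X m - c\<bar> \<le> inverse (real (Suc m)) \<and> a k < ereal (X m) \<and> ereal (X m) < b k \<and> ?P (X m)" ..
  note X1 = spec[OF X'] note X2 = conjunct2[OF X1] note X3 = conjunct2[OF X2]
  note X = conjunct1[OF X1] conjunct1[OF X2] conjunct1[OF X3] conjunct2[OF X3]
  have Xc: "X \<longlonglongrightarrow> c"
  proof (rule LIM_zero_cancel, rule Lim_null_comparison)
    show "\<forall>\<^sub>F m in sequentially. norm (X m - c) \<le> inverse (real (Suc m))" using X(1) by auto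
    show "(\<lambda>m. inverse (real (Suc m))) \<longlonglongrightarrow> 0" by (rule LIMSEQ_inverse_real_of_nat)
  qed
  have tern': "ternary ?l" using tern s by (auto simp: ternary_def)
  show ?thesis
    unfolding face_measurable_def
  proof (rule borel_measurable_LIMSEQ_metric[OF X(4)])
    fix y assume y: "y \<in> space (lebesgue_on_coords ?I)"
    show "(\<lambda>m. ?F (y(k := X m))) \<longlonglongrightarrow> indicator (par ?l) y *\<^sub>R pd q (fp ?l y)"
    proof (cases "y \<in> par ?l")
      case True
      let ?t = "fp ?l y"
      have t: "?t \<in> Q" by (rule fp_in_Q[OF tern' fin True])
      have tk: "?t k = c" unfolding c_def by (rule fp_upd_end[where k = k and l = l and s = s, OF k lk s])
      have "?t k \<in> edge a b k" by (rule box_Q_edge[OF t k])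
      moreover have "X m \<in> edge a b k" for m using X(2,3)[of m] by (auto simp: edge_def intro: less_imp_le)
      ultimately have "(\<lambda>m. pd q (?t(k := X m))) \<longlonglongrightarrow> pd q (?t(k := c))"
        using continuous_on_tendsto_compose[OF cont[OF t] Xc] unfolding tk by simp
      moreover have "?t(k := c) = ?t" using tk by auto
      moreover have "?F (y(k := X m)) = pd q (?t(k := X m))" for m
        using par_upd[where k = k and l = l and s = s, OF k lk s, of y "X m"] y True X(2,3) fp_upd[where k = k and l = l and s = s, OF k lk s] by auto
      ultimately show ?thesis using True by simp
    next
      case False
      then have "y(k := X m) \<notin> par l" for m using par_upd[where k = k and l = l and s = s, OF k lk s, of y "X m"] y by auto
      then show ?thesis using False by simp
    qed
  qed
qed

text \<open>The conditions on \<open>q\<close> allow all derivatives that occur while the variables are treated in the order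
  \<open>1, \<dots>, n\<close>; under them \<open>pd q\<close> is continuous across the face \<open>(l)\<close>.\<close>

definition valid :: "(nat \<Rightarrow> nat) \<Rightarrow> (nat \<Rightarrow> nat) \<Rightarrow> bool" where
  "valid l q \<longleftrightarrow> ternary l \<and> le_j q \<and>
     (\<forall>i\<in>{1..n}. l i \<noteq> 0 \<longrightarrow> q i < j i \<and> (\<forall>m\<in>{1..<i}. q m = 0 \<or> q m < j m))"

text \<open>One order is left in t_k, so \<open>pd q\<close> is even differentiable along edge
  k.\<close>

lemma pd_continuous:
  assumes "le_j q" "k \<in> {1..n}" "q k < j k" "\<And>i. i \<in> {1..<k} \<Longrightarrow> q i = 0 \<or> q i < j i" "t \<in> Q"
  shows "continuous_on (edge a b k) (\<lambda>x. pd q (t(k := x)))"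
proof -
  have "has_partial k (pd q) (pd (q(k := Suc (q k))))"
    by (rule pd_partial) (use assms in \<open>auto simp: le_j_def\<close>)
  then show ?thesis
    unfolding continuous_on_eq_continuous_within
    using has_partialD[OF _ assms(5,2)] has_vector_derivative_continuous by blast
qed

text \<open>Induction on the codimension: a face is reached from the one in which one of its fixed
  coordinates is still free.\<close>

lemma face_measurable:
  assumes "valid l q" "fin_face l"
  shows "face_measurable l q"
  using assms
proof (induction "card {i\<in>{1..n}. l i \<noteq> 0}" arbitrary: l rule: less_induct)
  case less
  show ?case
  proof (cases "\<forall>i\<in>{1..n}. l i = 0")
    case True
    then show ?thesis using less.prems by (intro face_measurable_box) (auto simp: valid_def)
  next
    case False
    then obtain k where k: "k \<in> {1..n}" "l k \<noteq> 0" by blast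
    let ?l = "l(k := 0)"
    have s: "l k = 1 \<or> l k = 2" using k less.prems(1) by (force simp: valid_def ternary_def)
    have v: "valid ?l q" using less.prems(1) by (auto simp: valid_def ternary_def)
    have card: "card {i\<in>{1..n}. ?l i \<noteq> 0} < card {i\<in>{1..n}. l i \<noteq> 0}"
      by (rule psubset_card_mono) (use k in auto)
    have vk: "le_j q" "q k < j k" "\<forall>m\<in>{1..<k}. q m = 0 \<or> q m < j m"
      using less.prems(1) k unfolding valid_def by blast+
    have fin0: "fin_face ?l" using less.prems(2) unfolding face_finite_def by auto
    have m: "face_measurable ?l q" by (rule less.hyps[OF card v fin0])
    have "face_measurable (?l(k := l k)) q"
    proof (rule face_measurable_step[OF k(1) _ s _ _ m])
      show "ternary ?l" using v by (simp add: valid_def)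
      show "fin_face (?l(k := l k))" using less.prems(2) by simp
      show "continuous_on (edge a b k) (\<lambda>x. pd q (t(k := x)))" if "t \<in> Q" for t
        by (rule pd_continuous[OF _ k(1) _ _ that]) (use vk in auto)
    qed simp
    then show ?thesis by simp
  qed
qed

text \<open>\<open>face_transform\<close> with an arbitrary symbol in place of that of the kernel.
  In this form the family is stable under R_k.\<close>

definition G :: "(nat \<Rightarrow> nat) \<Rightarrow> (nat \<Rightarrow> nat) \<Rightarrow> ('a \<Rightarrow> 'a) \<Rightarrow> 'a \<Rightarrow> 'a" where
  "G l q \<Psi> \<zeta> = (if fin_face l
     then \<integral>y. indicator (par l) y *\<^sub>R kern q \<Psi> \<zeta> (fp l y) \<partial>lebesgue_on_coords (free_coords n l) else 0)"

lemma face_transform_eq_G: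
  "face_transform \<kappa> r n e a b l (pd q) p \<zeta> = G l q ksymbol \<zeta>"
  unfolding face_transform_def G_def set_lebesgue_integral_def kern_def exp_kernel cd_mult_scaleR_right ..

lemma integrable_face:
  assumes v: "valid l q" and fin: "fin_face l" and \<Psi>: "vsymbol \<Psi>"
  shows "integrable (lebesgue_on_coords (free_coords n l)) (\<lambda>y. indicator (par l) y *\<^sub>R kern q \<Psi> \<zeta> (fp l y))"
proof -
  have q: "le_j q" and l: "ternary l" using v by (auto simp: valid_def)
  obtain C \<epsilon> where C: "C \<ge> 0" "\<epsilon> > 0"
    "\<And>t. t \<in> Q \<Longrightarrow> norm (kern q \<Psi> \<zeta> t) \<le> C * exp (- (\<epsilon> * (\<Sum>k=1..n. \<bar>t k\<bar>)))"
    using kern_bound[OF q \<Psi>, of "\<zeta> \<bullet> e 0" "norm \<zeta>"] by blast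
  show ?thesis
  proof (rule Bochner_Integration.integrable_bound)
    show "integrable (lebesgue_on_coords (free_coords n l)) (\<lambda>y. C * exp (- (\<epsilon> * (\<Sum>i\<in>free_coords n l. \<bar>y i\<bar>))))"
      by (intro Bochner_Integration.integrable_mult_right integrable_exp_coords C(2)) simp
    show "(\<lambda>y. indicator (par l) y *\<^sub>R kern q \<Psi> \<zeta> (fp l y)) \<in> borel_measurable (lebesgue_on_coords (free_coords n l))"
      by (rule kern_measurable[OF face_measurable[OF v fin] \<Psi>])
    show "AE y in lebesgue_on_coords (free_coords n l). norm (indicator (par l) y *\<^sub>R kern q \<Psi> \<zeta> (fp l y)) \<le>
        norm (C * exp (- (\<epsilon> * (\<Sum>i\<in>free_coords n l. \<bar>y i\<bar>))))"
    proof (rule AE_I2)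
      fix y
      show "norm (indicator (par l) y *\<^sub>R kern q \<Psi> \<zeta> (fp l y)) \<le> norm (C * exp (- (\<epsilon> * (\<Sum>i\<in>free_coords n l. \<bar>y i\<bar>))))"
      proof (cases "y \<in> par l")
        case True
        have "norm (kern q \<Psi> \<zeta> (fp l y)) \<le> C * exp (- (\<epsilon> * (\<Sum>k=1..n. \<bar>fp l y k\<bar>)))"
          by (rule C(3)[OF fp_in_Q[OF l fin True]])
        also have "\<dots> \<le> C * exp (- (\<epsilon> * (\<Sum>i\<in>free_coords n l. \<bar>y i\<bar>)))"
          using C(1,2) sum_abs_fp[where l = l and y = y] by (intro mult_left_mono) auto
        finally show ?thesis using True C(1) by simp
      qed (use C(1) in auto)
    qed
  qed
qed

lemma kern_add: "kern q (\<lambda>z. \<Psi> z + \<Phi> z) \<zeta> t = kern q \<Psi> \<zeta> t + kern q \<Phi> \<zeta> t"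
  by (simp add: kern_def cd_mult_add_right scaleR_add_right)

lemma kern_scaleR: "kern q (\<lambda>z. c *\<^sub>R \<Psi> z) \<zeta> t = c *\<^sub>R kern q \<Psi> \<zeta> t"
  by (simp add: kern_def cd_mult_scaleR_right mult.commute)

lemma G_add:
  assumes "valid l q" "vsymbol \<Psi>" "vsymbol \<Phi>"
  shows "G l q (\<lambda>z. \<Psi> z + \<Phi> z) \<zeta> = G l q \<Psi> \<zeta> + G l q \<Phi> \<zeta>"
  using assms by (auto simp: G_def kern_add scaleR_add_right integrable_face)

lemma G_scaleR: "G l q (\<lambda>z. c *\<^sub>R \<Psi> z) \<zeta> = c *\<^sub>R G l q \<Psi> \<zeta>"
proof -
  have "indicator (par l) y *\<^sub>R kern q (\<lambda>z. c *\<^sub>R \<Psi> z) \<zeta> (fp l y) =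
      c *\<^sub>R (indicator (par l) y *\<^sub>R kern q \<Psi> \<zeta> (fp l y))" for y
    by (simp add: kern_scaleR mult.commute)
  then show ?thesis by (simp add: G_def del: scaleR_scaleR)
qed

lemma G_sum:
  assumes "valid l q" "finite A" "\<And>i. i \<in> A \<Longrightarrow> vsymbol (\<Psi> i)"
  shows "G l q (\<lambda>z. \<Sum>i\<in>A. \<Psi> i z) \<zeta> = (\<Sum>i\<in>A. G l q (\<Psi> i) \<zeta>)"
  using assms(2,3)
proof (induction A)
  case empty
  then show ?case using G_scaleR[of l q 0 "\<lambda>z. 0" \<zeta>] by simp
next
  case (insert i A)
  then show ?case by (simp add: G_add[OF assms(1)] vsymbol_sum)
qed

lemma G_R_symbol:
  assumes "valid l q" "vsymbol \<Psi>"
  shows "G l q (R_symbol k \<Psi>) \<zeta> =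
    (p \<bullet> e 0) *\<^sub>R G l q \<Psi> \<zeta> - (\<Sum>m\<in>idx k. (p \<bullet> e m) *\<^sub>R G l q (partial \<Psi> m) \<zeta>)"
proof -
  have "G l q (R_symbol k \<Psi>) \<zeta> =
     G l q (\<lambda>z. (p \<bullet> e 0) *\<^sub>R \<Psi> z + (- 1) *\<^sub>R (\<Sum>m\<in>idx k. (p \<bullet> e m) *\<^sub>R partial \<Psi> m z)) \<zeta>"
    by (simp add: R_symbol_def[abs_def])
  also have "\<dots> = G l q (\<lambda>z. (p \<bullet> e 0) *\<^sub>R \<Psi> z) \<zeta> +
      G l q (\<lambda>z. (- 1) *\<^sub>R (\<Sum>m\<in>idx k. (p \<bullet> e m) *\<^sub>R partial \<Psi> m z)) \<zeta>"
    using assms by (intro G_add vsymbol_scaleR_const vsymbol_sum partial(1))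
  also have "\<dots> = (p \<bullet> e 0) *\<^sub>R G l q \<Psi> \<zeta> +
      (- 1) *\<^sub>R G l q (\<lambda>z. \<Sum>m\<in>idx k. (p \<bullet> e m) *\<^sub>R partial \<Psi> m z) \<zeta>"
    by (simp only: G_scaleR)
  also have "G l q (\<lambda>z. \<Sum>m\<in>idx k. (p \<bullet> e m) *\<^sub>R partial \<Psi> m z) \<zeta> =
      (\<Sum>m\<in>idx k. G l q (\<lambda>z. (p \<bullet> e m) *\<^sub>R partial \<Psi> m z) \<zeta>)"
    using assms by (intro G_sum vsymbol_scaleR_const partial(1)) auto
  finally show ?thesis by (simp add: G_scaleR)
qed

lemma kern_derivative_zeta:
  assumes \<Psi>: "vsymbol \<Psi>" and m: "m < 2 ^ r"
  shows "((\<lambda>x. kern q \<Psi> (\<zeta> + x *\<^sub>R e m) t) has_vector_derivative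
    kern q (partial \<Psi> m) (\<zeta> + x *\<^sub>R e m) t) (at x within S)"
proof -
  have sw: "\<zeta> + x *\<^sub>R e m + shift t = (\<zeta> + shift t) + x *\<^sub>R e m" for x by simp
  have "bounded_linear (\<lambda>v. weight t *\<^sub>R cd_mult r e (pd q t) v)"
    by (intro bounded_linear_compose[OF bounded_linear_scaleR_right]
        bounded_bilinear.bounded_linear_right[OF bounded_bilinear_cd_mult])
  from bounded_linear.has_vector_derivative[OF this symbol_direction_derivative[OF \<Psi> m]]
  show ?thesis unfolding kern_def sw .
qed

text \<open>The mean value estimate bounds the difference quotients with |x| \<le> 1 by an
  integrable w, and dominated convergence applies along sequences. With m \<noteq> 0 the point moves
  inside a hyperplane of fixed real part, where the bounds on symbols hold uniformly.\<close>

lemma G_derivative: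
  assumes v: "valid l q" and \<Psi>: "vsymbol \<Psi>" and m: "m < 2 ^ r" "m \<noteq> 0"
  shows "((\<lambda>x. G l q \<Psi> (\<zeta> + x *\<^sub>R e m)) has_vector_derivative G l q (partial \<Psi> m) \<zeta>) (at 0)"
proof (cases "fin_face l")
  case False
  then show ?thesis by (simp add: G_def)
next
  case fin: True
  let ?M = "lebesgue_on_coords (free_coords n l)"
  define F where "F = (\<lambda>x y. indicator (par l) y *\<^sub>R kern q \<Psi> (\<zeta> + x *\<^sub>R e m) (fp l y))"
  define F' where "F' = (\<lambda>y. indicator (par l) y *\<^sub>R kern q (partial \<Psi> m) \<zeta> (fp l y))"
  have q: "le_j q" and l: "ternary l" using v by (auto simp: valid_def)
  have intF: "integrable ?M (F x)" for x unfolding F_def by (rule integrable_face[OF v fin \<Psi>])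
  have intF': "integrable ?M F'" unfolding F'_def by (rule integrable_face[OF v fin partial(1)[OF \<Psi>]])
  obtain C \<epsilon> where C: "C \<ge> 0" "\<epsilon> > 0"
    "\<And>t z. t \<in> Q \<Longrightarrow> z \<bullet> e 0 = \<zeta> \<bullet> e 0 \<Longrightarrow> norm z \<le> norm \<zeta> + 1 \<Longrightarrow>
      norm (kern q (partial \<Psi> m) z t) \<le> C * exp (- (\<epsilon> * (\<Sum>k=1..n. \<bar>t k\<bar>)))"
    using kern_bound[OF q partial(1)[OF \<Psi>], of "\<zeta> \<bullet> e 0" "norm \<zeta> + 1"] by blast
  define w where "w = (\<lambda>y. C * exp (- (\<epsilon> * (\<Sum>i\<in>free_coords n l. \<bar>y i\<bar>))))"
  have w: "integrable ?M w" unfolding w_def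
    by (intro Bochner_Integration.integrable_mult_right integrable_exp_coords C(2)) simp
  have bound: "norm ((F x y - F 0 y) /\<^sub>R x) \<le> w y" if x: "\<bar>x\<bar> \<le> 1" "x \<noteq> 0" for x y
  proof (cases "y \<in> par l")
    case True
    let ?t = "fp l y"
    have "norm (kern q \<Psi> (\<zeta> + x *\<^sub>R e m) ?t - kern q \<Psi> (\<zeta> + 0 *\<^sub>R e m) ?t) \<le>
        (C * exp (- (\<epsilon> * (\<Sum>k=1..n. \<bar>?t k\<bar>)))) * \<bar>x - 0\<bar>"
    proof (rule norm_diff_le_of_vector_derivative[where S = "{-1..1}" and g = "\<lambda>x. kern q \<Psi> (\<zeta> + x *\<^sub>R e m) ?t",
          OF _ kern_derivative_zeta[OF \<Psi> m(1)]])
      fix x :: real assume x: "x \<in> {-1..1}"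
      have "norm (\<zeta> + x *\<^sub>R e m) \<le> norm \<zeta> + \<bar>x\<bar> * norm (e m)"
        using norm_triangle_ineq[of \<zeta> "x *\<^sub>R e m"] by simp
      also have "\<dots> \<le> norm \<zeta> + 1" using x m by (auto simp: norm_e)
      finally show "norm (kern q (partial \<Psi> m) (\<zeta> + x *\<^sub>R e m) ?t) \<le> C * exp (- (\<epsilon> * (\<Sum>k=1..n. \<bar>?t k\<bar>)))"
        using m by (intro C(3) fp_in_Q[OF l fin True]) (auto simp: inner_add_left inner_e)
    qed (use x in auto)
    also have "\<dots> \<le> w y * \<bar>x\<bar>"
      unfolding w_def using C(1,2) sum_abs_fp[where l = l and y = y]
      by (intro mult_mono mult_left_mono) auto
    finally have "norm (F x y - F 0 y) \<le> w y * \<bar>x\<bar>" using True by (simp add: F_def)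
    then show ?thesis using x by (simp add: divide_simps mult.commute)
  qed (use C(1) in \<open>auto simp: F_def w_def\<close>)
  have lim: "((\<lambda>x. (F x y - F 0 y) /\<^sub>R (x - 0)) \<longlongrightarrow> F' y) (at 0)" for y
  proof (rule vector_derivative_quotient)
    have "((\<lambda>x. kern q \<Psi> (\<zeta> + x *\<^sub>R e m) (fp l y)) has_vector_derivative
        kern q (partial \<Psi> m) \<zeta> (fp l y)) (at 0)"
      using kern_derivative_zeta[OF \<Psi> m(1), of q \<zeta> "fp l y" 0 UNIV] by simp
    then show "((\<lambda>x. F x y) has_vector_derivative F' y) (at 0)"
      unfolding F_def F'_def by (rule bounded_linear.has_vector_derivative[OF bounded_linear_scaleR_right])
  qed
  have "((\<lambda>x. ((\<integral>y. F x y \<partial>?M) - (\<integral>y. F 0 y \<partial>?M)) /\<^sub>R (x - 0)) \<longlongrightarrow> (\<integral>y. F' y \<partial>?M)) (at 0)"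
    unfolding tendsto_at_iff_sequentially
  proof (intro allI impI)
    fix X :: "nat \<Rightarrow> real" assume X: "\<forall>i. X i \<in> UNIV - {0}" "X \<longlonglongrightarrow> 0"
    \<comment> \<open>Dropping i0 terms brings the sequence into |x| \<le> 1, where w
      dominates.\<close>
    obtain i0 where i0: "\<And>i. i \<ge> i0 \<Longrightarrow> \<bar>X i\<bar> \<le> 1"
      using X(2)[THEN LIMSEQ_D, of 1] by (auto intro: less_imp_le)
    have "(\<lambda>i. \<integral>y. (F (X (i + i0)) y - F 0 y) /\<^sub>R X (i + i0) \<partial>?M) \<longlonglongrightarrow> (\<integral>y. F' y \<partial>?M)"
    proof (rule integral_dominated_convergence[OF _ _ w])
      show "F' \<in> borel_measurable ?M" using intF' by auto
      show "(\<lambda>y. (F (X (i + i0)) y - F 0 y) /\<^sub>R X (i + i0)) \<in> borel_measurable ?M" for i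
        using intF by (intro borel_measurable_scaleR borel_measurable_diff) auto
      show "AE y in ?M. norm ((F (X (i + i0)) y - F 0 y) /\<^sub>R X (i + i0)) \<le> w y" for i
        using i0[of "i + i0"] X(1) by (intro AE_I2 bound) auto
      show "AE y in ?M. (\<lambda>i. (F (X (i + i0)) y - F 0 y) /\<^sub>R X (i + i0)) \<longlonglongrightarrow> F' y"
      proof (rule AE_I2)
        fix y
        have "((\<lambda>x. (F x y - F 0 y) /\<^sub>R (x - 0)) \<circ> X) \<longlonglongrightarrow> F' y"
          using lim[of y] X unfolding tendsto_at_iff_sequentially by blast
        then show "(\<lambda>i. (F (X (i + i0)) y - F 0 y) /\<^sub>R X (i + i0)) \<longlonglongrightarrow> F' y"
          by (intro LIMSEQ_ignore_initial_segment) (simp add: o_def)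
      qed
    qed
    moreover have "(\<integral>y. (F x y - F 0 y) /\<^sub>R x \<partial>?M) = ((\<integral>y. F x y \<partial>?M) - (\<integral>y. F 0 y \<partial>?M)) /\<^sub>R x" for x
      using intF by (subst Bochner_Integration.integral_diff[symmetric]) auto
    ultimately have "(\<lambda>i. ((\<integral>y. F (X (i + i0)) y \<partial>?M) - (\<integral>y. F 0 y \<partial>?M)) /\<^sub>R X (i + i0)) \<longlonglongrightarrow> (\<integral>y. F' y \<partial>?M)"
      by (simp only:)
    from LIMSEQ_offset[OF this]
    show "((\<lambda>x. ((\<integral>y. F x y \<partial>?M) - (\<integral>y. F 0 y \<partial>?M)) /\<^sub>R (x - 0)) \<circ> X) \<longlonglongrightarrow> (\<integral>y. F' y \<partial>?M)"
      by (simp add: o_def)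
  qed
  then have "((\<lambda>x. \<integral>y. F x y \<partial>?M) has_vector_derivative (\<integral>y. F' y \<partial>?M)) (at 0)"
    by (rule has_vector_derivative_iff_quotient[THEN iffD2])
  then show ?thesis using fin by (simp add: G_def F_def F'_def)
qed

lemma R_op_G:
  assumes v: "valid l q" and \<Psi>: "vsymbol \<Psi>" and k: "k \<in> {1..n}"
  shows "R_op \<kappa> e p k (G l q \<Psi>) = G l q (R_symbol k \<Psi>)"
proof
  fix \<zeta>
  have "S_op e m (G l q \<Psi>) \<zeta> = - G l q (partial \<Psi> m) \<zeta>" if "m \<in> idx k" for m
    using G_derivative[OF v \<Psi>, of m \<zeta>] idx_bounds[OF k that]
    by (auto simp: S_op_def intro: vector_derivative_at)
  then show "R_op \<kappa> e p k (G l q \<Psi>) \<zeta> = G l q (R_symbol k \<Psi>) \<zeta>"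
    unfolding R_op_eq G_R_symbol[OF v \<Psi>] by (simp add: sum_negf)
qed

end

section \<open>Integration by parts over a face\<close>

context transform_problem begin
text \<open>By the product rule the t_k-derivative of the integrand is \<open>kern\<close> with the
  order raised in k minus \<open>kern\<close> with \<open>R_symbol k \<Psi>\<close>. Integrated
  along edge k it leaves the values at the two ends, and Fubini turns these into the transforms of
  the opposite faces. An infinite end gives 0 by decay, in agreement with the convention in
  \<open>G\<close>.\<close>

lemma G_integration_by_parts:
  assumes k: "k \<in> {1..n}" and lk: "l k = 0" and v: "valid l q" and vS: "valid l (q(k := Suc (q k)))"
    and v12: "valid (l(k := 1)) q" "valid (l(k := 2)) q" and \<Psi>: "vsymbol \<Psi>"
  shows "G l (q(k := Suc (q k))) \<Psi> \<zeta> =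
    G l q (R_symbol k \<Psi>) \<zeta> + G (l(k := 2)) q \<Psi> \<zeta> - G (l(k := 1)) q \<Psi> \<zeta>"
proof (cases "fin_face l")
  case False
  from False[unfolded face_finite_def Set.ball_simps(10)]
  obtain i where i: "i \<in> {1..n}" "\<not> ((l i = 1 \<longrightarrow> \<bar>a i\<bar> \<noteq> \<infinity>) \<and> (l i = 2 \<longrightarrow> \<bar>b i\<bar> \<noteq> \<infinity>))" ..
  \<comment> \<open>The fixed coordinate at infinity is not t_k, so it survives in the other faces
    and all terms vanish.\<close>
  then have "i \<noteq> k" using lk by auto
  have "\<not> fin_face (l(k := s))" for s
  proof
    assume "fin_face (l(k := s))"
    from bspec[OF this[unfolded face_finite_def] i(1)] i(2) \<open>i \<noteq> k\<close> show False by auto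
  qed
  then show ?thesis using False by (simp add: G_def)
next
  case fin: True
  let ?q = "q(k := Suc (q k))"
  let ?I = "free_coords n (l(k := 2))"
  have l: "ternary l" "ternary (l(k := 2))" "ternary (l(k := 1))" and q: "le_j q" "le_j ?q"
    using v vS v12 by (auto simp: valid_def)
  have upd: "free_coords n l = insert k ?I" "k \<notin> ?I" "free_coords n (l(k := 1)) = ?I"
    using free_coords_upd[where k = k and l = l and s = 2, OF k lk disjI2[OF refl]] free_coords_upd[where k = k and l = l and s = 1, OF k lk disjI1[OF refl]] by auto
  have par12: "par (l(k := 1)) = par (l(k := 2))" unfolding face_params_def upd ..
  have low: "q i = 0 \<or> q i < j i" if "i \<in> {1..<k}" for i
    using bspec[OF conjunct2[OF conjunct2[OF v12(1)[unfolded valid_def]]] k] that by simp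
  have qk: "q k < j k"
    using bspec[OF conjunct2[OF conjunct2[OF v12(1)[unfolded valid_def]]] k] by simp
  have partial: "has_partial k (pd q) (pd ?q)"
    by (rule pd_partial) (use q k qk low in \<open>auto simp: le_j_def\<close>)
  have deriv: "((\<lambda>x. kern q \<Psi> \<zeta> (t(k := x))) has_vector_derivative
      kern ?q \<Psi> \<zeta> (t(k := x)) - kern q (R_symbol k \<Psi>) \<zeta> (t(k := x))) (at x within edge a b k)"
    if t: "t \<in> Q" and x: "x \<in> edge a b k" for t x
  proof -
    have "kern q \<Psi> \<zeta> t = cd_mult r e (pd q t) (weight t *\<^sub>R \<Psi> (\<zeta> + shift t))" for q t
      by (simp add: kern_def cd_mult_scaleR_right)
    moreover have "((\<lambda>x. cd_mult r e (pd q (t(k := x))) (weight (t(k := x)) *\<^sub>R \<Psi> (\<zeta> + shift (t(k := x))))) has_vector_derivative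
      cd_mult r e (pd q (t(k := x))) (- (weight (t(k := x)) *\<^sub>R R_symbol k \<Psi> (\<zeta> + shift (t(k := x))))) +
      cd_mult r e (pd ?q (t(k := x))) (weight (t(k := x)) *\<^sub>R \<Psi> (\<zeta> + shift (t(k := x))))) (at x within edge a b k)"
      by (rule bounded_bilinear.has_vector_derivative[OF bounded_bilinear_cd_mult
            has_partialD[OF partial t k x] kernel_derivative[OF \<Psi> k]])
    moreover have "cd_mult r e u (- w) = - cd_mult r e u w" for u w
      using cd_mult_scaleR_right[of u "- 1" w] by simp
    ultimately show ?thesis by (simp add: kern_def cd_mult_scaleR_right)
  qed
  obtain C \<epsilon> where C: "C \<ge> 0" "\<epsilon> > 0"
    "\<And>t. t \<in> Q \<Longrightarrow> norm (kern q \<Psi> \<zeta> t) \<le> C * exp (- (\<epsilon> * (\<Sum>k=1..n. \<bar>t k\<bar>)))"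
    using kern_bound[OF q(1) \<Psi>, of "\<zeta> \<bullet> e 0" "norm \<zeta>"] by blast
  define H where "H = (\<lambda>y. indicator (par l) y *\<^sub>R (kern ?q \<Psi> \<zeta> (fp l y) - kern q (R_symbol k \<Psi>) \<zeta> (fp l y)))"
  \<comment> \<open>The integrand on the face t_k = a_k for s = 1 and t_k = b_k for s = 2. Both
    faces have the free coordinates \<open>?I\<close>, so they share one measure space.\<close>
  define B where "B = (\<lambda>s y. if fin_face (l(k := s)) then indicator (par (l(k := s))) y *\<^sub>R kern q \<Psi> \<zeta> (fp (l(k := s)) y) else 0)"
  note int1 = integrable_face[OF vS fin \<Psi>, of \<zeta>]
  note int2 = integrable_face[OF v fin vsymbol_R_symbol[OF \<Psi>], of k \<zeta>]
  have intH: "integrable (lebesgue_on_coords (insert k ?I)) H"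
    using Bochner_Integration.integrable_diff[OF int1 int2] unfolding H_def upd(1) scaleR_diff_right .
  have B_int': "integrable (lebesgue_on_coords (free_coords n (l(k := s)))) (B s)"
    if "valid (l(k := s)) q" for s
    using integrable_face[OF that _ \<Psi>, of \<zeta>] by (cases "fin_face (l(k := s))") (simp_all add: B_def)
  have B_int: "integrable (lebesgue_on_coords ?I) (B 1)" "integrable (lebesgue_on_coords ?I) (B 2)"
    using B_int'[OF v12(1)] B_int'[OF v12(2)] unfolding upd by blast+
  have GB': "G (l(k := s)) q \<Psi> \<zeta> = (\<integral>y. B s y \<partial>lebesgue_on_coords (free_coords n (l(k := s))))" for s
    by (cases "fin_face (l(k := s))") (simp_all add: G_def B_def)
  note GB = GB'[of 1, unfolded upd] GB'[of 2]
  have fin_s: "fin_face (l(k := 1)) \<longleftrightarrow> a k \<noteq> - \<infinity>" "fin_face (l(k := 2)) \<longleftrightarrow> b k \<noteq> \<infinity>"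
  proof -
    have "a k \<noteq> \<infinity>" "b k \<noteq> - \<infinity>" using bspec[OF ab k] by auto
    then have "\<bar>a k\<bar> \<noteq> \<infinity> \<longleftrightarrow> a k \<noteq> - \<infinity>" "\<bar>b k\<bar> \<noteq> \<infinity> \<longleftrightarrow> b k \<noteq> \<infinity>"
      by auto
    then show "fin_face (l(k := 1)) \<longleftrightarrow> a k \<noteq> - \<infinity>" "fin_face (l(k := 2)) \<longleftrightarrow> b k \<noteq> \<infinity>"
      using fin_face_upd[where k = k and l = l and s = 1, OF k lk disjI1[OF refl] fin]
        fin_face_upd[where k = k and l = l and s = 2, OF k lk disjI2[OF refl] fin] by auto
  qed
  have line: "AE y in lebesgue_on_coords ?I. (\<integral>x. H (y(k := x)) \<partial>lebesgue) = B 2 y - B 1 y"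
    unfolding AE_lebesgue_on_coords
    using AE_space fubini_coord(1)[OF finite_free_coords upd(2) intH]
  proof eventually_elim
    case (elim y)
    have y: "y \<in> ?I \<rightarrow>\<^sub>E UNIV" using elim(1) by (simp add: space_PiM)
    show ?case
    proof (cases "y \<in> par (l(k := 2))")
      case False
      then have "y(k := x) \<notin> par l" for x using par_upd[where k = k and l = l and s = 2, OF k lk disjI2[OF refl], OF y, of x] by auto
      then show ?thesis using False by (simp add: H_def B_def par12 del: One_nat_def)
    next
      case True
      \<comment> \<open>An anchor inside the edge: it yields a point t of the box whose k-th
        coordinate is then varied.\<close>
      obtain z where z: "a k < ereal z" "ereal z < b k" using ab k ereal_dense2 by blast
      define t where "t = fp l (y(k := z))"
      have yz: "y(k := z) \<in> par l" using par_upd[where k = k and l = l and s = 2, OF k lk disjI2[OF refl], OF y, of z] True z by auto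
      have t: "t \<in> Q" unfolding t_def by (rule fp_in_Q[OF l(1) fin yz])
      have fpx: "fp l (y(k := x)) = t(k := x)" for x
        unfolding t_def using fp_upd[where k = k and l = l and s = 2, OF k lk disjI2[OF refl]] by simp
      have fps: "fp (l(k := s)) y = t(k := fp (l(k := s)) y k)" if "s = 1 \<or> s = 2" for s
        unfolding t_def using fp_upd[where k = k and l = l and s = s, OF k lk that, of y z] by simp
      define \<phi> where "\<phi> = (\<lambda>x. kern q \<Psi> \<zeta> (t(k := x)))"
      define \<phi>' where "\<phi>' = (\<lambda>x. kern ?q \<Psi> \<zeta> (t(k := x)) - kern q (R_symbol k \<Psi>) \<zeta> (t(k := x)))"
      have H: "H (y(k := x)) = indicator {x. a k < ereal x \<and> ereal x < b k} x *\<^sub>R \<phi>' x" for x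
        using par_upd[where k = k and l = l and s = 2, OF k lk disjI2[OF refl], OF y, of x] True by (auto simp: H_def fpx \<phi>'_def indicator_def)
      have "(\<integral>x. H (y(k := x)) \<partial>lebesgue) =
         (if b k = \<infinity> then 0 else \<phi> (real_of_ereal (b k))) - (if a k = - \<infinity> then 0 else \<phi> (real_of_ereal (a k)))"
        unfolding H
      proof (rule integral_derivative_edge[where \<epsilon> = \<epsilon> and C = C])
        show "a k < b k" by (rule bspec[OF ab k])
        show "(\<phi> has_vector_derivative \<phi>' x) (at x within {x. a k \<le> ereal x \<and> ereal x \<le> b k})"
          if "x \<in> {x. a k \<le> ereal x \<and> ereal x \<le> b k}" for x
          using deriv[OF t, of x] that unfolding edge_def \<phi>_def \<phi>'_def by blast
        show "integrable lebesgue (\<lambda>x. indicator {x. a k < ereal x \<and> ereal x < b k} x *\<^sub>R \<phi>' x)"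
          using elim(2) unfolding H .
        show "norm (\<phi> x) \<le> C * exp (- (\<epsilon> * \<bar>x\<bar>))" if "x \<in> {x. a k \<le> ereal x \<and> ereal x \<le> b k}" for x
        proof -
          have "norm (\<phi> x) \<le> C * exp (- (\<epsilon> * (\<Sum>i=1..n. \<bar>(t(k := x)) i\<bar>)))"
            unfolding \<phi>_def using that by (intro C(3) box_Q_upd[OF t k]) (auto simp: edge_def)
          also have "\<dots> \<le> C * exp (- (\<epsilon> * \<bar>x\<bar>))"
            using C(1,2) member_le_sum[of k "{1..n}" "\<lambda>i. \<bar>(t(k := x)) i\<bar>"] k
            by (intro mult_left_mono) auto
          finally show ?thesis .
        qed
      qed (rule C(2))
      moreover have "B 2 y = (if b k = \<infinity> then 0 else \<phi> (real_of_ereal (b k)))"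
        using True fps[of 2] fp_upd_end[where k = k and l = l and s = 2, OF k lk disjI2[OF refl], of y] by (simp add: B_def fin_s \<phi>_def)
      moreover have "B 1 y = (if a k = - \<infinity> then 0 else \<phi> (real_of_ereal (a k)))"
        using True fps[of 1] fp_upd_end[where k = k and l = l and s = 1, OF k lk disjI1[OF refl], of y] by (simp add: B_def fin_s \<phi>_def par12 del: One_nat_def)
      ultimately show ?thesis by simp
    qed
  qed
  have "G l ?q \<Psi> \<zeta> - G l q (R_symbol k \<Psi>) \<zeta> = (\<integral>y. H y \<partial>lebesgue_on_coords (insert k ?I))"
    using Bochner_Integration.integral_diff[OF int1 int2] fin
    unfolding G_def H_def upd(1) scaleR_diff_right by simp
  also have "\<dots> = (\<integral>y. \<integral>x. H (y(k := x)) \<partial>lebesgue \<partial>lebesgue_on_coords ?I)"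
    by (rule fubini_coord(3)[OF finite_free_coords upd(2) intH])
  also have "\<dots> = (\<integral>y. B 2 y - B 1 y \<partial>lebesgue_on_coords ?I)"
    using fubini_coord(2)[OF finite_free_coords upd(2) intH] B_int
    by (intro integral_cong_AE line) auto
  also have "\<dots> = G (l(k := 2)) q \<Psi> \<zeta> - G (l(k := 1)) q \<Psi> \<zeta>"
    unfolding GB using B_int by simp
  finally show ?thesis by (simp add: algebra_simps)
qed

end

section \<open>Iterating the integration by parts\<close>

lemma AE_coords_neq:
  assumes "finite I" "k \<in> I"
  shows "AE t in coords_borel I. t k \<noteq> c"
proof -
  let ?A = "\<lambda>i. if i = k then {c} else (UNIV :: real set)"
  have "emeasure (coords_borel I) (Pi\<^sub>E I ?A) = (\<Prod>i\<in>I. emeasure lborel (?A i))"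
    using assms by (intro coords.emeasure_PiM) auto
  also have "\<dots> = 0" using assms by (auto intro!: prod_zero)
  finally have "Pi\<^sub>E I ?A \<in> null_sets (coords_borel I)"
    using assms by (auto simp: null_sets_def intro!: sets_PiM_I_finite)
  then show ?thesis
    by (rule AE_I') (use assms in \<open>auto simp: space_PiM PiE_iff extensional_def\<close>)
qed

context transform_problem
begin

lemma G_cong:
  assumes "\<And>i. i \<in> {1..n} \<Longrightarrow> l i = l' i" "\<And>i. i \<in> {1..n} \<Longrightarrow> q i = q' i"
  shows "G l q = G l' q'"
proof -
  have "free_coords n l = free_coords n l'" using assms(1) by (auto simp: free_coords_def)
  moreover from this have "par l = par l'" by (simp add: face_params_def)
  moreover have "fp l = fp l'" using assms(1) by (auto simp: face_point_def fun_eq_iff)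
  moreover have "fin_face l = fin_face l'" using assms(1) by (auto simp: face_finite_def)
  moreover have "pd q = pd q'" by (rule mpderiv_cong[OF assms(2)])
  ultimately show ?thesis unfolding G_def[abs_def] kern_def by (simp cong: if_cong)
qed

lemma valid_box: "le_j q \<Longrightarrow> valid (\<lambda>_. 0) q"
  by (simp add: valid_def ternary_def)

text \<open>The closed box and its interior differ by a null set.\<close>

lemma transform_eq_G:
  assumes q: "le_j q"
  shows "transform \<kappa> r n e (restrict_Q n a b (pd q)) p \<zeta> = G (\<lambda>_. 0) q ksymbol \<zeta>"
proof -
  let ?l = "\<lambda>_::nat. 0::nat"
  let ?M = "lebesgue_on_coords {1..n}"
  let ?g = "\<lambda>t. indicator (par ?l) t *\<^sub>R kern q ksymbol \<zeta> (fp ?l t)"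
  let ?h = "\<lambda>t. indicator Q t *\<^sub>R kern q ksymbol \<zeta> t"
  have fc: "free_coords n ?l = {1..n}" by (auto simp: free_coords_def)
  have fin: "fin_face ?l" by (simp add: face_finite_def)
  have "AE t in coords_borel {1..n}. \<forall>k\<in>{1..n}. t k \<noteq> real_of_ereal (a k) \<and> t k \<noteq> real_of_ereal (b k)"
    by (intro AE_finite_allI AE_conjI AE_coords_neq) auto
  then have "AE t in coords_borel {1..n}. ?h t = ?g t"
    using AE_space
  proof eventually_elim
    case (elim t)
    have t: "t \<in> Rn n" using elim(2) by (simp add: space_PiM)
    have "t \<in> Q \<longleftrightarrow> t \<in> par ?l"
    proof
      assume tQ: "t \<in> Q"
      have "a k < ereal (t k) \<and> ereal (t k) < b k" if k: "k \<in> {1..n}" for k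
      proof -
        have "a k \<noteq> ereal (t k)" "b k \<noteq> ereal (t k)" using bspec[OF elim(1) k] by auto
        moreover have "a k \<le> ereal (t k)" "ereal (t k) \<le> b k" using tQ k by (auto simp: box_Q_def)
        ultimately show ?thesis by (auto simp: order_less_le)
      qed
      then show "t \<in> par ?l" using t by (simp add: face_params_def fc)
    next
      assume "t \<in> par ?l"
      then show "t \<in> Q" using par_zero_subset[of ?l] by auto
    qed
    moreover have "fp ?l t = t" by (rule fp_zero[OF _ t]) simp
    ultimately show ?case by (simp add: indicator_def)
  qed
  note ae = this
  have int: "integrable ?M ?g"
    using integrable_face[OF valid_box[OF q] fin vsymbol_ksymbol, of \<zeta>] unfolding fc .
  then have mg: "?g \<in> borel_measurable ?M" by auto
  then have mh: "?h \<in> borel_measurable ?M"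
    unfolding lebesgue_on_coords_def by (rule borel_measurable_completion_cong_AE[OF _ ae])
  have "transform \<kappa> r n e (restrict_Q n a b (pd q)) p \<zeta> = (\<integral>t. ?h t \<partial>?M)"
    unfolding transform_def restrict_Q_def exp_kernel kern_def cd_mult_scaleR_left cd_mult_scaleR_right
    by (simp only: scaleR_left_commute)
  also have "\<dots> = (\<integral>t. ?g t \<partial>?M)"
    by (rule integral_cong_AE[OF mh mg]) (simp only: AE_lebesgue_on_coords ae)
  also have "\<dots> = G ?l q ksymbol \<zeta>" using fin by (simp only: G_def fc if_True)
  finally show ?thesis .
qed

text \<open>\<open>S_op\<close> uses \<open>vector_derivative\<close>, which is additive on
  differentiable functions only. The linear span of the functions \<open>G l q \<Psi>\<close> is
  differentiable in the imaginary directions and stable under R_k, so powers and products of the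
  operators are linear on it.\<close>

inductive tame :: "('a \<Rightarrow> 'a) \<Rightarrow> bool" where
  zero: "tame (\<lambda>_. 0)"
| base: "valid l q \<Longrightarrow> vsymbol \<Psi> \<Longrightarrow> tame (G l q \<Psi>)"
| add: "tame F \<Longrightarrow> tame H \<Longrightarrow> tame (\<lambda>\<zeta>. F \<zeta> + H \<zeta>)"
| scale: "tame F \<Longrightarrow> tame (\<lambda>\<zeta>. c *\<^sub>R F \<zeta>)"

lemma tame_differentiable:
  assumes "tame F" "m < 2 ^ r" "m \<noteq> 0"
  shows "(\<lambda>x. F (\<zeta> + x *\<^sub>R e m)) differentiable (at (0::real))"
  using assms(1)
proof induction
  case (base l q \<Psi>)
  show ?case by (rule differentiableI_vector[OF G_derivative[OF base assms(2,3)]])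
qed (auto intro: derivative_intros)

lemma S_op_add:
  assumes "tame F" "tame H" "m < 2 ^ r" "m \<noteq> 0"
  shows "S_op e m (\<lambda>\<zeta>. F \<zeta> + H \<zeta>) \<zeta> = S_op e m F \<zeta> + S_op e m H \<zeta>"
  using tame_differentiable[OF assms(1,3,4), of \<zeta>] tame_differentiable[OF assms(2-4), of \<zeta>]
  by (simp add: S_op_def)

lemma S_op_scale:
  assumes "tame F" "m < 2 ^ r" "m \<noteq> 0"
  shows "S_op e m (\<lambda>\<zeta>. c *\<^sub>R F \<zeta>) \<zeta> = c *\<^sub>R S_op e m F \<zeta>"
proof -
  have "((\<lambda>x. F (\<zeta> + x *\<^sub>R e m)) has_vector_derivative vector_derivative (\<lambda>x. F (\<zeta> + x *\<^sub>R e m)) (at 0)) (at 0)"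
    using tame_differentiable[OF assms, of \<zeta>] by (simp add: vector_derivative_works)
  from bounded_linear.has_vector_derivative[OF bounded_linear_scaleR_right this, of c]
  show ?thesis by (simp add: S_op_def vector_derivative_at)
qed

definition tame_linear :: "(('a \<Rightarrow> 'a) \<Rightarrow> 'a \<Rightarrow> 'a) \<Rightarrow> bool" where
  "tame_linear L \<longleftrightarrow> (\<forall>F. tame F \<longrightarrow> tame (L F)) \<and>
     (\<forall>F H. tame F \<longrightarrow> tame H \<longrightarrow> L (\<lambda>\<zeta>. F \<zeta> + H \<zeta>) = (\<lambda>\<zeta>. L F \<zeta> + L H \<zeta>)) \<and>
     (\<forall>c F. tame F \<longrightarrow> L (\<lambda>\<zeta>. c *\<^sub>R F \<zeta>) = (\<lambda>\<zeta>. c *\<^sub>R L F \<zeta>))"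

lemma tame_linearD: "tame_linear L \<Longrightarrow> tame F \<Longrightarrow> tame (L F)"
  by (simp add: tame_linear_def)

text \<open>On a generator R_k just changes the symbol, by \<open>R_op_G\<close>; linearity carries
  stability to the span.\<close>

lemma tame_linear_R_op:
  assumes k: "k \<in> {1..n}"
  shows "tame_linear (R_op \<kappa> e p k)"
proof -
  have m: "m < 2 ^ r" "m \<noteq> 0" if "m \<in> idx k" for m using idx_bounds[OF k that] by auto
  have add: "R_op \<kappa> e p k (\<lambda>\<zeta>. F \<zeta> + H \<zeta>) = (\<lambda>\<zeta>. R_op \<kappa> e p k F \<zeta> + R_op \<kappa> e p k H \<zeta>)"
    if "tame F" "tame H" for F H
  proof
    fix \<zeta>
    have "(\<Sum>m\<in>idx k. (p \<bullet> e m) *\<^sub>R S_op e m (\<lambda>\<zeta>. F \<zeta> + H \<zeta>) \<zeta>) =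
        (\<Sum>m\<in>idx k. (p \<bullet> e m) *\<^sub>R S_op e m F \<zeta> + (p \<bullet> e m) *\<^sub>R S_op e m H \<zeta>)"
      by (intro sum.cong refl) (simp add: S_op_add[OF that m] scaleR_add_right)
    then show "R_op \<kappa> e p k (\<lambda>\<zeta>. F \<zeta> + H \<zeta>) \<zeta> = R_op \<kappa> e p k F \<zeta> + R_op \<kappa> e p k H \<zeta>"
      unfolding R_op_eq by (simp add: sum.distrib scaleR_add_right)
  qed
  have scale: "R_op \<kappa> e p k (\<lambda>\<zeta>. c *\<^sub>R F \<zeta>) = (\<lambda>\<zeta>. c *\<^sub>R R_op \<kappa> e p k F \<zeta>)" if "tame F" for c F
  proof
    fix \<zeta>
    have "(\<Sum>m\<in>idx k. (p \<bullet> e m) *\<^sub>R S_op e m (\<lambda>\<zeta>. c *\<^sub>R F \<zeta>) \<zeta>) =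
        c *\<^sub>R (\<Sum>m\<in>idx k. (p \<bullet> e m) *\<^sub>R S_op e m F \<zeta>)"
      unfolding scaleR_sum_right
      by (intro sum.cong refl) (simp add: S_op_scale[OF that m] mult.commute)
    then show "R_op \<kappa> e p k (\<lambda>\<zeta>. c *\<^sub>R F \<zeta>) \<zeta> = c *\<^sub>R R_op \<kappa> e p k F \<zeta>"
      unfolding R_op_eq by (simp add: scaleR_add_right mult.commute)
  qed
  have "tame (R_op \<kappa> e p k F)" if "tame F" for F
    using that
  proof induction
    case zero
    have "R_op \<kappa> e p k (\<lambda>\<zeta>. 0) = (\<lambda>\<zeta>. 0)"
      using scale[OF tame.zero, of 0] by simp
    then show ?case by (simp add: tame.zero)
  next
    case (base l q \<Psi>)
    then show ?case by (simp add: R_op_G[OF base k] tame.base vsymbol_R_symbol)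
  next
    case (add F H)
    then show ?case by (simp add: \<open>\<And>H F. tame F \<Longrightarrow> tame H \<Longrightarrow> _\<close> tame.add)
  next
    case (scale F c)
    then show ?case by (simp add: \<open>\<And>F c. tame F \<Longrightarrow> _ = (\<lambda>\<zeta>. c *\<^sub>R _ \<zeta>)\<close> tame.scale)
  qed
  with add scale show ?thesis by (simp add: tame_linear_def)
qed

lemma tame_linear_id: "tame_linear (\<lambda>F. F)"
  by (simp add: tame_linear_def)

lemma tame_linear_comp: "tame_linear L \<Longrightarrow> tame_linear L' \<Longrightarrow> tame_linear (\<lambda>F. L (L' F))"
  by (simp add: tame_linear_def)

lemma tame_linear_funpow: "tame_linear L \<Longrightarrow> tame_linear (L ^^ m)"
proof (induction m)
  case 0
  then show ?case using tame_linear_id by (simp add: id_def)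
next
  case (Suc m)
  then show ?case using tame_linear_comp[of L "L ^^ m"] by (simp add: o_def)
qed

lemma tame_linear_foldr:
  assumes "set ks \<subseteq> {1..n}"
  shows "tame_linear (foldr (\<lambda>k. R_op \<kappa> e p k ^^ m k) ks)"
  using assms
proof (induction ks)
  case Nil
  then show ?case using tame_linear_id by (simp add: id_def)
next
  case (Cons k ks)
  have "tame_linear (R_op \<kappa> e p k ^^ m k)"
    by (rule tame_linear_funpow, rule tame_linear_R_op) (use Cons.prems in simp)
  moreover have "tame_linear (foldr (\<lambda>k. R_op \<kappa> e p k ^^ m k) ks)"
    using Cons by simp
  ultimately show ?case unfolding foldr.simps o_def by (rule tame_linear_comp)
qed

lemma tame_linear_zero:
  assumes "tame_linear L"
  shows "L (\<lambda>_. 0) = (\<lambda>_. 0)"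
proof -
  have "L (\<lambda>\<zeta>. 0 *\<^sub>R 0) = (\<lambda>\<zeta>. 0 *\<^sub>R L (\<lambda>_. 0) \<zeta>)"
    using assms tame.zero unfolding tame_linear_def by blast
  then show ?thesis by simp
qed

lemma tame_sum: "(\<And>i. i \<in> A \<Longrightarrow> tame (F i)) \<Longrightarrow> tame (\<lambda>\<zeta>. \<Sum>i\<in>A. c i *\<^sub>R F i \<zeta>)"
proof (induction A rule: infinite_finite_induct)
  case (insert i A)
  then have "tame (\<lambda>\<zeta>. c i *\<^sub>R F i \<zeta> + (\<Sum>i\<in>A. c i *\<^sub>R F i \<zeta>))"
    by (intro tame.add[OF tame.scale]) auto
  then show ?case using insert.hyps by simp
qed (simp_all add: tame.zero)

lemma tame_linear_sum:
  assumes L: "tame_linear L" and "\<And>i. i \<in> A \<Longrightarrow> tame (F i)"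
  shows "L (\<lambda>\<zeta>. \<Sum>i\<in>A. c i *\<^sub>R F i \<zeta>) = (\<lambda>\<zeta>. \<Sum>i\<in>A. c i *\<^sub>R L (F i) \<zeta>)"
  using assms(2)
proof (induction A rule: infinite_finite_induct)
  case (insert i A)
  have "L (\<lambda>\<zeta>. \<Sum>i\<in>insert i A. c i *\<^sub>R F i \<zeta>) = L (\<lambda>\<zeta>. c i *\<^sub>R F i \<zeta> + (\<Sum>i\<in>A. c i *\<^sub>R F i \<zeta>))"
    using insert by simp
  also have "\<dots> = (\<lambda>\<zeta>. L (\<lambda>\<zeta>. c i *\<^sub>R F i \<zeta>) \<zeta> + L (\<lambda>\<zeta>. \<Sum>i\<in>A. c i *\<^sub>R F i \<zeta>) \<zeta>)"
    using L insert.prems tame_sum[of A F c] tame.scale[of "F i" "c i"]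
    unfolding tame_linear_def by auto
  also have "L (\<lambda>\<zeta>. c i *\<^sub>R F i \<zeta>) = (\<lambda>\<zeta>. c i *\<^sub>R L (F i) \<zeta>)"
    using L insert.prems unfolding tame_linear_def by auto
  finally show ?case using insert by simp
qed (simp_all add: tame_linear_zero[OF L])

abbreviation "T l q \<equiv> G l q ksymbol"

text \<open>One variable: the order \<open>q k\<close> of the derivative is lowered step by step. The face reached after
  \<open>q k - i\<close> steps carries the derivative of order \<open>i\<close>.\<close>

lemma expand_coord:
  assumes k: "k \<in> {1..n}" and lk: "l k = 0"
    and v: "\<And>i. i \<le> N \<Longrightarrow> valid l (q(k := i))"
    and vs: "\<And>i s. i < N \<Longrightarrow> s \<in> {1, 2} \<Longrightarrow> valid (l(k := s)) (q(k := i))"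
  shows "T l (q(k := N)) = (\<lambda>\<zeta>. (R_op \<kappa> e p k ^^ N) (T l (q(k := 0))) \<zeta> +
    (\<Sum>(i, s)\<in>{..<N} \<times> {1, 2}. (-1) ^ s *\<^sub>R (R_op \<kappa> e p k ^^ (N - 1 - i)) (T (l(k := s)) (q(k := i))) \<zeta>))"
  using v vs
proof (induction N)
  case (Suc N)
  note prems = Suc.prems
  let ?R = "R_op \<kappa> e p k"
  let ?t = "\<lambda>x. T (l(k := snd x)) (q(k := fst x))"
  let ?P = "\<lambda>x. (?R ^^ (N - 1 - fst x)) (?t x)"
  let ?I = "{..<N} \<times> {1, 2 :: nat}"
  have lin: "tame_linear ?R" by (rule tame_linear_R_op[OF k])
  have tame_P: "tame (?P x)" if "x \<in> ?I" for x
  proof -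
    have "valid (l(k := snd x)) (q(k := fst x))" by (rule Suc.prems(2)) (use that in auto)
    then show ?thesis by (rule tame_linearD[OF tame_linear_funpow[OF lin] tame.base[OF _ vsymbol_ksymbol]])
  qed
  have "valid l (q(k := 0))" by (rule Suc.prems(1)) simp
  then have tame_0: "tame ((?R ^^ N) (T l (q(k := 0))))"
    by (rule tame_linearD[OF tame_linear_funpow[OF lin] tame.base[OF _ vsymbol_ksymbol]])
  have IH: "T l (q(k := N)) = (\<lambda>\<zeta>. (?R ^^ N) (T l (q(k := 0))) \<zeta> +
      (\<Sum>x\<in>?I. (-1) ^ snd x *\<^sub>R ?P x \<zeta>))"
    by (rule Suc.IH[unfolded case_prod_beta', OF Suc.prems(1) Suc.prems(2)]) simp_all
  have "?R (T l (q(k := N))) = (\<lambda>\<zeta>. ?R ((?R ^^ N) (T l (q(k := 0)))) \<zeta> +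
      ?R (\<lambda>\<zeta>. \<Sum>x\<in>?I. (-1) ^ snd x *\<^sub>R ?P x \<zeta>) \<zeta>)"
    unfolding IH
    by (rule lin[unfolded tame_linear_def, THEN conjunct2, THEN conjunct1, rule_format, OF tame_0 tame_sum[OF tame_P]])
  also have "?R (\<lambda>\<zeta>. \<Sum>x\<in>?I. (-1) ^ snd x *\<^sub>R ?P x \<zeta>) = (\<lambda>\<zeta>. \<Sum>x\<in>?I. (-1) ^ snd x *\<^sub>R ?R (?P x) \<zeta>)"
    by (rule tame_linear_sum[OF lin tame_P])
  finally have "?R (T l (q(k := N))) = (\<lambda>\<zeta>. ?R ((?R ^^ N) (T l (q(k := 0)))) \<zeta> +
      (\<Sum>x\<in>?I. (-1) ^ snd x *\<^sub>R ?R (?P x) \<zeta>))" .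
  then have RT: "?R (T l (q(k := N))) \<zeta> = ?R ((?R ^^ N) (T l (q(k := 0)))) \<zeta> +
      (\<Sum>x\<in>?I. (-1) ^ snd x *\<^sub>R ?R (?P x) \<zeta>)" for \<zeta> by (rule fun_cong)
  have shift: "?R (?P x) = (?R ^^ (N - fst x)) (?t x)" if "x \<in> ?I" for x
  proof -
    \<comment> \<open>Since \<open>fst x\<close> < N, no subtraction is truncated.\<close>
    have "N - fst x = Suc (N - 1 - fst x)" using that by auto
    then show ?thesis by (simp only: funpow.simps o_apply)
  qed
  have "T l ((q(k := N))(k := Suc ((q(k := N)) k))) \<zeta> =
      G l (q(k := N)) (R_symbol k ksymbol) \<zeta> + T (l(k := 2)) (q(k := N)) \<zeta> - T (l(k := 1)) (q(k := N)) \<zeta>" for \<zeta>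
  proof (rule G_integration_by_parts[where k = k and l = l, OF k lk _ _ _ _ vsymbol_ksymbol])
    show "valid l (q(k := N))" by (rule Suc.prems(1)) simp
    have "valid l (q(k := Suc N))" by (rule Suc.prems(1)) simp
    then show "valid l ((q(k := N))(k := Suc ((q(k := N)) k)))" by (simp only: fun_upd_upd fun_upd_same)
    show "valid (l(k := 1)) (q(k := N))" "valid (l(k := 2)) (q(k := N))" by (rule Suc.prems(2); simp)+
  qed
  moreover have "G l (q(k := N)) (R_symbol k ksymbol) = ?R (T l (q(k := N)))"
    by (rule R_op_G[OF Suc.prems(1) vsymbol_ksymbol k, symmetric]) simp
  ultimately have ibp: "T l (q(k := Suc N)) \<zeta> =
      ?R (T l (q(k := N))) \<zeta> + (T (l(k := 2)) (q(k := N)) \<zeta> - T (l(k := 1)) (q(k := N)) \<zeta>)" for \<zeta>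
    by (simp only: fun_upd_upd fun_upd_same add_diff_eq)
  show ?case
    unfolding case_prod_beta'
  proof
    fix \<zeta>
    let ?g = "\<lambda>x. (-1) ^ snd x *\<^sub>R (?R ^^ (Suc N - 1 - fst x)) (?t x) \<zeta>"
    \<comment> \<open>The last integration by parts adds the two faces of order N, on which no R_k
      acts; every earlier face gains one R_k. The sign \<open>(-1) ^ s\<close> is - at the lower end
      and + at the upper end.\<close>
    have I: "{..<Suc N} \<times> {1, 2 :: nat} = ?I \<union> {(N, 1), (N, 2)}" by auto
    have "sum ?g ({..<Suc N} \<times> {1, 2}) = sum ?g ?I + sum ?g {(N, 1), (N, 2)}"
      unfolding I by (rule sum.union_disjoint) auto
    also have "sum ?g {(N, 1), (N, 2)} = T (l(k := 2)) (q(k := N)) \<zeta> - T (l(k := 1)) (q(k := N)) \<zeta>"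
      by simp
    also have "sum ?g ?I = (\<Sum>x\<in>?I. (-1) ^ snd x *\<^sub>R ?R (?P x) \<zeta>)"
      by (rule sum.cong[OF refl]) (simp only: shift diff_Suc_1)
    finally show "T l (q(k := Suc N)) \<zeta> = (?R ^^ Suc N) (T l (q(k := 0))) \<zeta> + sum ?g ({..<Suc N} \<times> {1, 2})"
      unfolding ibp RT funpow.simps o_apply by (simp only: add.assoc)
  qed
qed simp

text \<open>A choice \<open>(s, m, i)\<close> for the variable \<open>k\<close> consists of the entry \<open>s\<close> of \<open>(l)\<close>, the exponent \<open>m\<close>
  of \<open>R\<^sub>k\<close> and the order \<open>i\<close> of the derivative on the face.\<close>

definition choices :: "nat \<Rightarrow> (nat \<times> nat \<times> nat) set" where
  "choices k = insert (0, j k, 0) ((\<lambda>(i, s). (s, j k - 1 - i, i)) ` ({..<j k} \<times> {1, 2}))"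

lemma choices_iff:
  "(s, m, i) \<in> choices k \<longleftrightarrow> s \<le> 2 \<and> (s = 0 \<longrightarrow> m = j k \<and> i = 0) \<and> (s \<noteq> 0 \<longrightarrow> m + i + 1 = j k)"
proof
  assume "s \<le> 2 \<and> (s = 0 \<longrightarrow> m = j k \<and> i = 0) \<and> (s \<noteq> 0 \<longrightarrow> m + i + 1 = j k)"
  then consider "s = 0" "m = j k" "i = 0" | "s \<in> {1, 2}" "m + i + 1 = j k" by force
  then show "(s, m, i) \<in> choices k"
  proof cases
    case 2
    then have "(s, m, i) = (\<lambda>(i, s). (s, j k - 1 - i, i)) (i, s)" "(i, s) \<in> {..<j k} \<times> {1, 2}" by auto
    then show ?thesis unfolding choices_def by blast
  qed (simp add: choices_def)
qed (auto simp: choices_def)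

lemma choicesD:
  assumes "x \<in> choices k"
  shows "fst x \<le> 2 \<and> (fst x = 0 \<longrightarrow> fst (snd x) = j k \<and> snd (snd x) = 0) \<and>
    (fst x \<noteq> 0 \<longrightarrow> fst (snd x) + snd (snd x) + 1 = j k)"
  using assms by (cases x) (simp add: choices_iff)

lemma finite_choices [simp]: "finite (choices k)"
  by (simp add: choices_def)

lemma expand_choices:
  assumes k: "k \<in> {1..n}" and lk: "l k = 0" and qk: "q k = j k"
    and v: "\<And>s m i. (s, m, i) \<in> choices k \<Longrightarrow> valid (l(k := s)) (q(k := i))" "valid l q"
    and v0: "\<And>i. i \<le> j k \<Longrightarrow> valid l (q(k := i))"
  shows "T l q \<zeta> = (\<Sum>x\<in>choices k. (-1) ^ fst x *\<^sub>R
    (R_op \<kappa> e p k ^^ fst (snd x)) (T (l(k := fst x)) (q(k := snd (snd x)))) \<zeta>)"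
proof -
  let ?f = "\<lambda>x. (-1) ^ fst x *\<^sub>R (R_op \<kappa> e p k ^^ fst (snd x)) (T (l(k := fst x)) (q(k := snd (snd x)))) \<zeta>"
  let ?c = "\<lambda>(i, s). (s, j k - 1 - i, i)"
  let ?I = "{..<j k} \<times> {1, 2 :: nat}"
  let ?g = "\<lambda>(i, s). (-1) ^ s *\<^sub>R (R_op \<kappa> e p k ^^ (j k - 1 - i)) (T (l(k := s)) (q(k := i))) \<zeta>"
  have l0: "l(k := 0) = l" using lk by auto
  have vs: "valid (l(k := s)) (q(k := i))" if "i < j k" "s \<in> {1, 2}" for i s
    by (rule v(1)[of _ "j k - 1 - i"]) (use that in \<open>auto simp: choices_iff\<close>)
  have E: "T l (q(k := j k)) = (\<lambda>\<zeta>. (R_op \<kappa> e p k ^^ j k) (T l (q(k := 0))) \<zeta> +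
    (\<Sum>(i, s)\<in>?I. (-1) ^ s *\<^sub>R (R_op \<kappa> e p k ^^ (j k - 1 - i)) (T (l(k := s)) (q(k := i))) \<zeta>))"
    by (rule expand_coord[where l = l and k = k, OF k lk v0 vs])
  have "q(k := j k) = q" by (simp add: qk[symmetric])
  then have "T l q \<zeta> = (R_op \<kappa> e p k ^^ j k) (T l (q(k := 0))) \<zeta> + sum ?g ?I"
    using fun_cong[OF E, of \<zeta>] by simp
  also have "sum ?g ?I = (\<Sum>y\<in>?I. ?f (?c y))"
    by (rule sum.cong) auto
  also have "\<dots> = (\<Sum>x\<in>?c ` ?I. ?f x)"
    by (subst sum.reindex) (auto simp: inj_on_def)
  also have "(R_op \<kappa> e p k ^^ j k) (T l (q(k := 0))) \<zeta> + \<dots> = (\<Sum>x\<in>choices k. ?f x)"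
  proof -
    have fresh: "finite (?c ` ?I)" "(0, j k, 0) \<notin> ?c ` ?I" by auto
    show ?thesis
      unfolding choices_def sum.insert[OF fresh] by (simp only: fst_conv snd_conv l0 power_0 scaleR_one)
  qed
  finally show ?thesis .
qed

definition override :: "nat \<Rightarrow> (nat \<Rightarrow> nat) \<Rightarrow> (nat \<Rightarrow> nat) \<Rightarrow> nat \<Rightarrow> nat" where
  "override k g h = (\<lambda>i. if i \<in> {k..n} then g i else h i)"

text \<open>The induction runs downwards from k = n + 1: coordinates below k are already expanded,
  those from k on are untouched. Expanding t_k before the later ones places R_k outside R_{k+1},
  ..., R_n. The condition on i < k is what an expanded coordinate satisfies, and it yields
  \<open>valid\<close> at each stage.\<close>

lemma expand_all:
  assumes "k \<le> Suc n" "1 \<le> k"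
    and "ternary l" "le_j q" "\<And>i. i \<in> {1..<k} \<Longrightarrow> (l i \<noteq> 0 \<longrightarrow> q i < j i) \<and> (q i = 0 \<or> q i < j i)"
    and "\<And>i. i \<in> {k..n} \<Longrightarrow> l i = 0 \<and> q i = j i"
  shows "T l q \<zeta> = (\<Sum>c\<in>Pi\<^sub>E {k..n} choices. (-1) ^ (\<Sum>i=k..n. fst (c i)) *\<^sub>R
    foldr (\<lambda>i. R_op \<kappa> e p i ^^ fst (snd (c i))) [k..<Suc n]
      (T (override k (\<lambda>i. fst (c i)) l) (override k (\<lambda>i. snd (snd (c i))) q)) \<zeta>)"
  using assms
proof (induction k arbitrary: l q \<zeta> rule: inc_induct)
  case base
  then show ?case by (simp add: override_def)
next
  case (step k)
  let ?S = "Pi\<^sub>E {Suc k..n} choices"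
  let ?op = "\<lambda>c. foldr (\<lambda>i. R_op \<kappa> e p i ^^ fst (snd (c i))) [Suc k..<Suc n]"
  let ?T = "\<lambda>l q c. T (override (Suc k) (\<lambda>i. fst (c i)) l) (override (Suc k) (\<lambda>i. snd (snd (c i))) q)"
  have k: "k \<in> {1..n}" using step.hyps step.prems by auto
  have lk: "l k = 0" "q k = j k" using step.prems(5)[of k] k by auto
  have kn: "{k..n} = insert k {Suc k..n}" using k by auto
  have low: "l i \<noteq> 0 \<Longrightarrow> i \<in> {1..n} \<Longrightarrow> i < k" for i
    using step.prems(5)[of i] by (cases "i < k") auto
  have v0: "valid l (q(k := i))" if "i \<le> j k" for i
    unfolding valid_def
  proof (intro conjI ballI impI)
    show "ternary l" by (rule step.prems(2))
    show "le_j (q(k := i))" using step.prems(3) that by (auto simp: le_j_def)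
    fix m assume m: "m \<in> {1..n}" "l m \<noteq> 0"
    then have mk: "m < k" by (intro low)
    show "(q(k := i)) m < j m" using step.prems(4)[of m] m mk by auto
    fix m' assume "m' \<in> {1..<m}"
    then show "(q(k := i)) m' = 0 \<or> (q(k := i)) m' < j m'"
      using step.prems(4)[of m'] mk by auto
  qed
  have vc: "valid (l(k := s)) (q(k := i))" if "(s, m, i) \<in> choices k" for s m i
  proof -
    have si: "s \<le> 2" "s \<noteq> 0 \<Longrightarrow> i < j k" "i \<le> j k" using that by (auto simp: choices_iff)
    show ?thesis
      unfolding valid_def
    proof (intro conjI ballI impI)
      show "ternary (l(k := s))" using step.prems(2) si by (auto simp: ternary_def)
      show "le_j (q(k := i))" using step.prems(3) si by (auto simp: le_j_def)
      fix m assume m: "m \<in> {1..n}" "(l(k := s)) m \<noteq> 0"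
      show "(q(k := i)) m < j m"
        using m si step.prems(4)[of m] low[of m] by (cases "m = k") auto
      fix m' assume "m' \<in> {1..<m}"
      moreover have "m \<le> k" using m low[of m] by (cases "m = k") auto
      ultimately show "(q(k := i)) m' = 0 \<or> (q(k := i)) m' < j m'"
        using step.prems(4)[of m'] by auto
    qed
  qed
  \<comment> \<open>All inner terms lie in the span, so the power of R_k may be distributed over the
    inner sum.\<close>
  have valid_T: "tame (?T (l(k := fst x)) (q(k := snd (snd x))) c)"
    if x: "x \<in> choices k" and c: "c \<in> ?S" for x c
  proof (rule tame.base[OF _ vsymbol_ksymbol])
    obtain s m i where xe: "x = (s, m, i)" by (cases x) auto
    have ci: "fst (c u) \<le> 2" "fst (c u) \<noteq> 0 \<Longrightarrow> snd (snd (c u)) < j u" "snd (snd (c u)) = 0 \<or> snd (snd (c u)) < j u"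
      if "u \<in> {Suc k..n}" for u
      using choicesD[OF PiE_mem[OF c that]] by auto
    have si: "s \<le> 2" "s \<noteq> 0 \<Longrightarrow> i < j k" "i = 0 \<or> i < j k"
      using x unfolding xe choices_iff by auto
    let ?l = "override (Suc k) (\<lambda>i. fst (c i)) (l(k := s))"
    let ?q = "override (Suc k) (\<lambda>i. snd (snd (c i))) (q(k := i))"
    have all: "?l u \<le> 2" "?l u \<noteq> 0 \<Longrightarrow> ?q u < j u" "?q u = 0 \<or> ?q u < j u" if u: "u \<in> {1..n}" for u
    proof -
      consider "u < k" | "u = k" | "u \<in> {Suc k..n}" using u by force
      then have "?l u \<le> 2 \<and> (?l u \<noteq> 0 \<longrightarrow> ?q u < j u) \<and> (?q u = 0 \<or> ?q u < j u)"
      proof cases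
        case 1
        then show ?thesis using step.prems(2) step.prems(4)[of u] u by (auto simp: override_def ternary_def)
      next
        case 2
        then show ?thesis using si by (auto simp: override_def)
      next
        case 3
        then show ?thesis using ci[OF 3] by (auto simp: override_def)
      qed
      then show "?l u \<le> 2" "?l u \<noteq> 0 \<Longrightarrow> ?q u < j u" "?q u = 0 \<or> ?q u < j u" by auto
    qed
    show "valid (override (Suc k) (\<lambda>i. fst (c i)) (l(k := fst x))) (override (Suc k) (\<lambda>i. snd (snd (c i))) (q(k := snd (snd x))))"
      unfolding xe fst_conv snd_conv valid_def
    proof (intro conjI ballI impI)
      show "ternary ?l" using all(1) by (auto simp: ternary_def)
      show "le_j ?q" unfolding le_j_def using all(3) by (metis less_imp_le le0)
      show "?q u < j u" if "u \<in> {1..n}" "?l u \<noteq> 0" for u using all(2) that by blast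
      show "?q u' = 0 \<or> ?q u' < j u'" if "u \<in> {1..n}" "u' \<in> {1..<u}" for u u' using all(3)[of u'] that by auto
    qed
  qed
  have IH: "T (l(k := fst x)) (q(k := snd (snd x))) =
      (\<lambda>\<zeta>. \<Sum>c\<in>?S. (-1) ^ (\<Sum>i=Suc k..n. fst (c i)) *\<^sub>R ?op c (?T (l(k := fst x)) (q(k := snd (snd x))) c) \<zeta>)"
    if x: "x \<in> choices k" for x
  proof
    fix \<zeta>
    obtain s m i where xe: "x = (s, m, i)" by (cases x) auto
    have si: "s \<le> 2" "s \<noteq> 0 \<Longrightarrow> i < j k" "i = 0 \<or> i < j k"
      using x unfolding xe choices_iff by auto
    show "T (l(k := fst x)) (q(k := snd (snd x))) \<zeta> =
      (\<Sum>c\<in>?S. (-1) ^ (\<Sum>i=Suc k..n. fst (c i)) *\<^sub>R ?op c (?T (l(k := fst x)) (q(k := snd (snd x))) c) \<zeta>)"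
    proof (rule step.IH)
      show "ternary (l(k := fst x))" "le_j (q(k := snd (snd x)))"
        using vc[of s m i] x unfolding xe by (simp_all add: valid_def)
      show "((l(k := fst x)) u \<noteq> 0 \<longrightarrow> (q(k := snd (snd x))) u < j u) \<and>
          ((q(k := snd (snd x))) u = 0 \<or> (q(k := snd (snd x))) u < j u)" if "u \<in> {1..<Suc k}" for u
        using step.prems(4)[of u] that si unfolding xe by (cases "u = k") auto
      show "(l(k := fst x)) u = 0 \<and> (q(k := snd (snd x))) u = j u" if "u \<in> {Suc k..n}" for u
        using step.prems(5)[of u] that by auto
    qed simp
  qed
  let ?A = "\<lambda>x c. (-1) ^ fst x *\<^sub>R (-1) ^ (\<Sum>i=Suc k..n. fst (c i)) *\<^sub>R
      (R_op \<kappa> e p k ^^ fst (snd x)) (?op c (?T (l(k := fst x)) (q(k := snd (snd x))) c)) \<zeta>"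
  let ?B = "\<lambda>c. (-1) ^ (\<Sum>i=k..n. fst (c i)) *\<^sub>R
    foldr (\<lambda>i. R_op \<kappa> e p i ^^ fst (snd (c i))) [k..<Suc n]
      (T (override k (\<lambda>i. fst (c i)) l) (override k (\<lambda>i. snd (snd (c i))) q)) \<zeta>"
  have "T l q \<zeta> = (\<Sum>x\<in>choices k. (-1) ^ fst x *\<^sub>R
    (R_op \<kappa> e p k ^^ fst (snd x)) (T (l(k := fst x)) (q(k := snd (snd x)))) \<zeta>)"
    by (rule expand_choices[where k = k and l = l and q = q, OF k lk vc _ v0]) (use v0[of "j k"] lk(2) in \<open>auto simp: fun_upd_idem\<close>)
  also have "\<dots> = (\<Sum>x\<in>choices k. \<Sum>c\<in>?S. (-1) ^ fst x *\<^sub>R (-1) ^ (\<Sum>i=Suc k..n. fst (c i)) *\<^sub>R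
      (R_op \<kappa> e p k ^^ fst (snd x)) (?op c (?T (l(k := fst x)) (q(k := snd (snd x))) c)) \<zeta>)"
  proof (rule sum.cong[OF refl])
    fix x assume x: "x \<in> choices k"
    have tame_op: "tame (?op c (?T (l(k := fst x)) (q(k := snd (snd x))) c))" if "c \<in> ?S" for c
    proof -
      have "tame_linear (?op c)" by (rule tame_linear_foldr) (use k in auto)
      then show ?thesis using valid_T[OF x that] by (simp add: tame_linear_def)
    qed
    have L_sum: "(R_op \<kappa> e p k ^^ fst (snd x)) (\<lambda>\<zeta>. \<Sum>c\<in>?S. (-1) ^ (\<Sum>i=Suc k..n. fst (c i)) *\<^sub>R
        ?op c (?T (l(k := fst x)) (q(k := snd (snd x))) c) \<zeta>) =
      (\<lambda>\<zeta>. \<Sum>c\<in>?S. (-1) ^ (\<Sum>i=Suc k..n. fst (c i)) *\<^sub>R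
        (R_op \<kappa> e p k ^^ fst (snd x)) (?op c (?T (l(k := fst x)) (q(k := snd (snd x))) c)) \<zeta>)"
      by (rule tame_linear_sum[OF tame_linear_funpow[OF tame_linear_R_op[OF k]] tame_op])
    show "(-1) ^ fst x *\<^sub>R (R_op \<kappa> e p k ^^ fst (snd x)) (T (l(k := fst x)) (q(k := snd (snd x)))) \<zeta> =
      (\<Sum>c\<in>?S. (-1) ^ fst x *\<^sub>R (-1) ^ (\<Sum>i=Suc k..n. fst (c i)) *\<^sub>R
      (R_op \<kappa> e p k ^^ fst (snd x)) (?op c (?T (l(k := fst x)) (q(k := snd (snd x))) c)) \<zeta>)"
      unfolding IH[OF x] L_sum scaleR_sum_right ..
  qed
  also have "\<dots> = (\<Sum>(x, c)\<in>choices k \<times> ?S. ?A x c)"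
    by (rule sum.cartesian_product)
  \<comment> \<open>Choices for k, ..., n are a choice x for k joined with choices g for k + 1, ...,
    n; exponents of the sign add up.\<close>
  also have "\<dots> = (\<Sum>(x, g)\<in>choices k \<times> ?S. ?B (g(k := x)))"
  proof (rule sum.cong[OF refl])
    fix y assume "y \<in> choices k \<times> ?S"
    obtain s m i g where y: "y = ((s, m, i), g)" by (cases y) auto
    let ?c = "g(k := (s, m, i))"
    have 1: "(\<Sum>i=k..n. fst (?c i)) = s + (\<Sum>i=Suc k..n. fst (g i))"
      unfolding kn by (subst sum.insert) (auto intro!: sum.cong)
    have 2: "override k (\<lambda>i. fst (?c i)) l = override (Suc k) (\<lambda>i. fst (g i)) (l(k := s))"
      "override k (\<lambda>i. snd (snd (?c i))) q = override (Suc k) (\<lambda>i. snd (snd (g i))) (q(k := i))"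
      using k by (auto simp: override_def fun_eq_iff)
    have 3: "[k..<Suc n] = k # [Suc k..<Suc n]" using k by (simp add: upt_conv_Cons del: upt_Suc)
    have 4: "foldr (\<lambda>i. R_op \<kappa> e p i ^^ fst (snd (?c i))) [Suc k..<Suc n] F = ?op g F" for F
      by (rule foldr_cong) auto
    have "?A (s, m, i) g = ?B ?c"
      unfolding 1 2 3 foldr.simps o_apply 4 fst_conv snd_conv fun_upd_same power_add scaleR_scaleR ..
    then show "(case y of (x, c) \<Rightarrow> ?A x c) = (case y of (x, g) \<Rightarrow> ?B (g(k := x)))"
      unfolding y prod.case .
  qed
  also have "\<dots> = sum ?B ((\<lambda>(x, g). g(k := x)) ` (choices k \<times> ?S))"
  proof -
    have "inj_on (\<lambda>(x, g). g(k := x)) (choices k \<times> ?S)" by (rule inj_combinator) simp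
    then show ?thesis by (simp only: sum.reindex o_def case_prod_beta')
  qed
  also have "(\<lambda>(x, g). g(k := x)) ` (choices k \<times> ?S) = Pi\<^sub>E {k..n} choices"
    unfolding kn PiE_insert_eq ..
  finally show ?case .
qed

section \<open>Identification of the expansion with the sum over the addenda\<close>

lemma main_formula:
  "transform \<kappa> r n e (restrict_Q n a b (mpderiv n a b j f)) p \<zeta> =
      R_pow \<kappa> n e p j (transform \<kappa> r n e (restrict_Q n a b f) p) \<zeta> +
      (\<Sum>(l, m, q)\<in>addenda n a b j.
         (-1) ^ (\<Sum>k=1..n. lj l j k) *\<^sub>R
         R_pow \<kappa> n e p m
           (face_transform \<kappa> r n e a b (lj l j) (mpderiv n a b q f) p) \<zeta>)"
proof -
  let ?o = "\<lambda>_::nat. 0::nat"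
  let ?t = "\<lambda>c. (-1) ^ (\<Sum>i=1..n. fst (c i)) *\<^sub>R
    R_pow \<kappa> n e p (\<lambda>i. fst (snd (c i))) (T (\<lambda>i. fst (c i)) (\<lambda>i. snd (snd (c i)))) \<zeta>"
  let ?C = "Pi\<^sub>E {1..n} choices"
  \<comment> \<open>The choice that stays inside the box in every variable; it produces the term
    without boundary.\<close>
  define c0 where "c0 = (\<lambda>k\<in>{1..n}. (0::nat, j k, 0::nat))"
  have ov: "T (override 1 (\<lambda>i. fst (c i)) ?o) (override 1 (\<lambda>i. snd (snd (c i))) j) =
      T (\<lambda>i. fst (c i)) (\<lambda>i. snd (snd (c i)))" for c
    by (rule fun_cong[OF G_cong]) (auto simp: override_def)
  have R_cong: "R_pow \<kappa> n e p m F = R_pow \<kappa> n e p m' F" if "\<And>i. i \<in> {1..n} \<Longrightarrow> m i = m' i" for m m' F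
    unfolding R_pow_def by (rule foldr_cong) (use that in auto)
  have lin: "tame_linear (R_pow \<kappa> n e p m)" for m
    unfolding R_pow_def by (rule tame_linear_foldr) auto
  have "transform \<kappa> r n e (restrict_Q n a b (pd j)) p \<zeta> = T ?o j \<zeta>"
    by (rule transform_eq_G) (simp add: le_j_def)
  also have "\<dots> = (\<Sum>c\<in>?C. (-1) ^ (\<Sum>i=1..n. fst (c i)) *\<^sub>R
    foldr (\<lambda>i. R_op \<kappa> e p i ^^ fst (snd (c i))) [1..<Suc n]
      (T (override 1 (\<lambda>i. fst (c i)) ?o) (override 1 (\<lambda>i. snd (snd (c i))) j)) \<zeta>)"
    by (rule expand_all) (auto simp: ternary_def le_j_def)
  also have "\<dots> = (\<Sum>c\<in>?C. ?t c)"
    by (simp only: ov R_pow_def)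
  also have "\<dots> = ?t c0 + (\<Sum>c\<in>?C - {c0}. ?t c)"
    by (rule sum.remove) (auto simp: c0_def choices_def intro!: finite_PiE)
  also have "?t c0 = R_pow \<kappa> n e p j (transform \<kappa> r n e (restrict_Q n a b f) p) \<zeta>"
  proof -
    have "transform \<kappa> r n e (restrict_Q n a b f) p = T ?o ?o"
      using transform_eq_G[of ?o] mpderiv_zero[of ?o f] by (simp add: le_j_def fun_eq_iff)
    also have "\<dots> = T (\<lambda>i. fst (c0 i)) (\<lambda>i. snd (snd (c0 i)))"
      by (rule fun_cong[OF G_cong]) (auto simp: c0_def)
    finally have "R_pow \<kappa> n e p j (transform \<kappa> r n e (restrict_Q n a b f) p) =
        R_pow \<kappa> n e p (\<lambda>i. fst (snd (c0 i))) (T (\<lambda>i. fst (c0 i)) (\<lambda>i. snd (snd (c0 i))))"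
      by (simp only:) (rule R_cong, simp add: c0_def)
    moreover have "(\<Sum>i=1..n. fst (c0 i)) = 0" by (auto simp: c0_def)
    ultimately show ?thesis by simp
  qed
  also have "(\<Sum>c\<in>?C - {c0}. ?t c) = (\<Sum>(l, m, q)\<in>addenda n a b j.
         (-1) ^ (\<Sum>k=1..n. lj l j k) *\<^sub>R
         R_pow \<kappa> n e p m (face_transform \<kappa> r n e a b (lj l j) (pd q) p) \<zeta>)"
  \<comment> \<open>The remaining choices correspond to the addenda, except that
    \<open>addenda\<close> leaves out faces in a direction unbounded on both sides. These choices
    form S'; their faces lie at infinity and contribute 0.\<close>
  proof (rule sum.reindex_bij_witness_not_neutral[
        where S' = "{c \<in> ?C - {c0}. \<exists>k\<in>{1..n}. a k = - \<infinity> \<and> b k = \<infinity> \<and> fst (c k) \<noteq> 0}" and T' = "{}"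
          and j = "\<lambda>c. (\<lambda>k\<in>{1..n}. fst (c k), \<lambda>k\<in>{1..n}. fst (snd (c k)), \<lambda>k\<in>{1..n}. snd (snd (c k)))"
          and i = "\<lambda>(l, m, q). \<lambda>k\<in>{1..n}. (l k, m k, q k)"])
    show "finite {c \<in> ?C - {c0}. \<exists>k\<in>{1..n}. a k = - \<infinity> \<and> b k = \<infinity> \<and> fst (c k) \<noteq> 0}"
      by (rule finite_subset[of _ ?C]) (auto intro!: finite_PiE)
    fix c assume c: "c \<in> (?C - {c0}) - {c \<in> ?C - {c0}. \<exists>k\<in>{1..n}. a k = - \<infinity> \<and> b k = \<infinity> \<and> fst (c k) \<noteq> 0}"
    show "(\<lambda>(l, m, q). \<lambda>k\<in>{1..n}. (l k, m k, q k))
        (\<lambda>k\<in>{1..n}. fst (c k), \<lambda>k\<in>{1..n}. fst (snd (c k)), \<lambda>k\<in>{1..n}. snd (snd (c k))) = c"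
      using c by (auto simp: fun_eq_iff PiE_iff extensional_def)
    have ck: "fst (c k) \<le> 2 \<and> (fst (c k) = 0 \<longrightarrow> fst (snd (c k)) = j k \<and> snd (snd (c k)) = 0) \<and>
        (fst (c k) \<noteq> 0 \<longrightarrow> fst (snd (c k)) + snd (snd (c k)) + 1 = j k)" if "k \<in> {1..n}" for k
    proof -
      have "c \<in> ?C" using c by blast
      from choicesD[OF PiE_mem[OF this that]] show ?thesis .
    qed
    have "\<exists>k\<in>{1..n}. fst (c k) \<noteq> 0"
    proof (rule ccontr)
      assume "\<not> ?thesis"
      then have "c = c0"
        using c ck by (auto simp: fun_eq_iff c0_def PiE_iff extensional_def prod_eq_iff)
      then show False using c by auto
    qed
    then obtain k0 where k0: "k0 \<in> {1..n}" "fst (c k0) \<noteq> 0" by blast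
    let ?l = "\<lambda>k\<in>{1..n}. fst (c k)" and ?m = "\<lambda>k\<in>{1..n}. fst (snd (c k))" and ?q = "\<lambda>k\<in>{1..n}. snd (snd (c k))"
    have "?l \<in> {1..n} \<rightarrow>\<^sub>E {0, 1, 2}"
    proof (rule restrict_PiE_iff[THEN iffD2], rule ballI)
      fix k assume "k \<in> {1..n}"
      then have "fst (c k) \<le> 2" using ck by blast
      then show "fst (c k) \<in> {0, 1, 2}" by force
    qed
    moreover have "?m \<in> {1..n} \<rightarrow>\<^sub>E UNIV" "?q \<in> {1..n} \<rightarrow>\<^sub>E UNIV" by auto
    moreover have "\<forall>k\<in>{1..n}. j k = 0 \<longrightarrow> ?l k = 0"
    proof (intro ballI impI)
      fix k assume "k \<in> {1..n}" "j k = 0"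
      then show "?l k = 0" using ck[of k] by auto
    qed
    moreover have "\<forall>k\<in>{1..n}. a k = - \<infinity> \<and> b k = \<infinity> \<longrightarrow> ?l k = 0" using c by auto
    moreover have "1 \<le> (\<Sum>k=1..n. lj ?l j k)"
    proof -
      have "1 \<le> lj ?l j k0" using k0 ck[OF k0(1)] by (auto simp: lj_def sign0_def)
      also have "\<dots> \<le> (\<Sum>k=1..n. lj ?l j k)" using k0 by (intro member_le_sum) auto
      finally show ?thesis .
    qed
    moreover have "\<forall>k\<in>{1..n}. ?m k + ?q k + sign0 (?l k * j k) = j k \<and> (?l k * j k = 0 \<longrightarrow> ?q k = 0)"
    proof
      fix k assume "k \<in> {1..n}"
      then show "?m k + ?q k + sign0 (?l k * j k) = j k \<and> (?l k * j k = 0 \<longrightarrow> ?q k = 0)"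
        using ck[of k] by (auto simp: sign0_def)
    qed
    ultimately show "(?l, ?m, ?q) \<in> addenda n a b j - {}"
      unfolding addenda_def Diff_empty mem_Collect_eq prod.case by (intro conjI)
  next
    fix x assume "x \<in> addenda n a b j - {}"
    then obtain l m q where x: "x = (l, m, q)" and lmq: "(l, m, q) \<in> addenda n a b j" by (cases x) auto
    then have l: "l \<in> {1..n} \<rightarrow>\<^sub>E {0, 1, 2}" and mq: "m \<in> {1..n} \<rightarrow>\<^sub>E UNIV" "q \<in> {1..n} \<rightarrow>\<^sub>E UNIV"
      and jl: "\<And>k. k \<in> {1..n} \<Longrightarrow> j k = 0 \<Longrightarrow> l k = 0"
      and inf: "\<And>k. k \<in> {1..n} \<Longrightarrow> a k = - \<infinity> \<and> b k = \<infinity> \<Longrightarrow> l k = 0"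
      and pos: "1 \<le> (\<Sum>k=1..n. lj l j k)"
      and s: "\<And>k. k \<in> {1..n} \<Longrightarrow> m k + q k + sign0 (l k * j k) = j k \<and> (l k * j k = 0 \<longrightarrow> q k = 0)"
      by (simp_all add: addenda_def)
    show "(\<lambda>c. (\<lambda>k\<in>{1..n}. fst (c k), \<lambda>k\<in>{1..n}. fst (snd (c k)), \<lambda>k\<in>{1..n}. snd (snd (c k))))
        ((\<lambda>(l, m, q). \<lambda>k\<in>{1..n}. (l k, m k, q k)) x) = x"
      using l mq unfolding x by (auto simp: fun_eq_iff PiE_iff extensional_def)
    have "\<exists>k\<in>{1..n}. l k \<noteq> 0"
    proof (rule ccontr)
      assume "\<not> ?thesis"
      then have "(\<Sum>k=1..n. lj l j k) = 0" by (simp add: lj_def)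
      then show False using pos by simp
    qed
    then have "(\<lambda>k\<in>{1..n}. (l k, m k, q k)) \<noteq> c0"
      by (auto simp: c0_def fun_eq_iff)
    moreover have "(\<lambda>k\<in>{1..n}. (l k, m k, q k)) \<in> ?C"
    proof (rule restrict_PiE_iff[THEN iffD2], rule ballI)
      fix k assume k: "k \<in> {1..n}"
      have "l k \<le> 2" using PiE_mem[OF l k] by auto
      then show "(l k, m k, q k) \<in> choices k"
        using s[OF k] jl[OF k] by (auto simp: choices_iff sign0_def split: if_splits)
    qed
    moreover have "\<not> (\<exists>k\<in>{1..n}. a k = - \<infinity> \<and> b k = \<infinity> \<and> fst ((\<lambda>k\<in>{1..n}. (l k, m k, q k)) k) \<noteq> 0)"
      using inf by auto
    ultimately show "(\<lambda>(l, m, q). \<lambda>k\<in>{1..n}. (l k, m k, q k)) x \<in>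
        (?C - {c0}) - {c \<in> ?C - {c0}. \<exists>k\<in>{1..n}. a k = - \<infinity> \<and> b k = \<infinity> \<and> fst (c k) \<noteq> 0}"
      unfolding x by simp
  next
    fix c assume "c \<in> {c \<in> ?C - {c0}. \<exists>k\<in>{1..n}. a k = - \<infinity> \<and> b k = \<infinity> \<and> fst (c k) \<noteq> 0}"
    then obtain k where c: "c \<in> ?C" and k: "k \<in> {1..n}" "a k = - \<infinity>" "b k = \<infinity>" "fst (c k) \<noteq> 0" by blast
    have "fst (c k) \<le> 2"
      using choicesD[OF PiE_mem[OF c k(1)]] by blast
    then have "fst (c k) = 1 \<or> fst (c k) = 2" using k(4) by linarith
    then have "\<not> fin_face (\<lambda>i. fst (c i))" unfolding face_finite_def using k by auto
    then have "T (\<lambda>i. fst (c i)) (\<lambda>i. snd (snd (c i))) = (\<lambda>_. 0)" by (simp add: G_def fun_eq_iff)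
    then show "?t c = 0" by (simp add: tame_linear_zero[OF lin])
  next
    fix c assume c: "c \<in> ?C - {c0}"
    let ?l = "\<lambda>k\<in>{1..n}. fst (c k)" and ?m = "\<lambda>k\<in>{1..n}. fst (snd (c k))" and ?q = "\<lambda>k\<in>{1..n}. snd (snd (c k))"
    \<comment> \<open>A nonzero entry forces j k \<ge> 1, so multiplying by
      \<open>sign0 (j k)\<close> changes nothing.\<close>
    have lj: "lj ?l j k = fst (c k)" if "k \<in> {1..n}" for k
    proof -
      have "c \<in> ?C" using c by blast
      from choicesD[OF PiE_mem[OF this that]] show ?thesis
        using that by (auto simp: lj_def sign0_def)
    qed
    have "face_transform \<kappa> r n e a b (lj ?l j) (pd ?q) p = T (\<lambda>i. fst (c i)) (\<lambda>i. snd (snd (c i)))"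
      unfolding face_transform_eq_G[abs_def] by (rule fun_cong[OF G_cong]) (use lj in auto)
    moreover have "R_pow \<kappa> n e p ?m F = R_pow \<kappa> n e p (\<lambda>i. fst (snd (c i))) F" for F
      by (rule R_cong) auto
    moreover have "(\<Sum>k=1..n. lj ?l j k) = (\<Sum>k=1..n. fst (c k))"
      by (rule sum.cong[OF refl lj])
    ultimately show "(case (?l, ?m, ?q) of (l, m, q) \<Rightarrow> (-1) ^ (\<Sum>k=1..n. lj l j k) *\<^sub>R
         R_pow \<kappa> n e p m (face_transform \<kappa> r n e a b (lj l j) (pd q) p) \<zeta>) = ?t c"
      by simp
  qed (rule finite.emptyI, erule emptyE)
  finally show ?thesis .
qed

end

theorem theorem25:
  fixes r n :: nat
    and e :: "nat \<Rightarrow> 'a::euclidean_space"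
    and a b :: "nat \<Rightarrow> ereal"
    and j :: "nat \<Rightarrow> nat"
    and f :: "(nat \<Rightarrow> real) \<Rightarrow> 'a"
    and a1 am1 :: "(nat \<Rightarrow> nat) \<Rightarrow> real"
    and \<kappa> :: kernel
    and p \<zeta> :: 'a
  assumes "2 \<le> r" and "2 ^ (r - 1) \<le> n" and "n \<le> 2 ^ r - 1"
    and "cd_basis r e"
    and "\<forall>k\<in>{1..n}. a k < b k"
    and "mpderivs_exist n a b j f"
    and "original n (restrict_Q n a b f)"
    and "original n (restrict_Q n a b (mpderiv n a b j f))"
    and "\<forall>m\<in>multi_le n j. growth n (a1 m) (am1 m) (restrict_Q n a b (mpderiv n a b m f))"
    and "p \<in> domain_W r n e a b (Max (a1 ` multi_le n j)) (Min (am1 ` multi_le n j))"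
    and "\<forall>k\<in>{n<..<2 ^ r}. p \<bullet> e k = 0" and "\<forall>k\<in>{n<..<2 ^ r}. \<zeta> \<bullet> e k = 0"
  shows "transform \<kappa> r n e (restrict_Q n a b (mpderiv n a b j f)) p \<zeta> =
      R_pow \<kappa> n e p j (transform \<kappa> r n e (restrict_Q n a b f) p) \<zeta> +
      (\<Sum>(l, m, q)\<in>addenda n a b j.
         (-1) ^ (\<Sum>k=1..n. lj l j k) *\<^sub>R
         R_pow \<kappa> n e p m
           (face_transform \<kappa> r n e a b (lj l j) (mpderiv n a b q f) p) \<zeta>)"
proof -
  interpret transform_problem r e n \<kappa> p a b j f a1 am1
    by unfold_locales (use assms in \<open>auto simp: original_def\<close>)
  show ?thesis by (rule main_formula)
qed

end
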